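(* Let $\Phi(z)=\sum_{n\ge0}z^{2^n}$. Then, modulo $8$, \begin{align*} \sum_{n\ge0}s_{n+1}(\Gamma_3(3))\,z^n={}&4z^{62}+4z^{53}+4z^{44}+4z^{35}+6z^{26}+4z^{20}+4z^{14}+4z^{12}+4z^{11}+4z^{10}\\ &+4z^9+4z^5+6z^4+4z^3+4z^2+4z+6+\tfrac{7}{z^2}+\tfrac{7}{z^3}+\tfrac{3}{z^5}+\tfrac{6}{z^6}\\ &+\Big(4z^3+4z^2+\tfrac{4}{z}+\tfrac{6}{z^3}+\tfrac{6}{z^4}+\tfrac{6}{z^6}+\tfrac{2}{z^7}\Big)\Phi(z)\\ &+\Big(4z^8+4z^4+4z^3+6z^2+4+\tfrac{4}{z}+\tfrac{6}{z^2}+\tfrac{2}{z^3}+\tfrac{5}{z^4}+\tfrac{6}{z^5}+\tfrac{6}{z^6}+\tfrac{5}{z^7}\Big)\Phi^2(z)\\ &+\Big(4z^2+\tfrac{4}{z^2}+\tfrac{4}{z^3}+\tfrac{2}{z^4}+\tfrac{4}{z^5}+\tfrac{4}{z^6}+\tfrac{2}{z^7}\Big)\Phi^3(z). \end{align*}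
   Context: $\Gamma_3(3)=\langle x,y\mid x^{6}=y^{9}=1,\ x^2=y^3\rangle=C_6\underset{C_3}{\ast}C_9$. For a finitely generated group $\Gamma$, $s_n(\Gamma)$ denotes the number of subgroups of index $n$ in $\Gamma$. For formal Laurent series with integer coefficients, an equality "modulo $M$" means that coefficients of equal powers of $z$ agree modulo $M$. $\Phi^i(z)$ denotes $(\Phi(z))^i$. *)

theory Defs
  imports
    "HOL-Algebra.Coset"
    "HOL-Number_Theory.Cong"
    "HOL-Computational_Algebra.Formal_Laurent_Series"
begin

section \<open>Groups given by generators and relations\<close>

text \<open>
  The generators are all elements of the type \<open>'a\<close>. A group word is a list of signed generators:
  \<open>(a, True)\<close> stands for the generator \<open>a\<close> and \<open>(a, False)\<close> for its formal inverse.
  A relation \<open>l = r\<close> is a pair \<open>(l, r)\<close> of words.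
\<close>

type_synonym 'a gword = "('a \<times> bool) list"

inductive rel_eq :: "('a gword \<times> 'a gword) set \<Rightarrow> 'a gword \<Rightarrow> 'a gword \<Rightarrow> bool"
  for R :: "('a gword \<times> 'a gword) set"
where
  rel_refl: "rel_eq R u u"
| rel_sym: "rel_eq R u v \<Longrightarrow> rel_eq R v u"
| rel_trans: "rel_eq R u v \<Longrightarrow> rel_eq R v w \<Longrightarrow> rel_eq R u w"
| rel_cancel: "rel_eq R (u @ [(a, b), (a, \<not> b)] @ v) (u @ v)"
| rel_relation: "(l, r) \<in> R \<Longrightarrow> rel_eq R (u @ l @ v) (u @ r @ v)"

definition word_class :: "('a gword \<times> 'a gword) set \<Rightarrow> 'a gword \<Rightarrow> 'a gword set" where
  "word_class R w = {v. rel_eq R w v}"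

definition presented_group :: "('a gword \<times> 'a gword) set \<Rightarrow> 'a gword set monoid" where
  "presented_group R =
     \<lparr>carrier = range (word_class R),
      monoid.mult = (\<lambda>A B. \<Union>u\<in>A. \<Union>v\<in>B. word_class R (u @ v)),
      one = word_class R []\<rparr>"

lemma rel_eq_context:
  assumes "rel_eq R u v"
  shows "rel_eq R (p @ u @ q) (p @ v @ q)"
  using assms
proof induction
  case (rel_cancel u a b v)
  show ?case using rel_eq.rel_cancel[of R "p @ u" a b "v @ q"] by simp
next
  case (rel_relation l r u v)
  then show ?case using rel_eq.rel_relation[of l r R "p @ u" "v @ q"] by simp
next
  case (rel_trans u v w)
  then show ?case by (metis rel_eq.rel_trans)
qed (simp_all add: rel_refl rel_sym)

lemma rel_eq_append:
  assumes "rel_eq R u u'" "rel_eq R v v'"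
  shows "rel_eq R (u @ v) (u' @ v')"
  using rel_eq_context[OF assms(1), of "[]" v] rel_eq_context[OF assms(2), of u' "[]"]
  by (metis append_Nil append_Nil2 rel_trans)

lemma word_class_eq_iff: "word_class R u = word_class R v \<longleftrightarrow> rel_eq R u v"
  unfolding word_class_def by (metis (mono_tags, lifting) Collect_cong mem_Collect_eq rel_refl rel_sym rel_trans)

lemma carrier_presented_group: "carrier (presented_group R) = range (word_class R)"
  by (simp add: presented_group_def)

lemma one_presented_group: "\<one>\<^bsub>presented_group R\<^esub> = word_class R []"
  by (simp add: presented_group_def)

lemma mult_presented_group:
  "word_class R u \<otimes>\<^bsub>presented_group R\<^esub> word_class R v = word_class R (u @ v)"
proof -
  have eq: "word_class R (u' @ v') = word_class R (u @ v)"
    if "u' \<in> word_class R u" "v' \<in> word_class R v" for u' v'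
    unfolding word_class_eq_iff
    using that by (intro rel_eq_append) (simp_all add: word_class_def rel_sym)
  have ne: "word_class R u \<noteq> {}" "word_class R v \<noteq> {}"
    by (auto simp: word_class_def intro: rel_refl)
  have "word_class R u \<otimes>\<^bsub>presented_group R\<^esub> word_class R v =
      (\<Union>u'\<in>word_class R u. \<Union>v'\<in>word_class R v. word_class R (u' @ v'))"
    by (simp add: presented_group_def)
  also have "\<dots> = (\<Union>u'\<in>word_class R u. \<Union>v'\<in>word_class R v. word_class R (u @ v))"
    by (intro SUP_cong refl eq)
  also have "\<dots> = word_class R (u @ v)"
    using ne by simp
  finally show ?thesis .
qed

lemma rel_eq_inverse_left: "rel_eq R (rev (map (map_prod id Not) w) @ w) []"
proof (induction w)
  case (Cons x w)
  obtain a b where x: "x = (a, b)" by force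
  let ?i = "rev (map (map_prod id Not) w)"
  have "rel_eq R (?i @ [(a, \<not> b), (a, b)] @ w) (?i @ w)"
    using rel_cancel[of R ?i a "\<not> b" w] by simp
  from rel_trans[OF this Cons.IH]
  show ?case by (simp add: x id_def)
qed (simp add: rel_refl)

lemma group_presented_group: "group (presented_group R)"
proof (rule groupI)
  fix A assume "A \<in> carrier (presented_group R)"
  then obtain w where A: "A = word_class R w" by (auto simp: carrier_presented_group)
  show "\<exists>B\<in>carrier (presented_group R). B \<otimes>\<^bsub>presented_group R\<^esub> A = \<one>\<^bsub>presented_group R\<^esub>"
    using rel_eq_inverse_left[of R w]
    by (auto simp: A carrier_presented_group one_presented_group mult_presented_group word_class_eq_iff)
qed (auto simp: carrier_presented_group one_presented_group mult_presented_group)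

section \<open>The group and its subgroup counts\<close>

datatype gen = X | Y

abbreviation gen_pow :: "'a \<Rightarrow> nat \<Rightarrow> 'a gword" where
  "gen_pow a n \<equiv> replicate n (a, True)"

definition Gamma33 :: "gen gword set monoid" where
  "Gamma33 = presented_group
     {(gen_pow X 6, []), (gen_pow Y 9, []), (gen_pow X 2, gen_pow Y 3)}"

text \<open>
  The set counted below is finite for finitely generated \<open>G\<close>, so \<open>card\<close> is the true number there.
\<close>

definition num_subgroups :: "('a, 'b) monoid_scheme \<Rightarrow> nat \<Rightarrow> nat" where
  "num_subgroups G n =
     card {H. subgroup H G \<and> finite (rcosets\<^bsub>G\<^esub> H) \<and> card (rcosets\<^bsub>G\<^esub> H) = n}"

section \<open>Laurent series\<close>

text \<open>The sum is taken in the usual (\<open>z\<close>-adic) topology of formal power series.\<close>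

definition Phi_fps :: "int fps" where
  "Phi_fps = (\<Sum>n. fps_X ^ (2 ^ n))"

lemma Phi_fps_sums: "(\<lambda>n. fps_X ^ (2 ^ n)) sums Abs_fps (\<lambda>m. of_bool (\<exists>n. m = 2 ^ n) :: int)"
  (is "_ sums ?P")
  unfolding sums_def
proof (rule tendsto_fpsI)
  fix m :: nat
  have "(\<Sum>i<N. fps_X ^ (2 ^ i) :: int fps) $ m = ?P $ m" if "N > m" for N
  proof -
    have "(\<Sum>i<N. fps_X ^ (2 ^ i) :: int fps) $ m = (\<Sum>i<N. of_bool (m = 2 ^ i))"
      by (simp add: fps_sum_nth of_bool_def del: sum_of_bool_eq)
    also have "\<dots> = of_bool (\<exists>n. m = 2 ^ n)"
    proof (cases "\<exists>n. m = 2 ^ n")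
      case True
      then obtain n where n: "m = 2 ^ n" by blast
      have "n < m" by (simp add: n)
      with that have "n < N" by simp
      have "(\<Sum>i<N. of_bool (m = 2 ^ i) :: int) = (\<Sum>i<N. if i = n then 1 else 0)"
        by (rule sum.cong) (auto simp: n)
      with \<open>n < N\<close> True show ?thesis by simp
    qed simp
    finally show ?thesis by simp
  qed
  then show "\<forall>\<^sub>F N in sequentially. (\<Sum>i<N. fps_X ^ (2 ^ i) :: int fps) $ m = ?P $ m"
    by (auto simp: eventually_sequentially intro!: exI[of _ "Suc m"])
qed

lemma Phi_fps_nth: "Phi_fps $ m = of_bool (\<exists>n. m = 2 ^ n)"
  unfolding Phi_fps_def using sums_unique[OF Phi_fps_sums] by (metis fps_nth_Abs_fps)

definition Phi :: "int fls" where
  "Phi = fps_to_fls Phi_fps"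

abbreviation zpow :: "int \<Rightarrow> int fls" where
  "zpow k \<equiv> fls_X_intpow k"

definition fls_cong :: "int \<Rightarrow> int fls \<Rightarrow> int fls \<Rightarrow> bool" where
  "fls_cong M f g \<longleftrightarrow> (\<forall>k. [fls_nth f k = fls_nth g k] (mod M))"

end

theory Submission
  imports Defs "HOL-Combinatorics.Cycles"
begin

text \<open>
  Let \<open>c = x\<^sup>2 = y\<^sup>3\<close>, a central element of order 3. Counting permutation actions of \<open>\<Gamma>\<close> on \<open>n\<close> points by
  the orbit of a base point gives \<open>H' = S H\<close>, where \<open>H\<close> is the exponential generating function of the
  actions and \<open>S\<close> the series of the subgroup numbers. Splitting the point set into the fixed
  points of \<open>c\<close> and the rest shows \<open>H = H\<^sub>1 H\<^sub>2\<close>, where \<open>H\<^sub>1\<close> counts the actions of the modular group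
  \<open>C\<^sub>2 * C\<^sub>3\<close> and \<open>H\<^sub>2\<close> the actions in which \<open>c\<close> has no fixed point; hence \<open>S = S\<^sub>1 + S\<^sub>2\<close> with integral
  \<open>S\<^sub>i = H\<^sub>i'/H\<^sub>i\<close>. Both \<open>H\<^sub>i\<close> are P-recursive, which yields Riccati type equations for \<open>S\<^sub>1\<close> and \<open>S\<^sub>2\<close>
  with integral coefficients. Modulo 8 each of them has a unique solution: for \<open>S\<^sub>2\<close> it is a polynomial
  in \<open>z\<^sup>9\<close> (up to a shift), for \<open>S\<^sub>1\<close> a cubic polynomial in \<open>\<Phi>\<close>, and the latter is checked with the
  relations that \<open>\<Phi>\<close> satisfies modulo 8.
\<close>

section \<open>Actions of presented groups\<close>

text \<open>The series \<open>H\<close>, \<open>H\<^sub>1\<close> and \<open>H\<^sub>2\<close> have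
  factorials in their denominators, so nothing can be reduced modulo 8 on their level; only the
  logarithmic derivatives are integral. This is why linear differential equations over the rationals
  are first turned into nonlinear ones. Integrality of \<open>S\<^sub>2\<close> needs no count of
  its own: \<open>S\<^sub>1\<close> is the series of subgroup numbers of
  \<open>C\<^sub>2 * C\<^sub>3\<close>, and \<open>S\<^sub>2 = S - S\<^sub>1\<close>. The split
  keeps the equations small. Where \<open>c\<close> is trivial, \<open>x\<close> and
  \<open>y\<close> are independent permutations, and the coefficients are products of two simple
  sequences. Where \<open>c\<close> has no fixed point, \<open>y\<close> consists of 9-cycles and
  \<open>x\<close> is a square root of \<open>y\<^sup>3\<close>, whose number depends only on the
  number of cycles. In both cases the logarithmic derivative satisfies a first-order equation with
  quadratic nonlinearity. After multiplication by a power of \<open>z\<close>, two solutions modulo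
  8 differ by a \<open>D\<close> that reproduces itself with an extra factor \<open>z\<close>, and
  with \<open>z\<^sup>2\<close> in front of the derivative. Hence \<open>D\<close> vanishes modulo 8
  coefficient by coefficient.\<close>

text \<open>Words act from the right, so that point stabilizers are matched by right cosets.\<close>

definition act :: "('a \<Rightarrow> 'b \<Rightarrow> 'b) \<Rightarrow> 'a gword \<Rightarrow> 'b \<Rightarrow> 'b" where
  "act \<sigma> w = fold (\<lambda>(a, e). if e then \<sigma> a else inv_into UNIV (\<sigma> a)) w"

text \<open>Acting permutations are total functions that are the identity off \<open>S\<close>. So
  relations are equalities of functions, and actions on different subsets of one type can be
  restricted and glued.\<close>

definition actions :: "('a gword \<times> 'a gword) set \<Rightarrow> 'b set \<Rightarrow> ('a \<Rightarrow> 'b \<Rightarrow> 'b) set" where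
  "actions R S = {\<sigma>. (\<forall>a. \<sigma> a permutes S) \<and> (\<forall>(l, r)\<in>R. act \<sigma> l = act \<sigma> r)}"

definition gw_inv :: "'a gword \<Rightarrow> 'a gword" where
  "gw_inv w = rev (map (map_prod id Not) w)"

lemma act_Nil [simp]: "act \<sigma> [] = id"
  by (simp add: act_def)

lemma act_append: "act \<sigma> (u @ v) = act \<sigma> v \<circ> act \<sigma> u"
  by (simp add: act_def)

lemma act_Cons: "act \<sigma> ((a, e) # w) = act \<sigma> w \<circ> (if e then \<sigma> a else inv_into UNIV (\<sigma> a))"
  by (simp add: act_def)

lemma act_permutes:
  assumes "\<And>a. \<sigma> a permutes S"
  shows "act \<sigma> w permutes S"
proof (induction w)
  case (Cons x w)
  obtain a e where x: "x = (a, e)" by force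
  have "(if e then \<sigma> a else inv_into UNIV (\<sigma> a)) permutes S"
    using assms by (simp add: permutes_inv)
  from permutes_compose[OF this Cons.IH] show ?case unfolding x act_Cons .
qed (simp add: permutes_id[unfolded id_def] id_def)

lemma actions_permutes: "\<sigma> \<in> actions R S \<Longrightarrow> \<sigma> a permutes S"
  by (simp add: actions_def)

lemma actions_act_permutes: "\<sigma> \<in> actions R S \<Longrightarrow> act \<sigma> w permutes S"
  by (intro act_permutes actions_permutes)

text \<open>Words that are equal in the group move every point alike, so the action descends to
  \<open>presented_group R\<close>. Bijectivity of the generators enters in the cancellation
  rule.\<close>

lemma act_rel_eq:
  assumes "\<sigma> \<in> actions R S" "rel_eq R u v"
  shows "act \<sigma> u = act \<sigma> v"
  using assms(2)
proof induction
  case (rel_cancel u a e v)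
  have "inv_into UNIV (\<sigma> a) \<circ> \<sigma> a = id" "\<sigma> a \<circ> inv_into UNIV (\<sigma> a) = id"
    using permutes_inv_o[OF actions_permutes[OF assms(1), of a]] by simp_all
  then have "act \<sigma> [(a, e), (a, \<not> e)] = id"
    by (simp add: act_Cons)
  then show ?case by (simp only: act_append) simp
next
  case (rel_relation l r u v)
  then have "act \<sigma> l = act \<sigma> r" using assms(1) by (auto simp: actions_def)
  then show ?case by (simp add: act_append)
qed auto

lemma rel_eq_gw_inv: "rel_eq R (gw_inv w @ w) []" "rel_eq R (w @ gw_inv w) []"
proof -
  show l: "rel_eq R (gw_inv w @ w) []" for w :: "'a gword"
    unfolding gw_inv_def by (rule rel_eq_inverse_left)
  have "gw_inv (gw_inv w) = w"
    by (simp add: gw_inv_def rev_map o_def map_idI prod.map_comp split_beta)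
  then show "rel_eq R (w @ gw_inv w) []" using l[of "gw_inv w"] by simp
qed

lemma act_gw_inv:
  assumes "\<sigma> \<in> actions R S"
  shows "act \<sigma> (gw_inv w) (act \<sigma> w p) = p" "act \<sigma> w (act \<sigma> (gw_inv w) p) = p"
  using act_rel_eq[OF assms rel_eq_gw_inv(1)[of R w]] act_rel_eq[OF assms rel_eq_gw_inv(2)[of R w]]
  by (simp_all add: act_append fun_eq_iff)

definition act_orbit :: "('a \<Rightarrow> 'b \<Rightarrow> 'b) \<Rightarrow> 'b \<Rightarrow> 'b set" where
  "act_orbit \<sigma> p = range (\<lambda>w. act \<sigma> w p)"

definition stab :: "('a gword \<times> 'a gword) set \<Rightarrow> ('a \<Rightarrow> 'b \<Rightarrow> 'b) \<Rightarrow> 'b \<Rightarrow> 'a gword set set" where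
  "stab R \<sigma> p = word_class R ` {w. act \<sigma> w p = p}"

text \<open>\<open>stab\<close> only provides some representative that fixes \<open>p\<close>; by
  invariance under \<open>rel_eq\<close> every representative then does.\<close>

lemma word_class_in_stab_iff:
  assumes "\<sigma> \<in> actions R S"
  shows "word_class R w \<in> stab R \<sigma> p \<longleftrightarrow> act \<sigma> w p = p"
  using act_rel_eq[OF assms] by (auto simp: stab_def word_class_eq_iff)

lemma subgroup_stab:
  assumes "\<sigma> \<in> actions R S"
  shows "subgroup (stab R \<sigma> p) (presented_group R)"
proof -
  interpret G: group "presented_group R" by (rule group_presented_group)
  show ?thesis
  proof (rule G.subgroupI)
    show "stab R \<sigma> p \<subseteq> carrier (presented_group R)"
      by (auto simp: stab_def carrier_presented_group)
    show "stab R \<sigma> p \<noteq> {}"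
      using word_class_in_stab_iff[OF assms, of "[]" p] by auto
  next
    fix A assume "A \<in> stab R \<sigma> p"
    then obtain w where w: "A = word_class R w" "act \<sigma> w p = p" by (auto simp: stab_def)
    have "inv\<^bsub>presented_group R\<^esub> A = word_class R (gw_inv w)"
      using rel_eq_gw_inv(1)[of R w]
      by (intro G.inv_equality) (auto simp: w mult_presented_group one_presented_group
          carrier_presented_group word_class_eq_iff)
    moreover have "act \<sigma> (gw_inv w) p = p"
      using act_gw_inv(1)[OF assms, of w p] w by simp
    ultimately show "inv\<^bsub>presented_group R\<^esub> A \<in> stab R \<sigma> p"
      by (simp add: word_class_in_stab_iff[OF assms])
  next
    fix A B assume "A \<in> stab R \<sigma> p" "B \<in> stab R \<sigma> p"
    then obtain u v where "A = word_class R u" "act \<sigma> u p = p" "B = word_class R v" "act \<sigma> v p = p"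
      by (auto simp: stab_def)
    then show "A \<otimes>\<^bsub>presented_group R\<^esub> B \<in> stab R \<sigma> p"
      by (simp add: mult_presented_group word_class_in_stab_iff[OF assms] act_append)
  qed
qed


section \<open>Cosets of point stabilizers\<close>

lemma rcosets_presented_group:
  "rcosets\<^bsub>presented_group R\<^esub> H = range (\<lambda>w. H #>\<^bsub>presented_group R\<^esub> word_class R w)"
  by (auto simp: RCOSETS_def carrier_presented_group)

lemma r_coset_eq_iff:
  assumes "subgroup H (presented_group R)"
  shows "H #>\<^bsub>presented_group R\<^esub> word_class R u = H #>\<^bsub>presented_group R\<^esub> word_class R v
    \<longleftrightarrow> word_class R (u @ gw_inv v) \<in> H" (is "?L \<longleftrightarrow> ?R")
proof -
  interpret G: group "presented_group R" by (rule group_presented_group)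
  have sub: "H \<subseteq> carrier (presented_group R)" using assms by (rule subgroup.subset)
  have car: "word_class R w \<in> carrier (presented_group R)" for w
    by (simp add: carrier_presented_group)
  have inv: "word_class R v \<otimes>\<^bsub>presented_group R\<^esub> word_class R (gw_inv v) = \<one>\<^bsub>presented_group R\<^esub>"
    using rel_eq_gw_inv(2)[of R v]
    by (simp add: mult_presented_group one_presented_group word_class_eq_iff)
  show ?thesis
  proof
    assume ?L
    then have "H #>\<^bsub>presented_group R\<^esub> word_class R u #>\<^bsub>presented_group R\<^esub> word_class R (gw_inv v)
      = H #>\<^bsub>presented_group R\<^esub> \<one>\<^bsub>presented_group R\<^esub>"
      using G.coset_mult_assoc[OF sub car car, of v "gw_inv v"] inv by simp
    then have "H #>\<^bsub>presented_group R\<^esub> word_class R (u @ gw_inv v) = H"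
      using sub G.coset_mult_assoc[OF sub car car] by (simp add: mult_presented_group)
    then show ?R using G.coset_join1[OF _ car assms] sub by blast
  next
    assume ?R
    then have "H #>\<^bsub>presented_group R\<^esub> word_class R (u @ gw_inv v) = H"
      using G.coset_join2[OF car assms] by blast
    then have "H #>\<^bsub>presented_group R\<^esub> word_class R (u @ gw_inv v) #>\<^bsub>presented_group R\<^esub> word_class R v
      = H #>\<^bsub>presented_group R\<^esub> word_class R v"
      by simp
    moreover have "word_class R ((u @ gw_inv v) @ v) = word_class R u"
      using rel_eq_append[OF rel_refl[of R u] rel_eq_gw_inv(1)[of R v]]
      by (simp add: word_class_eq_iff)
    ultimately show ?L
      using G.coset_mult_assoc[OF sub car car, of "u @ gw_inv v" v] by (simp add: mult_presented_group)
  qed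
qed

text \<open>Orbit-stabilizer theorem: under a right action \<open>u\<close> and \<open>v\<close>
  send \<open>p\<close> to the same point exactly when \<open>u v\<^sup>-\<^sup>1\<close> fixes
  \<open>p\<close>, which is equality of right cosets.\<close>

lemma bij_betw_rcosets_stab:
  assumes "\<sigma> \<in> actions R S"
  shows "\<exists>\<phi>. bij_betw \<phi> (rcosets\<^bsub>presented_group R\<^esub> (stab R \<sigma> p)) (act_orbit \<sigma> p)"
proof -
  let ?G = "presented_group R" and ?H = "stab R \<sigma> p"
  have eq: "?H #>\<^bsub>?G\<^esub> word_class R u = ?H #>\<^bsub>?G\<^esub> word_class R v \<longleftrightarrow> act \<sigma> u p = act \<sigma> v p" for u v
    unfolding r_coset_eq_iff[OF subgroup_stab[OF assms]] word_class_in_stab_iff[OF assms]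
    by (metis act_append act_gw_inv[OF assms] comp_apply)
  define f where "f M = act \<sigma> (SOME w. M = ?H #>\<^bsub>?G\<^esub> word_class R w) p" for M
  have f: "f (?H #>\<^bsub>?G\<^esub> word_class R w) = act \<sigma> w p" for w
    unfolding f_def using someI[of "\<lambda>v. ?H #>\<^bsub>?G\<^esub> word_class R w = ?H #>\<^bsub>?G\<^esub> word_class R v" w] eq by metis
  show ?thesis
    by (rule exI[of _ f])
      (auto simp: bij_betw_def inj_on_def rcosets_presented_group act_orbit_def f eq image_image)
qed

section \<open>Restriction and gluing of actions\<close>

text \<open>That \<open>T\<close> is mapped onto itself is used for the inverse letters: a point of
  \<open>T\<close> must have its preimage under \<open>\<sigma> a\<close> in \<open>T\<close> as
  well, where both permutations agree.\<close>

lemma act_agree: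
  assumes "\<And>a. bij (\<sigma> a)" "\<And>a. bij (\<tau> a)" "\<And>a. \<sigma> a ` T = T"
    and agree: "\<And>a i. i \<in> T \<Longrightarrow> \<sigma> a i = \<tau> a i" and "i \<in> T"
  shows "act \<sigma> w i = act \<tau> w i \<and> act \<sigma> w i \<in> T"
  using \<open>i \<in> T\<close>
proof (induction w arbitrary: i)
  case (Cons x w)
  obtain a e where x: "x = (a, e)" by force
  have "(if e then \<sigma> a else inv_into UNIV (\<sigma> a)) i = (if e then \<tau> a else inv_into UNIV (\<tau> a)) i
    \<and> (if e then \<sigma> a else inv_into UNIV (\<sigma> a)) i \<in> T"
  proof (cases e)
    case True
    then show ?thesis using agree assms(3)[of a] Cons.prems by auto
  next
    case False
    obtain j where j: "j \<in> T" "i = \<sigma> a j" using assms(3)[of a] Cons.prems by blast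
    then have "inv_into UNIV (\<sigma> a) i = j" "inv_into UNIV (\<tau> a) i = j"
      using agree[of j a] inv_f_f[OF bij_is_inj[OF assms(1)], of a j] inv_f_f[OF bij_is_inj[OF assms(2)], of a j]
      by simp_all
    then show ?thesis using False j by simp
  qed
  then show ?case using Cons.IH by (metis act_Cons comp_apply x)
qed simp

lemma actions_bij: "\<sigma> \<in> actions R S \<Longrightarrow> bij (\<sigma> a)"
  by (rule permutes_bij[OF actions_permutes])

definition restr :: "'b set \<Rightarrow> ('a \<Rightarrow> 'b \<Rightarrow> 'b) \<Rightarrow> 'a \<Rightarrow> 'b \<Rightarrow> 'b" where
  "restr T \<sigma> = (\<lambda>a i. if i \<in> T then \<sigma> a i else i)"

lemma restr_permutes:
  assumes "\<sigma> \<in> actions R S" "\<And>a. \<sigma> a ` T = T"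
  shows "restr T \<sigma> a permutes T"
proof (rule bij_imp_permutes)
  have "inj_on (\<sigma> a) T"
    using actions_bij[OF assms(1)] by (metis bij_is_inj inj_on_subset subset_UNIV)
  moreover have "restr T \<sigma> a ` T = T"
    using assms(2)[of a] by (auto simp: restr_def)
  ultimately show "bij_betw (restr T \<sigma> a) T T"
    by (simp add: bij_betw_def restr_def inj_on_def)
qed (simp add: restr_def)

lemma act_restr:
  assumes "\<sigma> \<in> actions R S" "\<And>a. \<sigma> a ` T = T"
  shows "act (restr T \<sigma>) w i = (if i \<in> T then act \<sigma> w i else i)"
proof (cases "i \<in> T")
  case True
  have "act \<sigma> w i = act (restr T \<sigma>) w i \<and> act \<sigma> w i \<in> T"
    using assms actions_bij[OF assms(1)] permutes_bij[OF restr_permutes[OF assms]] True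
    by (intro act_agree) (auto simp: restr_def)
  then show ?thesis using True by simp
next
  case False
  then show ?thesis
    using act_permutes[of "restr T \<sigma>" T w, OF restr_permutes[OF assms]]
    by (simp add: permutes_not_in)
qed

lemma restr_actions:
  assumes "\<sigma> \<in> actions R S" "\<And>a. \<sigma> a ` T = T"
  shows "restr T \<sigma> \<in> actions R T"
  using restr_permutes[OF assms] assms(1)
  by (auto simp: actions_def fun_eq_iff act_restr[OF assms])

text \<open>Points outside both domains fall under the second branch, where \<open>\<rho>\<close> is
  already the identity.\<close>

definition glue :: "'b set \<Rightarrow> ('a \<Rightarrow> 'b \<Rightarrow> 'b) \<Rightarrow> ('a \<Rightarrow> 'b \<Rightarrow> 'b) \<Rightarrow> 'a \<Rightarrow> 'b \<Rightarrow> 'b" where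
  "glue T \<tau> \<rho> = (\<lambda>a i. if i \<in> T then \<tau> a i else \<rho> a i)"

lemma glue_permutes:
  assumes "\<tau> \<in> actions R T" "\<rho> \<in> actions R U" "T \<inter> U = {}"
  shows "glue T \<tau> \<rho> a permutes (T \<union> U)"
proof (rule bij_imp_permutes)
  have t: "bij_betw (\<tau> a) T T" and r: "bij_betw (\<rho> a) U U"
    using actions_permutes[OF assms(1)] actions_permutes[OF assms(2)] by (simp_all add: permutes_imp_bij)
  have "bij_betw (glue T \<tau> \<rho> a) T T"
    using t by (rule bij_betw_cong[THEN iffD1, rotated]) (simp add: glue_def)
  moreover have "bij_betw (glue T \<tau> \<rho> a) U U"
    using r by (rule bij_betw_cong[THEN iffD1, rotated]) (use assms(3) in \<open>auto simp: glue_def\<close>)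
  ultimately show "bij_betw (glue T \<tau> \<rho> a) (T \<union> U) (T \<union> U)"
    using assms(3) by (rule bij_betw_combine)
qed (use permutes_not_in[OF actions_permutes[OF assms(2)]] in \<open>auto simp: glue_def\<close>)

lemma glue_image:
  assumes "\<tau> \<in> actions R T"
  shows "glue T \<tau> \<rho> a ` T = T"
  using permutes_image[OF actions_permutes[OF assms], of a] by (simp add: glue_def)

lemma glue_image':
  assumes "\<rho> \<in> actions R U" "T \<inter> U = {}"
  shows "glue T \<tau> \<rho> a ` U = U"
proof -
  have "glue T \<tau> \<rho> a ` U = \<rho> a ` U"
    by (rule image_cong) (use assms(2) in \<open>auto simp: glue_def\<close>)
  then show ?thesis using permutes_image[OF actions_permutes[OF assms(1)], of a] by simp
qed

lemma act_glue:
  assumes "\<tau> \<in> actions R T" "\<rho> \<in> actions R U" "T \<inter> U = {}"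
  shows "act (glue T \<tau> \<rho>) w i = (if i \<in> T then act \<tau> w i else act \<rho> w i)"
proof -
  have b: "bij (glue T \<tau> \<rho> a)" for a by (rule permutes_bij[OF glue_permutes[OF assms]])
  consider "i \<in> T" | "i \<in> U" | "i \<notin> T \<union> U" by blast
  then show ?thesis
  proof cases
    case 1
    have "act (glue T \<tau> \<rho>) w i = act \<tau> w i \<and> act (glue T \<tau> \<rho>) w i \<in> T"
      by (rule act_agree[OF b actions_bij[OF assms(1)] glue_image[OF assms(1)] _ 1])
        (simp add: glue_def)
    then show ?thesis using 1 by simp
  next
    case 2
    have "act (glue T \<tau> \<rho>) w i = act \<rho> w i \<and> act (glue T \<tau> \<rho>) w i \<in> U"
      by (rule act_agree[OF b actions_bij[OF assms(2)] glue_image'[OF assms(2,3)] _ 2])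
        (use assms(3) in \<open>auto simp: glue_def\<close>)
    then show ?thesis using 2 assms(3) by auto
  next
    case 3
    then have "act (glue T \<tau> \<rho>) w i = i"
      by (rule permutes_not_in[OF act_permutes[OF glue_permutes[OF assms]]])
    moreover have "act \<rho> w i = i"
      by (rule permutes_not_in[OF actions_act_permutes[OF assms(2)]]) (use 3 in blast)
    moreover have "i \<notin> T" using 3 by blast
    ultimately show ?thesis by simp
  qed
qed

lemma glue_actions:
  assumes "\<tau> \<in> actions R T" "\<rho> \<in> actions R U" "T \<inter> U = {}"
  shows "glue T \<tau> \<rho> \<in> actions R (T \<union> U)"
  using glue_permutes[OF assms] assms(1,2)
  by (auto simp: actions_def fun_eq_iff act_glue[OF assms])

lemma restr_glue:
  assumes "\<tau> \<in> actions R T" "\<rho> \<in> actions R U" "T \<inter> U = {}"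
  shows "restr T (glue T \<tau> \<rho>) = \<tau>" "restr U (glue T \<tau> \<rho>) = \<rho>"
  using permutes_not_in[OF actions_permutes[OF assms(1)]]
    permutes_not_in[OF actions_permutes[OF assms(2)]] assms(3)
  by (auto simp: restr_def glue_def fun_eq_iff)

lemma image_Diff_permutes:
  assumes "f permutes S" "f ` T = T"
  shows "f ` (S - T) = S - T"
  using assms by (metis image_set_diff permutes_image permutes_inj)

text \<open>Restriction to the two invariant parts and gluing are inverse to each other. The
  predicates \<open>P\<close> and \<open>Q\<close> let one bijection serve both for splitting off
  the orbit of a point and for splitting off the fixed points of \<open>c\<close>.\<close>

lemma card_actions_split:
  assumes "T \<subseteq> S"
  shows "card {\<sigma> \<in> actions R S. (\<forall>a. \<sigma> a ` T = T) \<and> P (restr T \<sigma>) \<and> Q (restr (S - T) \<sigma>)}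
    = card {\<tau> \<in> actions R T. P \<tau>} * card {\<rho> \<in> actions R (S - T). Q \<rho>}"
    (is "card ?A = card ?B * card ?C")
proof -
  have ST: "T \<union> (S - T) = S" using assms by blast
  have "bij_betw (\<lambda>\<sigma>. (restr T \<sigma>, restr (S - T) \<sigma>)) ?A (?B \<times> ?C)"
  proof (rule bij_betw_byWitness[where f' = "\<lambda>(\<tau>, \<rho>). glue T \<tau> \<rho>"])
    show "\<forall>\<sigma>\<in>?A. (case (restr T \<sigma>, restr (S - T) \<sigma>) of (\<tau>, \<rho>) \<Rightarrow> glue T \<tau> \<rho>) = \<sigma>"
    proof
      fix \<sigma> assume "\<sigma> \<in> ?A"
      then have "\<sigma> a i = i" if "i \<notin> S" for a i
        using that permutes_not_in[OF actions_permutes, of \<sigma> R S] by simp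
      then have "glue T (restr T \<sigma>) (restr (S - T) \<sigma>) a i = \<sigma> a i" for a i
        by (simp add: glue_def restr_def)
      then show "(case (restr T \<sigma>, restr (S - T) \<sigma>) of (\<tau>, \<rho>) \<Rightarrow> glue T \<tau> \<rho>) = \<sigma>"
        by (auto intro!: ext)
    qed
    show "\<forall>x\<in>?B \<times> ?C. (restr T (case x of (\<tau>, \<rho>) \<Rightarrow> glue T \<tau> \<rho>),
        restr (S - T) (case x of (\<tau>, \<rho>) \<Rightarrow> glue T \<tau> \<rho>)) = x"
      by (auto simp: restr_glue[of _ R T _ "S - T"])
    show "(\<lambda>\<sigma>. (restr T \<sigma>, restr (S - T) \<sigma>)) ` ?A \<subseteq> ?B \<times> ?C"
    proof
      fix x assume "x \<in> (\<lambda>\<sigma>. (restr T \<sigma>, restr (S - T) \<sigma>)) ` ?A"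
      then obtain \<sigma> where x: "x = (restr T \<sigma>, restr (S - T) \<sigma>)" and \<sigma>: "\<sigma> \<in> ?A" by blast
      have inv: "\<sigma> a ` T = T" "\<sigma> a ` (S - T) = S - T" for a
        using \<sigma> image_Diff_permutes[OF actions_permutes[of \<sigma> R S a], of T] by auto
      have "restr T \<sigma> \<in> actions R T" "restr (S - T) \<sigma> \<in> actions R (S - T)"
        using \<sigma> restr_actions[of \<sigma> R S, OF _ inv(1)] restr_actions[of \<sigma> R S, OF _ inv(2)] by simp_all
      moreover have "P (restr T \<sigma>)" "Q (restr (S - T) \<sigma>)" using \<sigma> by blast+
      ultimately show "x \<in> ?B \<times> ?C" unfolding x by blast
    qed
    show "(\<lambda>(\<tau>, \<rho>). glue T \<tau> \<rho>) ` (?B \<times> ?C) \<subseteq> ?A"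
    proof
      fix \<sigma> assume "\<sigma> \<in> (\<lambda>(\<tau>, \<rho>). glue T \<tau> \<rho>) ` (?B \<times> ?C)"
      then obtain x where x: "x \<in> ?B \<times> ?C" "\<sigma> = (case x of (\<tau>, \<rho>) \<Rightarrow> glue T \<tau> \<rho>)" by (rule imageE)
      obtain \<tau> \<rho> where "x = (\<tau>, \<rho>)" by (rule prod.exhaust)
      with x have \<sigma>: "\<sigma> = glue T \<tau> \<rho>" and \<tau>: "\<tau> \<in> ?B" and \<rho>: "\<rho> \<in> ?C" by simp_all
      have *: "\<tau> \<in> actions R T" "\<rho> \<in> actions R (S - T)" "T \<inter> (S - T) = {}" using \<tau> \<rho> by auto
      show "\<sigma> \<in> ?A"
        using glue_actions[OF *, unfolded ST] restr_glue[OF *] glue_image[OF *(1)] \<tau> \<rho> unfolding \<sigma> by auto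
    qed
  qed
  from bij_betw_same_card[OF this] show ?thesis unfolding card_cartesian_product .
qed

lemma finite_actions:
  assumes "finite (UNIV :: 'a set)" "finite S"
  shows "finite (actions R S :: ('a \<Rightarrow> 'b \<Rightarrow> 'b) set)"
proof (rule finite_subset)
  show "actions R S \<subseteq> PiE UNIV (\<lambda>_::'a. {f. f permutes S})"
    by (auto simp: actions_def)
  show "finite (PiE UNIV (\<lambda>_::'a. {f :: 'b \<Rightarrow> 'b. f permutes S}))"
    using assms by (intro finite_PiE finite_permutations)
qed

section \<open>Orbits of a base point\<close>

lemma self_in_act_orbit: "p \<in> act_orbit \<sigma> p"
  unfolding act_orbit_def by (rule range_eqI[of _ _ "[]"]) simp

lemma act_orbit_subset:
  assumes "\<sigma> \<in> actions R S" "p \<in> S"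
  shows "act_orbit \<sigma> p \<subseteq> S"
  using actions_act_permutes[OF assms(1)] assms(2) by (auto simp: act_orbit_def permutes_in_image)

lemma act_orbit_image:
  assumes "\<sigma> \<in> actions R S"
  shows "\<sigma> a ` act_orbit \<sigma> p = act_orbit \<sigma> p"
proof
  show "\<sigma> a ` act_orbit \<sigma> p \<subseteq> act_orbit \<sigma> p"
  proof
    fix q assume "q \<in> \<sigma> a ` act_orbit \<sigma> p"
    then obtain w where "q = \<sigma> a (act \<sigma> w p)" by (auto simp: act_orbit_def)
    then have "q = act \<sigma> (w @ [(a, True)]) p" by (simp add: act_append act_Cons)
    then show "q \<in> act_orbit \<sigma> p" by (auto simp: act_orbit_def)
  qed
  show "act_orbit \<sigma> p \<subseteq> \<sigma> a ` act_orbit \<sigma> p"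
  proof
    fix q assume "q \<in> act_orbit \<sigma> p"
    then obtain w where w: "q = act \<sigma> w p" by (auto simp: act_orbit_def)
    have "q = \<sigma> a (act \<sigma> (w @ [(a, False)]) p)"
      using actions_bij[OF assms, of a] by (simp add: w act_append act_Cons surj_f_inv_f bij_is_surj)
    then show "q \<in> \<sigma> a ` act_orbit \<sigma> p" by (auto simp: act_orbit_def)
  qed
qed

text \<open>An orbit is invariant, so the action splits there; transitivity is imposed on the orbit
  and nothing on the complement.\<close>

lemma card_actions_orbit:
  assumes "T \<subseteq> S" "p \<in> T"
  shows "card {\<sigma> \<in> actions R S. act_orbit \<sigma> p = T}
    = card {\<tau> \<in> actions R T. act_orbit \<tau> p = T} * card (actions R (S - T))"
proof -
  have *: "act_orbit (restr T \<sigma>) p = act_orbit \<sigma> p" if "\<sigma> \<in> actions R S" "\<And>a. \<sigma> a ` T = T" for \<sigma>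
    using assms(2) by (simp add: act_orbit_def act_restr[OF that])
  have "{\<sigma> \<in> actions R S. act_orbit \<sigma> p = T}
    = {\<sigma> \<in> actions R S. (\<forall>a. \<sigma> a ` T = T) \<and> act_orbit (restr T \<sigma>) p = T \<and> True}"
    (is "?L = ?M")
  proof (intro equalityI subsetI)
    fix \<sigma> assume "\<sigma> \<in> ?L"
    then have \<sigma>: "\<sigma> \<in> actions R S" and T: "act_orbit \<sigma> p = T" by simp_all
    have inv: "\<sigma> a ` T = T" for a using act_orbit_image[OF \<sigma>] T by blast
    show "\<sigma> \<in> ?M" using \<sigma> T inv *[OF \<sigma> inv] by blast
  next
    fix \<sigma> assume "\<sigma> \<in> ?M"
    then have \<sigma>: "\<sigma> \<in> actions R S" and inv: "\<And>a. \<sigma> a ` T = T"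
      and T: "act_orbit (restr T \<sigma>) p = T" by blast+
    show "\<sigma> \<in> ?L" using \<sigma> T *[OF \<sigma> inv] by simp
  qed
  then show ?thesis
    using card_actions_split[OF assms(1), of R "\<lambda>\<tau>. act_orbit \<tau> p = T" "\<lambda>_. True"] by simp
qed

section \<open>Subgroups as stabilizers of transitive actions\<close>

definition relabel :: "('b \<Rightarrow> 'b) \<Rightarrow> ('a \<Rightarrow> 'b \<Rightarrow> 'b) \<Rightarrow> 'a \<Rightarrow> 'b \<Rightarrow> 'b" where
  "relabel \<pi> \<sigma> = (\<lambda>a. \<pi> \<circ> \<sigma> a \<circ> inv_into UNIV \<pi>)"

lemma act_relabel:
  assumes "bij \<pi>" "\<And>a. bij (\<sigma> a)"
  shows "act (relabel \<pi> \<sigma>) w (\<pi> i) = \<pi> (act \<sigma> w i)"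
proof (induction w arbitrary: i)
  case (Cons x w)
  obtain a e where x: "x = (a, e)" by force
  have inj: "inj \<pi>" using assms(1) by (rule bij_is_inj)
  have r: "relabel \<pi> \<sigma> a (\<pi> j) = \<pi> (\<sigma> a j)" for j
    by (simp add: relabel_def inv_f_f[OF inj])
  have "bij (relabel \<pi> \<sigma> a)"
    unfolding relabel_def by (intro bij_comp bij_imp_bij_inv assms)
  then have "inv_into UNIV (relabel \<pi> \<sigma> a) (\<pi> i) = \<pi> (inv_into UNIV (\<sigma> a) i)"
    using r[of "inv_into UNIV (\<sigma> a) i"] surj_f_inv_f[OF bij_is_surj[OF assms(2)], of a i]
    by (intro inv_f_eq) (simp_all add: bij_is_inj)
  then have "(if e then relabel \<pi> \<sigma> a else inv_into UNIV (relabel \<pi> \<sigma> a)) (\<pi> i)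
    = \<pi> ((if e then \<sigma> a else inv_into UNIV (\<sigma> a)) i)"
    using r[of i] by simp
  then show ?case unfolding x act_Cons comp_apply using Cons.IH by simp
qed simp

lemma actions_rel: "\<sigma> \<in> actions R S \<Longrightarrow> (l, r) \<in> R \<Longrightarrow> act \<sigma> l = act \<sigma> r"
  unfolding actions_def by blast

lemma actionsI:
  assumes "\<And>a. \<sigma> a permutes S" "\<And>l r. (l, r) \<in> R \<Longrightarrow> act \<sigma> l = act \<sigma> r"
  shows "\<sigma> \<in> actions R S"
  using assms unfolding actions_def by blast

lemma relabel_actions:
  assumes "\<sigma> \<in> actions R T" "\<pi> permutes T"
  shows "relabel \<pi> \<sigma> \<in> actions R T"
proof -
  have bij: "bij \<pi>" using assms(2) by (rule permutes_bij)
  have j: "\<pi> (inv_into UNIV \<pi> j) = j" for j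
    by (rule surj_f_inv_f[OF bij_is_surj[OF bij]])
  have act: "act (relabel \<pi> \<sigma>) w j = \<pi> (act \<sigma> w (inv_into UNIV \<pi> j))" for w j
    using act_relabel[of \<pi> \<sigma> w "inv_into UNIV \<pi> j", OF bij actions_bij[OF assms(1)]] by (simp only: j)
  show ?thesis
  proof (rule actionsI)
    show "relabel \<pi> \<sigma> a permutes T" for a
      unfolding relabel_def
      by (intro permutes_compose permutes_inv assms(2) actions_permutes[OF assms(1)])
    show "act (relabel \<pi> \<sigma>) l = act (relabel \<pi> \<sigma>) r" if "(l, r) \<in> R" for l r
      by (rule ext) (simp only: act actions_rel[OF assms(1) that])
  qed
qed

definition transitive_actions :: "('a gword \<times> 'a gword) set \<Rightarrow> 'b set \<Rightarrow> 'b \<Rightarrow> ('a \<Rightarrow> 'b \<Rightarrow> 'b) set" where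
  "transitive_actions R T p = {\<sigma> \<in> actions R T. act_orbit \<sigma> p = T}"

lemma transitive_actionsD:
  assumes "\<sigma> \<in> transitive_actions R T p"
  shows "\<sigma> \<in> actions R T" "act_orbit \<sigma> p = T"
  using assms by (simp_all add: transitive_actions_def)

text \<open>Which of the points reached from \<open>p\<close> coincide is decided by the stabilizer
  alone. This makes the relabelling between two actions with equal stabilizers well defined and
  injective.\<close>

lemma stab_eq_imp_act_eq_iff:
  assumes "\<sigma> \<in> actions R T" "\<tau> \<in> actions R T" "stab R \<sigma> p = stab R \<tau> p"
  shows "act \<sigma> u p = act \<sigma> v p \<longleftrightarrow> act \<tau> u p = act \<tau> v p"
proof -
  have *: "act \<rho> u p = act \<rho> v p \<longleftrightarrow> word_class R (u @ gw_inv v) \<in> stab R \<rho> p"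
    if "\<rho> \<in> actions R T" for \<rho>
    unfolding word_class_in_stab_iff[OF that] act_append comp_apply
    using act_gw_inv[OF that, of v] by metis
  show ?thesis using *[OF assms(1)] *[OF assms(2)] assms(3) by simp
qed

lemma relabel_transitive:
  assumes \<sigma>: "\<sigma> \<in> transitive_actions R T p" and p: "p \<in> T" and \<pi>: "\<pi> permutes (T - {p})"
  shows "relabel \<pi> \<sigma> \<in> transitive_actions R T p \<and> stab R (relabel \<pi> \<sigma>) p = stab R \<sigma> p"
proof -
  note \<sigma> = transitive_actionsD[OF \<sigma>]
  have bij: "bij \<pi>" using \<pi> by (rule permutes_bij)
  have T: "\<pi> permutes T" using \<pi> by (rule permutes_subset) blast
  have "\<pi> p = p" using \<pi> by (rule permutes_not_in) blast
  then have act: "act (relabel \<pi> \<sigma>) w p = \<pi> (act \<sigma> w p)" for w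
    using act_relabel[of \<pi> \<sigma> w p, OF bij actions_bij[OF \<sigma>(1)]] by simp
  have "act_orbit (relabel \<pi> \<sigma>) p = \<pi> ` act_orbit \<sigma> p"
    by (auto simp: act_orbit_def act)
  then have "act_orbit (relabel \<pi> \<sigma>) p = T"
    using permutes_image[OF T] \<sigma>(2) by simp
  moreover have "act (relabel \<pi> \<sigma>) w p = p \<longleftrightarrow> act \<sigma> w p = p" for w
    using act[of w] \<open>\<pi> p = p\<close> bij_is_inj[OF bij] by (metis injD)
  ultimately show ?thesis
    using relabel_actions[OF \<sigma>(1) T] by (simp add: transitive_actions_def stab_def)
qed

text \<open>
  Actions that are transitive on \<open>T\<close> and have the same stabilizer of \<open>p\<close> differ by a unique relabelling
  of \<open>T - {p}\<close>: send \<open>p \<cdot> w\<close> under the first action to \<open>p \<cdot> w\<close> under the second.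
\<close>

lemma relabel_ex:
  assumes \<sigma>: "\<sigma> \<in> transitive_actions R T p" and \<tau>: "\<tau> \<in> transitive_actions R T p"
    and stab: "stab R \<sigma> p = stab R \<tau> p"
  shows "\<exists>\<pi>. \<pi> permutes (T - {p}) \<and> \<tau> = relabel \<pi> \<sigma>"
proof -
  note \<sigma> = transitive_actionsD[OF \<sigma>] and \<tau> = transitive_actionsD[OF \<tau>]
  note iff = stab_eq_imp_act_eq_iff[OF \<sigma>(1) \<tau>(1) stab]
  define \<pi> where "\<pi> q = (if q \<in> T then act \<tau> (SOME w. act \<sigma> w p = q) p else q)" for q
  have inT: "act \<sigma> w p \<in> T" "act \<tau> w p \<in> T" for w
    using \<sigma>(2) \<tau>(2) by (auto simp: act_orbit_def)
  have \<pi>: "\<pi> (act \<sigma> w p) = act \<tau> w p" for w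
  proof -
    have "act \<sigma> (SOME v. act \<sigma> v p = act \<sigma> w p) p = act \<sigma> w p"
      by (rule someI_ex) blast
    then show ?thesis using inT iff by (simp add: \<pi>_def)
  qed
  have ex: "\<exists>w. q = act \<sigma> w p" if "q \<in> T" for q
    using that \<sigma>(2) by (auto simp: act_orbit_def)
  have "bij_betw \<pi> T T"
    unfolding bij_betw_def
  proof
    show "inj_on \<pi> T"
    proof (rule inj_onI)
      fix q q' assume "q \<in> T" "q' \<in> T" and eq: "\<pi> q = \<pi> q'"
      obtain w w' where w: "q = act \<sigma> w p" "q' = act \<sigma> w' p"
        using ex[OF \<open>q \<in> T\<close>] ex[OF \<open>q' \<in> T\<close>] by (elim exE)
      show "q = q'" using eq iff[of w w'] \<pi>[of w] \<pi>[of w'] by (simp add: w)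
    qed
    show "\<pi> ` T = T"
    proof (intro equalityI subsetI)
      fix y assume "y \<in> \<pi> ` T"
      then obtain q where q: "q \<in> T" "y = \<pi> q" by (elim imageE)
      obtain w where w: "q = act \<sigma> w p" using ex[OF q(1)] by (elim exE)
      show "y \<in> T" using \<pi>[of w] inT(2)[of w] by (simp add: q w)
    next
      fix y assume "y \<in> T"
      then obtain w where "y = act \<tau> w p" using \<tau>(2) by (auto simp: act_orbit_def)
      then have "y = \<pi> (act \<sigma> w p)" by (simp add: \<pi>)
      then show "y \<in> \<pi> ` T" using inT(1) by (rule image_eqI)
    qed
  qed
  then have permT: "\<pi> permutes T"
    by (rule bij_imp_permutes) (simp add: \<pi>_def)
  have bij: "bij \<pi>" using permT by (rule permutes_bij)
  have "\<pi> p = p" using \<pi>[of "[]"] by simp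
  with permT have perm: "\<pi> permutes (T - {p})"
    by (auto intro: permutes_superset)
  have "\<tau> a i = relabel \<pi> \<sigma> a i" for a i
  proof (cases "i \<in> T")
    case True
    then obtain w where w: "i = act \<tau> w p" using \<tau>(2) by (auto simp: act_orbit_def)
    then have i: "i = \<pi> (act \<sigma> w p)" by (simp add: \<pi>)
    have "relabel \<pi> \<sigma> a i = \<pi> (\<sigma> a (act \<sigma> w p))"
      by (simp add: relabel_def i inv_f_f[OF bij_is_inj[OF bij]])
    also have "\<sigma> a (act \<sigma> w p) = act \<sigma> (w @ [(a, True)]) p"
      by (simp add: act_append act_Cons)
    also have "\<pi> \<dots> = \<tau> a i"
      unfolding \<pi> by (simp add: act_append act_Cons w)
    finally show ?thesis ..
  next
    case False
    then have "\<tau> a i = i" "relabel \<pi> \<sigma> a i = i"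
      using permutes_not_in[OF actions_permutes[OF \<tau>(1)]]
        permutes_not_in[OF actions_permutes[OF relabel_actions[OF \<sigma>(1) permT]]] by simp_all
    then show ?thesis by simp
  qed
  then have "\<tau> = relabel \<pi> \<sigma>" by (intro ext)
  with perm show ?thesis by (intro exI conjI)
qed

text \<open>The permutations of \<open>T - {p}\<close> act simply transitively on these actions:
  existence is \<open>relabel_ex\<close>, and by transitivity a relabelling is determined by its
  effect on the points reached from \<open>p\<close>.\<close>

lemma card_transitive_stab_eq:
  assumes \<sigma>: "\<sigma> \<in> transitive_actions R T p" and "finite T" and p: "p \<in> T"
  shows "card {\<tau> \<in> transitive_actions R T p. stab R \<tau> p = stab R \<sigma> p} = fact (card T - 1)"
proof -
  have "{\<tau> \<in> transitive_actions R T p. stab R \<tau> p = stab R \<sigma> p}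
    = (\<lambda>\<pi>. relabel \<pi> \<sigma>) ` {\<pi>. \<pi> permutes (T - {p})}" (is "?A = ?f ` ?P")
  proof (intro equalityI subsetI)
    fix \<tau> assume "\<tau> \<in> ?A"
    then have "\<tau> \<in> transitive_actions R T p" "stab R \<sigma> p = stab R \<tau> p" by simp_all
    from relabel_ex[OF \<sigma> this] obtain \<pi> where "\<pi> permutes (T - {p})" "\<tau> = relabel \<pi> \<sigma>"
      by (elim exE conjE)
    then show "\<tau> \<in> ?f ` ?P" by simp
  next
    fix \<tau> assume "\<tau> \<in> ?f ` ?P"
    then obtain \<pi> where "\<tau> = relabel \<pi> \<sigma>" "\<pi> permutes (T - {p})" by (elim imageE) simp
    then show "\<tau> \<in> ?A" using relabel_transitive[OF \<sigma> p] by simp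
  qed
  moreover have "inj_on ?f ?P"
  proof (rule inj_onI)
    fix \<pi> \<pi>' assume "\<pi> \<in> ?P" "\<pi>' \<in> ?P" and eq: "relabel \<pi> \<sigma> = relabel \<pi>' \<sigma>"
    then have P: "\<pi> permutes (T - {p})" "\<pi>' permutes (T - {p})" by simp_all
    have fp: "\<pi> p = p" "\<pi>' p = p" using permutes_not_in[OF P(1)] permutes_not_in[OF P(2)] by simp_all
    have "\<pi> i = \<pi>' i" for i
    proof (cases "i \<in> T")
      case True
      then obtain w where w: "i = act \<sigma> w p"
        using transitive_actionsD(2)[OF \<sigma>] by (auto simp: act_orbit_def)
      show ?thesis
        using act_relabel[of \<pi> \<sigma> w p, OF permutes_bij[OF P(1)] actions_bij[OF transitive_actionsD(1)[OF \<sigma>]]]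
          act_relabel[of \<pi>' \<sigma> w p, OF permutes_bij[OF P(2)] actions_bij[OF transitive_actionsD(1)[OF \<sigma>]]]
        by (simp add: w eq fp)
    next
      case False
      then show ?thesis using permutes_not_in[OF P(1)] permutes_not_in[OF P(2)] by simp
    qed
    then show "\<pi> = \<pi>'" by (intro ext)
  qed
  ultimately have "card ?A = card ?P" by (simp add: card_image)
  also have "\<dots> = fact (card T - 1)"
    using p \<open>finite T\<close> by (subst card_permutations[of _ "card T - 1"]) simp_all
  finally show ?thesis .
qed

text \<open>The model is right multiplication on the cosets of \<open>H\<close>, carried over to
  \<open>T\<close> by a bijection.\<close>

lemma transitive_action_exists:
  assumes H: "subgroup H (presented_group R)" and fin: "finite (rcosets\<^bsub>presented_group R\<^esub> H)"
    and card: "card (rcosets\<^bsub>presented_group R\<^esub> H) = card T" and "finite T" "p \<in> T"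
  shows "\<exists>\<sigma>\<in>transitive_actions R T p. stab R \<sigma> p = H"
proof -
  let ?G = "presented_group R"
  let ?C = "rcosets\<^bsub>?G\<^esub> H"
  interpret G: group ?G by (rule group_presented_group)
  have sub: "H \<subseteq> carrier ?G" using H by (rule subgroup.subset)
  have car: "word_class R w \<in> carrier ?G" for w by (simp add: carrier_presented_group)
  have HC: "H \<in> ?C"
    using G.coset_mult_one[OF sub] unfolding rcosets_presented_group one_presented_group by (metis rangeI)
  have "card (?C - {H}) = card (T - {p})" using fin \<open>finite T\<close> HC \<open>p \<in> T\<close> card by simp
  \<comment> \<open>The coset \<open>H\<close> is matched with \<open>p\<close> separately, since
    only then is the stabilizer of \<open>p\<close> equal to \<open>H\<close> and not merely to a
    conjugate.\<close>
  then obtain g where g: "bij_betw g (?C - {H}) (T - {p})"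
    using finite_same_card_bij[of "?C - {H}" "T - {p}"] fin \<open>finite T\<close> by auto
  define \<phi> where "\<phi> M = (if M = H then p else g M)" for M
  have "bij_betw \<phi> (?C - {H}) (T - {p})"
    using g by (rule bij_betw_cong[THEN iffD1, rotated]) (simp add: \<phi>_def)
  moreover have "bij_betw \<phi> {H} {p}" by (simp add: \<phi>_def)
  ultimately have "bij_betw \<phi> ((?C - {H}) \<union> {H}) ((T - {p}) \<union> {p})"
    by (rule bij_betw_combine) simp
  then have bij: "bij_betw \<phi> ?C T" using HC \<open>p \<in> T\<close> by (simp add: insert_absorb)
  have step: "H #>\<^bsub>?G\<^esub> word_class R u #>\<^bsub>?G\<^esub> word_class R v = H #>\<^bsub>?G\<^esub> word_class R (u @ v)" for u v
    using G.coset_mult_assoc[OF sub car car] by (simp add: mult_presented_group)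
  have stepC: "M #>\<^bsub>?G\<^esub> word_class R v \<in> ?C" if "M \<in> ?C" for M v
    using that step unfolding rcosets_presented_group by (elim rangeE) simp
  have step': "M #>\<^bsub>?G\<^esub> word_class R u #>\<^bsub>?G\<^esub> word_class R v = M #>\<^bsub>?G\<^esub> word_class R (u @ v)"
    if "M \<in> ?C" for M u v
    using that step unfolding rcosets_presented_group by (elim rangeE) simp
  have stepN: "M #>\<^bsub>?G\<^esub> word_class R [] = M" if "M \<in> ?C" for M
    using that step[of _ "[]"] unfolding rcosets_presented_group by (elim rangeE) simp
  have cancel: "word_class R [(a, e), (a, \<not> e)] = word_class R []" for a e
    using rel_cancel[of R "[]" a e "[]"] by (simp add: word_class_eq_iff)
  define \<psi> where "\<psi> = inv_into ?C \<phi>"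
  have \<psi>: "\<psi> (\<phi> M) = M" if "M \<in> ?C" for M
    using bij that by (simp add: \<psi>_def bij_betw_def)
  have \<phi>\<psi>: "\<phi> (\<psi> i) = i" "\<psi> i \<in> ?C" if "i \<in> T" for i
    using bij that by (simp_all add: \<psi>_def bij_betw_inv_into_right bij_betw_def inv_into_into)
  have \<phi>T: "\<phi> M \<in> T" if "M \<in> ?C" for M
    using bij that by (auto simp: bij_betw_def)
  define \<sigma> where "\<sigma> a i = (if i \<in> T then \<phi> (\<psi> i #>\<^bsub>?G\<^esub> word_class R [(a, True)]) else i)" for a i
  \<comment> \<open>The action of the inverse letter is defined on its own; that it inverts
    \<open>\<sigma> a\<close> is then what proves bijectivity.\<close>
  define \<sigma>' where "\<sigma>' a i = (if i \<in> T then \<phi> (\<psi> i #>\<^bsub>?G\<^esub> word_class R [(a, False)]) else i)" for a i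
  have inv1: "\<sigma>' a (\<sigma> a i) = i" and inv2: "\<sigma> a (\<sigma>' a i) = i" for a i
    using cancel[of a True] cancel[of a False]
    by (auto simp: \<sigma>_def \<sigma>'_def \<phi>T \<psi> \<phi>\<psi> stepC step' stepN)
  have inv: "inv_into UNIV (\<sigma> a) = \<sigma>' a" for a
    by (rule inv_equality) (rule inv1 inv2)+
  have perm: "\<sigma> a permutes T" for a
  proof (rule bij_imp_permutes)
    show "bij_betw (\<sigma> a) T T"
      by (rule bij_betw_byWitness[where f' = "\<sigma>' a"])
        (auto simp: inv1 inv2, auto simp: \<sigma>_def \<sigma>'_def \<phi>T stepC \<phi>\<psi>)
  qed (simp add: \<sigma>_def)
  have act: "act \<sigma> w (\<phi> M) = \<phi> (M #>\<^bsub>?G\<^esub> word_class R w)" if "M \<in> ?C" for w M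
    using that
  proof (induction w arbitrary: M)
    case Nil
    then show ?case by (simp add: stepN)
  next
    case (Cons x w)
    obtain a e where x: "x = (a, e)" by (rule prod.exhaust)
    have "(if e then \<sigma> a else \<sigma>' a) (\<phi> M) = \<phi> (M #>\<^bsub>?G\<^esub> word_class R [(a, e)])"
      using \<phi>T[OF Cons.prems] by (simp add: \<sigma>_def \<sigma>'_def \<psi>[OF Cons.prems])
    then show ?case
      unfolding x act_Cons comp_apply inv
      using Cons.IH[OF stepC[OF Cons.prems]] step'[OF Cons.prems, of "[(a, e)]" w] by simp
  qed
  have rel: "act \<sigma> l = act \<sigma> r" if "(l, r) \<in> R" for l r
  proof
    fix i
    have wc: "word_class R l = word_class R r"
      using rel_relation[OF that, of "[]" "[]"] by (simp add: word_class_eq_iff)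
    show "act \<sigma> l i = act \<sigma> r i"
    proof (cases "i \<in> T")
      case True
      then show ?thesis using act[OF \<phi>\<psi>(2)[OF True]] \<phi>\<psi>(1)[OF True] wc by metis
    next
      case False
      then show ?thesis
        using permutes_not_in[OF act_permutes[of \<sigma> T, OF perm]] by simp
    qed
  qed
  have \<sigma>: "\<sigma> \<in> actions R T" using perm rel by (rule actionsI)
  have actp: "act \<sigma> w p = \<phi> (H #>\<^bsub>?G\<^esub> word_class R w)" for w
    using act[OF HC] by (simp add: \<phi>_def)
  have "act_orbit \<sigma> p = \<phi> ` ?C"
    by (simp add: act_orbit_def actp rcosets_presented_group image_image)
  then have "act_orbit \<sigma> p = T" using bij by (simp add: bij_betw_def)
  moreover have "stab R \<sigma> p = H"
  proof -
    have "word_class R w \<in> stab R \<sigma> p \<longleftrightarrow> word_class R w \<in> H" for w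
    proof -
      have "word_class R w \<in> stab R \<sigma> p \<longleftrightarrow> \<phi> (H #>\<^bsub>?G\<^esub> word_class R w) = \<phi> H"
        unfolding word_class_in_stab_iff[OF \<sigma>] actp by (simp add: \<phi>_def)
      also have "\<dots> \<longleftrightarrow> H #>\<^bsub>?G\<^esub> word_class R w = H"
        using bij stepC[OF HC, of w] HC by (auto simp: bij_betw_def inj_on_def)
      also have "\<dots> \<longleftrightarrow> word_class R w \<in> H"
        using G.coset_join1[OF _ car H] G.coset_join2[OF car H] sub by metis
      finally show ?thesis .
    qed
    moreover have "stab R \<sigma> p \<subseteq> range (word_class R)" by (auto simp: stab_def)
    moreover have "H \<subseteq> range (word_class R)" using sub by (simp add: carrier_presented_group)
    ultimately show ?thesis by blast
  qed
  ultimately show ?thesis using \<sigma> by (auto simp: transitive_actions_def)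
qed

text \<open>Transitive actions are sorted by the stabilizer of \<open>p\<close>: every subgroup of
  index \<open>card T\<close> occurs, and all fibres have the same size.\<close>

lemma card_transitive_actions:
  fixes R :: "('a::finite gword \<times> 'a gword) set"
  assumes "finite T" "p \<in> T"
  shows "card (transitive_actions R T p)
    = fact (card T - 1) * num_subgroups (presented_group R) (card T)"
proof -
  let ?H = "{H. subgroup H (presented_group R) \<and> finite (rcosets\<^bsub>presented_group R\<^esub> H)
    \<and> card (rcosets\<^bsub>presented_group R\<^esub> H) = card T}"
  let ?A = "transitive_actions R T p"
  have finA: "finite ?A"
    using finite_actions[of T R] assms by (simp add: transitive_actions_def)
  have img: "(\<lambda>\<sigma>. stab R \<sigma> p) ` ?A = ?H"
  proof (intro equalityI subsetI)
    fix H assume "H \<in> (\<lambda>\<sigma>. stab R \<sigma> p) ` ?A"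
    then obtain \<sigma> where \<sigma>: "\<sigma> \<in> ?A" "H = stab R \<sigma> p" by (elim imageE)
    note \<sigma>' = transitive_actionsD[OF \<sigma>(1)]
    from bij_betw_rcosets_stab[OF \<sigma>'(1), of p] obtain \<phi>
      where "bij_betw \<phi> (rcosets\<^bsub>presented_group R\<^esub> H) T"
      unfolding \<sigma>'(2) \<sigma>(2) by (elim exE)
    then show "H \<in> ?H"
      using subgroup_stab[OF \<sigma>'(1), of p] assms(1) \<sigma>(2)
      by (simp add: bij_betw_same_card bij_betw_finite)
  next
    fix H assume "H \<in> ?H"
    then show "H \<in> (\<lambda>\<sigma>. stab R \<sigma> p) ` ?A"
      using transitive_action_exists[of H R T p] assms by (auto simp: image_iff)
  qed
  have "card ?A = (\<Sum>H\<in>?H. \<Sum>\<sigma>\<in>{\<sigma>\<in>?A. stab R \<sigma> p = H}. 1)"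
    using sum.group[of ?A ?H "\<lambda>\<sigma>. stab R \<sigma> p" "\<lambda>_. 1::nat"] finA finite_imageI[OF finA] img
    by (metis card_eq_sum order_refl)
  also have "\<dots> = (\<Sum>H\<in>?H. fact (card T - 1))"
  proof (rule sum.cong)
    fix H assume "H \<in> ?H"
    then obtain \<sigma> where \<sigma>: "\<sigma> \<in> ?A" "H = stab R \<sigma> p" unfolding img[symmetric] by (elim imageE)
    show "(\<Sum>\<sigma>\<in>{\<sigma>\<in>?A. stab R \<sigma> p = H}. 1) = fact (card T - 1)"
      using card_transitive_stab_eq[OF \<sigma>(1) assms] by (simp add: \<sigma>(2))
  qed simp
  finally show ?thesis by (simp add: num_subgroups_def mult.commute)
qed

section \<open>The recursion behind \<open>H' = S H\<close>\<close>

lemma sum_subsets_by_card: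
  fixes g :: "nat \<Rightarrow> nat"
  assumes "finite S"
  shows "(\<Sum>A\<in>Pow S. g (card A)) = (\<Sum>k\<le>card S. (card S choose k) * g k)"
proof -
  have "card ` Pow S \<subseteq> {..card S}"
    using card_mono[OF assms] by auto
  then have "(\<Sum>A\<in>Pow S. g (card A)) = (\<Sum>k\<le>card S. \<Sum>A\<in>{A \<in> Pow S. card A = k}. g (card A))"
    using sum.group[of "Pow S" "{..card S}" card "\<lambda>A. g (card A)"] assms by simp
  also have "\<dots> = (\<Sum>k\<le>card S. (card S choose k) * g k)"
    by (rule sum.cong) (simp_all add: n_subsets[OF assms])
  finally show ?thesis .
qed

lemma sum_pointed_subsets:
  assumes "p \<in> S"
  shows "(\<Sum>T | T \<subseteq> S \<and> p \<in> T. g T) = (\<Sum>A\<in>Pow (S - {p}). g (insert p A))"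
  using assms
  by (intro sum.reindex_bij_witness[where i = "insert p" and j = "\<lambda>T. T - {p}"])
    (auto simp: insert_absorb)

definition num_actions :: "('a gword \<times> 'a gword) set \<Rightarrow> nat \<Rightarrow> nat" where
  "num_actions R n = card (actions R {..<n})"

text \<open>Actions are sorted by the orbit of \<open>p\<close>. The summation set is the orbit
  without \<open>p\<close>, so that the factorial of the transitive count becomes
  \<open>fact (card A)\<close>.\<close>

lemma card_actions_rec:
  fixes R :: "('a::finite gword \<times> 'a gword) set"
  assumes "finite S" "p \<in> S"
  shows "card (actions R S) = (\<Sum>A\<in>Pow (S - {p}).
    fact (card A) * num_subgroups (presented_group R) (Suc (card A)) * card (actions R (S - {p} - A)))"
proof -
  let ?I = "{T. T \<subseteq> S \<and> p \<in> T}"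
  have "card (actions R S) = (\<Sum>T\<in>?I. \<Sum>\<sigma>\<in>{\<sigma>\<in>actions R S. act_orbit \<sigma> p = T}. 1)"
  proof -
    have "(\<lambda>\<sigma>. act_orbit \<sigma> p) ` actions R S \<subseteq> ?I"
    proof
      fix T assume "T \<in> (\<lambda>\<sigma>. act_orbit \<sigma> p) ` actions R S"
      then obtain \<sigma> where "\<sigma> \<in> actions R S" "T = act_orbit \<sigma> p" by (elim imageE)
      then show "T \<in> ?I" using act_orbit_subset[of \<sigma> R S p] self_in_act_orbit[of p \<sigma>] assms by simp
    qed
    then show ?thesis
      using sum.group[of "actions R S" ?I "\<lambda>\<sigma>. act_orbit \<sigma> p" "\<lambda>_. 1::nat"] assms(1)
        finite_actions[of S R] by simp
  qed
  also have "\<dots> = (\<Sum>T\<in>?I. fact (card T - 1) * num_subgroups (presented_group R) (card T)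
      * card (actions R (S - T)))"
  proof (rule sum.cong)
    fix T assume T: "T \<in> ?I"
    then have "finite T" "p \<in> T" "T \<subseteq> S" using assms(1) finite_subset by auto
    then show "(\<Sum>\<sigma>\<in>{\<sigma>\<in>actions R S. act_orbit \<sigma> p = T}. 1) =
      fact (card T - 1) * num_subgroups (presented_group R) (card T) * card (actions R (S - T))"
      using card_actions_orbit[of T S p R] card_transitive_actions[of T p R]
      by (simp add: transitive_actions_def)
  qed simp
  also have "\<dots> = (\<Sum>A\<in>Pow (S - {p}). fact (card A) * num_subgroups (presented_group R) (Suc (card A))
      * card (actions R (S - {p} - A)))"
    unfolding sum_pointed_subsets[OF assms(2)]
  proof (rule sum.cong)
    fix A assume A: "A \<in> Pow (S - {p})"
    then have "finite A" "p \<notin> A" using assms(1) finite_subset[of A S] by auto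
    moreover have "S - insert p A = S - {p} - A" by blast
    ultimately show "fact (card (insert p A) - 1) * num_subgroups (presented_group R) (card (insert p A))
      * card (actions R (S - insert p A)) = fact (card A)
      * num_subgroups (presented_group R) (Suc (card A)) * card (actions R (S - {p} - A))" by simp
  qed simp
  finally show ?thesis .
qed

text \<open>Instead of transporting actions along a bijection, the recursion is used: by induction
  its right-hand side sees only cardinalities, hence so does the left-hand side.\<close>

lemma card_actions:
  fixes R :: "('a::finite gword \<times> 'a gword) set" and S :: "nat set"
  assumes "finite S"
  shows "card (actions R S) = num_actions R (card S)"
proof -
  have "card (actions R S) = card (actions R S')"
    if "finite S" "finite S'" "card S = n" "card S' = n" for S S' :: "nat set" and n
    using that
  proof (induction n arbitrary: S S' rule: less_induct)
    case (less n)
    show ?case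
    proof (cases "n = 0")
      case True
      then have "S = S'" using less.prems by simp
      then show ?thesis by simp
    next
      case False
      then obtain p p' where p: "p \<in> S" "p' \<in> S'" using less.prems by fastforce
      define h where "h k = card (actions R {..<k})" for k :: nat
      have h: "card (actions R (V - {q} - A)) = h (n - 1 - card A)"
        if "finite V" "card V = n" "q \<in> V" "A \<in> Pow (V - {q})" for V :: "nat set" and q A
      proof -
        have "finite A" using that finite_subset[of A V] by auto
        then have c: "card (V - {q} - A) = n - 1 - card A"
          using that by (simp add: card_Diff_subset)
        show ?thesis unfolding h_def
          by (rule less.IH[of "n - 1 - card A"]) (use c that False in simp_all)
      qed
      define c where "c k = fact k * num_subgroups (presented_group R) (Suc k) * h (n - 1 - k)" for k
      have "card (actions R V) = (\<Sum>k\<le>n - 1. (n - 1 choose k) * c k)"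
        if "finite V" "card V = n" "q \<in> V" for V :: "nat set" and q
      proof -
        have "card (actions R V) = (\<Sum>A\<in>Pow (V - {q}). c (card A))"
          unfolding card_actions_rec[OF that(1,3)]
          by (intro sum.cong) (simp_all add: c_def h[OF that])
        also have "\<dots> = (\<Sum>k\<le>n - 1. (n - 1 choose k) * c k)"
          using that by (subst sum_subsets_by_card) simp_all
        finally show ?thesis .
      qed
      from this[OF less.prems(1,3) p(1)] this[OF less.prems(2,4) p(2)] show ?thesis by simp
    qed
  qed
  from this[OF assms _ refl, of "{..<card S}"] show ?thesis by (simp add: num_actions_def)
qed

text \<open>Divided by \<open>n!\<close>, this is the coefficient of index \<open>n\<close> in
  \<open>H' = S H\<close>.\<close>

theorem num_actions_Suc:
  fixes R :: "('a::finite gword \<times> 'a gword) set"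
  shows "num_actions R (Suc n) = (\<Sum>k\<le>n. (n choose k) *
    (fact k * num_subgroups (presented_group R) (Suc k) * num_actions R (n - k)))"
proof -
  have "num_actions R (Suc n) = (\<Sum>A\<in>Pow ({..<Suc n} - {n}).
      fact (card A) * num_subgroups (presented_group R) (Suc (card A)) * num_actions R (n - card A))"
    unfolding num_actions_def[of R "Suc n"] card_actions_rec[of "{..<Suc n}" n R, simplified]
  proof (rule sum.cong)
    fix A assume A: "A \<in> Pow ({..<Suc n} - {n})"
    then have "finite A" using finite_subset[of A "{..<Suc n}"] by auto
    then have "card ({..<Suc n} - {n} - A) = n - card A" using A by (simp add: card_Diff_subset)
    then show "fact (card A) * num_subgroups (presented_group R) (Suc (card A)) *
        card (actions R ({..<Suc n} - {n} - A)) =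
        fact (card A) * num_subgroups (presented_group R) (Suc (card A)) * num_actions R (n - card A)"
      by (simp add: card_actions)
  qed simp
  also have "{..<Suc n} - {n} = {..<n}" by auto
  finally show ?thesis
    by (simp add: sum_subsets_by_card[of "{..<n}"
        "\<lambda>k. fact k * num_subgroups (presented_group R) (Suc k) * num_actions R (n - k)"])
qed

section \<open>Permutations with prescribed cycle lengths\<close>

lemma funpow_agree:
  assumes "\<And>i. i \<in> T \<Longrightarrow> f i = g i \<and> f i \<in> T" "i \<in> T"
  shows "(f ^^ n) i = (g ^^ n) i \<and> (f ^^ n) i \<in> T"
proof (induction n)
  case (Suc n)
  then show ?case using assms(1)[of "(f ^^ n) i"] by auto
qed (use assms(2) in simp)

lemma least_power_agree:
  assumes "\<And>i. i \<in> T \<Longrightarrow> f i = g i \<and> f i \<in> T" "i \<in> T"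
  shows "least_power f i = least_power g i"
  using funpow_agree[OF assms] by (simp add: least_power_def)

lemma permutes_imp_permutation: "f permutes S \<Longrightarrow> finite S \<Longrightarrow> permutation f"
  by (auto simp: permutation_permutes)

text \<open>\<open>least_power f i\<close> is the length of the cycle through \<open>i\<close>, so
  \<open>D\<close> prescribes the cycle lengths; fixed points inside \<open>U\<close> count as
  cycles of length 1.\<close>

definition cycle_perms :: "nat set \<Rightarrow> 'b set \<Rightarrow> ('b \<Rightarrow> 'b) set" where
  "cycle_perms D U = {f. f permutes U \<and> (\<forall>i\<in>U. least_power f i \<in> D)}"

lemma funpow_cycle_of_list:
  assumes "distinct cs" "j < length cs"
  shows "(cycle_of_list cs ^^ n) (cs ! j) = cs ! ((j + n) mod length cs)"
proof -
  have "map (cycle_of_list cs ^^ n) cs ! j = rotate n cs ! j"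
    using cyclic_rotation[OF assms(1)] by simp
  then show ?thesis using assms(2) by (simp add: nth_rotate add.commute)
qed

text \<open>Two numbers are equal if they divide the same numbers, and the powers of the cycle that
  fix \<open>i\<close> are those whose exponent is a multiple of its length.\<close>

lemma least_power_cycle_of_list:
  assumes "distinct cs" "i \<in> set cs"
  shows "least_power (cycle_of_list cs) i = length cs"
proof -
  obtain j where j: "j < length cs" "i = cs ! j" using assms(2) by (auto simp: in_set_conv_nth)
  have perm: "permutation (cycle_of_list cs)" by (rule permutation_of_cycle)
  have "least_power (cycle_of_list cs) i dvd n \<longleftrightarrow> length cs dvd n" for n
  proof -
    have "least_power (cycle_of_list cs) i dvd n \<longleftrightarrow> cs ! ((j + n) mod length cs) = cs ! j"
      unfolding least_power_dvd[OF perm] j(2) funpow_cycle_of_list[OF assms(1) j(1)] ..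
    also have "\<dots> \<longleftrightarrow> (j + n) mod length cs = j"
    proof -
      have "(j + n) mod length cs < length cs" using j by (intro mod_less_divisor) auto
      then show ?thesis using nth_eq_iff_index_eq[OF assms(1) _ j(1)] by simp
    qed
    also have "\<dots> \<longleftrightarrow> (j + n) mod length cs = (j + 0) mod length cs" using j by simp
    also have "\<dots> \<longleftrightarrow> length cs dvd n"
      by (metis cong_add_lcancel_nat cong_0_iff cong_def)
    finally show ?thesis .
  qed
  then show ?thesis by (metis dvd_antisym dvd_refl)
qed

lemma support_cycle_of_list:
  assumes "distinct cs" "cs \<noteq> []"
  shows "support (cycle_of_list cs) (hd cs) = cs"
proof (rule nth_equalityI)
  have len: "least_power (cycle_of_list cs) (hd cs) = length cs"
    using assms by (intro least_power_cycle_of_list) auto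
  show "length (support (cycle_of_list cs) (hd cs)) = length cs" by (simp add: len)
  fix k assume "k < length (support (cycle_of_list cs) (hd cs))"
  then have k: "k < length cs" by (simp add: len)
  show "support (cycle_of_list cs) (hd cs) ! k = cs ! k"
    using funpow_cycle_of_list[OF assms(1), of 0 k] assms(2) k by (simp add: len flip: hd_conv_nth)
qed

lemma cycle_of_list_image: "cycle_of_list cs ` set cs = set cs"
  by (rule permutes_image[OF cycle_permutes])

text \<open>A prescribed cycle can be removed or inserted freely if the condition
  \<open>\<Phi>\<close> is local: at \<open>i\<close> it may depend on \<open>f\<close> only through
  an invariant set around \<open>i\<close>. This covers both cycle lengths and the equation
  \<open>f (f i) = c i\<close>.\<close>

lemma card_extend_cycle:
  fixes \<Phi> :: "('b \<Rightarrow> 'b) \<Rightarrow> 'b \<Rightarrow> bool"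
  assumes cong: "\<And>f g V i. (\<And>j. j \<in> V \<Longrightarrow> f j = g j \<and> f j \<in> V) \<Longrightarrow> i \<in> V \<Longrightarrow> \<Phi> f i = \<Phi> g i"
    and "set cs \<subseteq> U" and \<Phi>: "\<And>i. i \<in> set cs \<Longrightarrow> \<Phi> (cycle_of_list cs) i"
  shows "card {f. f permutes U \<and> (\<forall>i\<in>U. \<Phi> f i) \<and> (\<forall>i\<in>set cs. f i = cycle_of_list cs i)}
    = card {f. f permutes (U - set cs) \<and> (\<forall>i\<in>U - set cs. \<Phi> f i)}"
proof (rule bij_betw_same_card)
  let ?t = "cycle_of_list cs" and ?V = "U - set cs"
  let ?r = "\<lambda>f i. if i \<in> ?V then f i else i"
  let ?A = "{f. f permutes U \<and> (\<forall>i\<in>U. \<Phi> f i) \<and> (\<forall>i\<in>set cs. f i = ?t i)}"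
  let ?B = "{f. f permutes ?V \<and> (\<forall>i\<in>?V. \<Phi> f i)}"
  have A: "f permutes U" "\<And>i. i \<in> U \<Longrightarrow> \<Phi> f i"
    "\<And>i. i \<in> set cs \<Longrightarrow> f i = ?t i" "f ` ?V = ?V" if "f \<in> ?A" for f
  proof -
    show f: "f permutes U" and "\<And>i. i \<in> U \<Longrightarrow> \<Phi> f i" and t: "\<And>i. i \<in> set cs \<Longrightarrow> f i = ?t i"
      using that by auto
    have "f ` set cs = set cs"
      using t cycle_of_list_image[of cs] by (metis image_cong)
    with f show "f ` ?V = ?V" by (rule image_Diff_permutes)
  qed
  have B: "z permutes ?V" "\<And>i. i \<in> ?V \<Longrightarrow> \<Phi> z i"
    "\<And>i. i \<in> set cs \<Longrightarrow> (?t \<circ> z) i = ?t i" "\<And>i. i \<notin> set cs \<Longrightarrow> (?t \<circ> z) i = z i"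
    if "z \<in> ?B" for z
  proof -
    show z: "z permutes ?V" and "\<And>i. i \<in> ?V \<Longrightarrow> \<Phi> z i"
      using that by auto
    show "(?t \<circ> z) i = ?t i" if "i \<in> set cs" for i
      using permutes_not_in[OF z, of i] that by simp
    show "(?t \<circ> z) i = z i" if "i \<notin> set cs" for i
    proof -
      have "z i \<notin> set cs" using permutes_in_image[OF z, of i] permutes_not_in[OF z, of i] that by auto
      then show ?thesis by (simp add: id_outside_supp)
    qed
  qed
  show "bij_betw ?r ?A ?B"
  \<comment> \<open>A permutation of the complement is the identity on \<open>set cs\<close>, so
    composing with the cycle just inserts it.\<close>
  proof (rule bij_betw_byWitness[where f' = "\<lambda>z. ?t \<circ> z"])
    show "\<forall>f\<in>?A. ?t \<circ> ?r f = f"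
    proof
      fix f assume f: "f \<in> ?A"
      have "(?t \<circ> ?r f) i = f i" for i
      proof (cases "i \<in> ?V")
        case True
        then have "f i \<in> ?V" using A(4)[OF f] by blast
        then show ?thesis using True by (simp add: id_outside_supp)
      next
        case False
        then consider "i \<in> set cs" | "i \<notin> U" "i \<notin> set cs" using assms(2) by blast
        then show ?thesis
          using A(3)[OF f, of i] permutes_not_in[OF A(1)[OF f], of i] False
          by cases (auto simp: id_outside_supp)
      qed
      then show "?t \<circ> ?r f = f" by (intro ext)
    qed
    show "\<forall>z\<in>?B. ?r (?t \<circ> z) = z"
    proof
      fix z assume z: "z \<in> ?B"
      have "?r (?t \<circ> z) i = z i" for i
        using B(4)[OF z, of i] permutes_not_in[OF B(1)[OF z], of i] by auto
      then show "?r (?t \<circ> z) = z" by (intro ext)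
    qed
    show "?r ` ?A \<subseteq> ?B"
    proof
      fix z assume "z \<in> ?r ` ?A"
      then obtain f where f: "f \<in> ?A" "z = ?r f" by (elim imageE)
      have "inj_on f ?V" using permutes_inj_on[OF A(1)[OF f(1)]] .
      then have "bij_betw f ?V ?V" using A(4)[OF f(1)] by (simp add: bij_betw_def)
      then have "bij_betw z ?V ?V"
        by (rule bij_betw_cong[THEN iffD1, rotated]) (simp add: f(2))
      then have "z permutes ?V" by (rule bij_imp_permutes) (auto simp: f(2))
      moreover have "\<Phi> z i" if "i \<in> ?V" for i
      proof -
        have "\<Phi> z i = \<Phi> f i"
          by (rule cong[OF _ that]) (use A(4)[OF f(1)] in \<open>auto simp: f(2)\<close>)
        then show ?thesis using A(2)[OF f(1), of i] that by simp
      qed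
      ultimately show "z \<in> ?B" by simp
    qed
    show "(\<lambda>z. ?t \<circ> z) ` ?B \<subseteq> ?A"
    proof
      fix f assume "f \<in> (\<lambda>z. ?t \<circ> z) ` ?B"
      then obtain z where z: "z \<in> ?B" "f = ?t \<circ> z" by (elim imageE)
      have "f permutes U"
        unfolding z(2)
        using permutes_subset[OF B(1)[OF z(1)], of U] permutes_subset[OF cycle_permutes[of cs] assms(2)]
        by (intro permutes_compose) auto
      moreover have *: "f i = ?t i \<and> f i \<in> set cs" if "i \<in> set cs" for i
        using B(3)[OF z(1) that] cycle_of_list_image[of cs] that unfolding z(2) by auto
      moreover have "\<Phi> f i" if "i \<in> U" for i
      proof (cases "i \<in> set cs")
        case True
        then show ?thesis using cong[OF * True] \<Phi>[OF True] by simp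
      next
        case False
        have "\<Phi> f i = \<Phi> z i"
        proof (rule cong[of ?V])
          fix j assume "j \<in> ?V"
          then show "f j = z j \<and> f j \<in> ?V"
            using B(4)[OF z(1), of j] permutes_in_image[OF B(1)[OF z(1)], of j] unfolding z(2) by simp
        qed (use that False in simp)
        then show ?thesis using B(2)[OF z(1), of i] that False by simp
      qed
      ultimately show "f \<in> ?A" by simp
    qed
  qed
qed

lemma support_eq_iff:
  assumes "permutation f" "distinct cs" "cs \<noteq> []"
  shows "support f (hd cs) = cs \<longleftrightarrow> (\<forall>i\<in>set cs. f i = cycle_of_list cs i)"
proof
  assume supp: "support f (hd cs) = cs"
  show "\<forall>i\<in>set cs. f i = cycle_of_list cs i"
    using cycle_restrict[OF assms(1), of _ "hd cs", unfolded supp] by blast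
next
  assume "\<forall>i\<in>set cs. f i = cycle_of_list cs i"
  then have *: "f i = cycle_of_list cs i \<and> f i \<in> set cs" if "i \<in> set cs" for i
    using that cycle_of_list_image[of cs] by auto
  have "support f (hd cs) = support (cycle_of_list cs) (hd cs)"
    using least_power_agree[of "set cs", OF * hd_in_set[OF assms(3)]]
      funpow_agree[of "set cs", OF * hd_in_set[OF assms(3)]] by simp
  then show "support f (hd cs) = cs" using support_cycle_of_list[OF assms(2,3)] by simp
qed

lemma card_cycle_perms_support:
  assumes "finite U" "distinct cs" "cs \<noteq> []" "set cs \<subseteq> U" "length cs \<in> D"
  shows "card {f \<in> cycle_perms D U. support f (hd cs) = cs} = card (cycle_perms D (U - set cs))"
proof -
  have "{f \<in> cycle_perms D U. support f (hd cs) = cs}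
    = {f. f permutes U \<and> (\<forall>i\<in>U. least_power f i \<in> D) \<and> (\<forall>i\<in>set cs. f i = cycle_of_list cs i)}"
    unfolding cycle_perms_def mem_Collect_eq conj_assoc
    using support_eq_iff[OF permutes_imp_permutation[OF _ assms(1)] assms(2,3)]
    by (intro Collect_cong conj_cong refl) simp
  also have "card \<dots> = card {f. f permutes (U - set cs) \<and> (\<forall>i\<in>U - set cs. least_power f i \<in> D)}"
  proof (rule card_extend_cycle)
    fix f g :: "'a \<Rightarrow> 'a" and V i
    assume *: "\<And>j. j \<in> V \<Longrightarrow> f j = g j \<and> f j \<in> V" "i \<in> V"
    show "(least_power f i \<in> D) = (least_power g i \<in> D)"
      using least_power_agree[of V f g i, OF *] by simp
  next
    fix i assume "i \<in> set cs"
    then show "least_power (cycle_of_list cs) i \<in> D"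
      using least_power_cycle_of_list[OF assms(2)] assms(5) by simp
  qed (rule assms(4))
  finally show ?thesis by (simp add: cycle_perms_def)
qed

lemma finite_cycle_perms: "finite U \<Longrightarrow> finite (cycle_perms D U)"
  unfolding cycle_perms_def by (rule finite_subset[OF _ finite_permutations]) auto

text \<open>Permutations are sorted by the cycle through \<open>p\<close>, written as a list that
  starts with \<open>p\<close>; \<open>xs\<close> is its tail.\<close>

lemma card_cycle_perms_rec:
  assumes "finite U" "p \<in> U" "finite D" "0 \<notin> D"
  shows "card (cycle_perms D U) = (\<Sum>d\<in>D. \<Sum>xs | length xs = d - 1 \<and> distinct xs \<and> set xs \<subseteq> U - {p}.
    card (cycle_perms D (U - {p} - set xs)))"
proof -
  define I where "I d = {xs. length xs = d - 1 \<and> distinct xs \<and> set xs \<subseteq> U - {p}}" for d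
  let ?L = "\<lambda>f. (least_power f p, tl (support f p))"
  have finI: "finite (I d)" for d
    by (rule finite_subset[OF _ finite_lists_length_eq[of "U - {p}" "d - 1"]])
      (use assms(1) in \<open>auto simp: I_def\<close>)
  have supp: "support f p = p # tl (support f p)" "distinct (support f p)"
    "set (support f p) \<subseteq> U" if "f \<in> cycle_perms D U" for f
  proof -
    have f: "f permutes U" "least_power f p \<in> D" using that assms(2) by (simp_all add: cycle_perms_def)
    have perm: "permutation f" using f(1) assms(1) by (rule permutes_imp_permutation)
    show "distinct (support f p)" by (rule cycle_of_permutation[OF perm])
    have pos: "least_power f p > 0" using f(2) assms(4) by (cases "least_power f p") auto
    then show "support f p = p # tl (support f p)" by (simp add: upt_conv_Cons)
    have "(f ^^ i) p \<in> U" for i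
      by (induction i) (simp_all add: assms(2) permutes_in_image[OF f(1)])
    then show "set (support f p) \<subseteq> U" by auto
  qed
  have img: "?L ` cycle_perms D U \<subseteq> Sigma D I"
  proof
    fix x assume "x \<in> ?L ` cycle_perms D U"
    then obtain f where f: "f \<in> cycle_perms D U" "x = ?L f" by (elim imageE)
    have "distinct (p # tl (support f p))" "set (p # tl (support f p)) \<subseteq> U"
      using supp[OF f(1)] by simp_all
    moreover have "least_power f p \<in> D" using f(1) assms(2) by (simp add: cycle_perms_def)
    ultimately show "x \<in> Sigma D I" by (auto simp: f(2) I_def)
  qed
  have "card (cycle_perms D U) = (\<Sum>x\<in>Sigma D I. \<Sum>f\<in>{f\<in>cycle_perms D U. ?L f = x}. 1)"
    using sum.group[OF finite_cycle_perms[OF assms(1)] _ img, of "\<lambda>_. 1::nat"] finI assms(3)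
    by (simp add: finite_SigmaI)
  also have "\<dots> = (\<Sum>x\<in>Sigma D I. card (cycle_perms D (U - {p} - set (snd x))))"
  proof (rule sum.cong)
    fix x assume "x \<in> Sigma D I"
    then obtain d xs where x: "x = (d, xs)" "d \<in> D" "xs \<in> I d" by (elim SigmaE)
    \<comment> \<open>Subtraction is truncated, so \<open>0 \<notin> D\<close> is what recovers
      \<open>d\<close> from \<open>d - 1\<close>.\<close>
    have d: "d = length (p # xs)" using x assms(4) by (cases d) (auto simp: I_def)
    have cs: "distinct (p # xs)" "set (p # xs) \<subseteq> U" using x(3) assms(2) by (auto simp: I_def)
    have "{f\<in>cycle_perms D U. ?L f = x} = {f \<in> cycle_perms D U. support f (hd (p # xs)) = p # xs}"
    proof (rule Collect_cong, rule conj_cong[OF refl])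
      fix f assume f: "f \<in> cycle_perms D U"
      show "?L f = x \<longleftrightarrow> support f (hd (p # xs)) = p # xs"
      proof
        assume "?L f = x"
        then have "snd (?L f) = snd x" by (rule arg_cong)
        then have "tl (support f p) = xs" unfolding x(1) snd_conv .
        then show "support f (hd (p # xs)) = p # xs" using supp(1)[OF f] by simp
      next
        assume *: "support f (hd (p # xs)) = p # xs"
        then have "length (support f p) = length (p # xs)" by simp
        then show "?L f = x" using * by (simp add: x(1) d)
      qed
    qed
    moreover have "U - {p} - set xs = U - set (p # xs)" by auto
    ultimately show "(\<Sum>f\<in>{f\<in>cycle_perms D U. ?L f = x}. 1)
      = card (cycle_perms D (U - {p} - set (snd x)))"
      using card_cycle_perms_support[OF assms(1) cs(1) _ cs(2), of D] x(2) d by (simp add: x(1))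
  qed simp
  also have "\<dots> = (\<Sum>d\<in>D. \<Sum>xs\<in>I d. card (cycle_perms D (U - {p} - set xs)))"
    using assms(3) finI by (subst sum.Sigma) (auto simp: split_def)
  finally show ?thesis by (simp add: I_def)
qed

lemma card_distinct_lists:
  assumes "finite A" "k \<le> card A"
  shows "card {xs. length xs = k \<and> distinct xs \<and> set xs \<subseteq> A} * fact (card A - k) = fact (card A)"
proof -
  have "(fact (card A - k) :: nat) dvd fact (card A)" by (rule fact_dvd) simp
  moreover have "card {xs. length xs = k \<and> distinct xs \<and> set xs \<subseteq> A} = fact (card A) div fact (card A - k)"
    unfolding card_lists_distinct_length_eq[OF assms(1,2)] using assms(2)
    by (subst fact_div_fact) simp_all
  ultimately show ?thesis by simp
qed

lemma no_long_distinct_lists: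
  assumes "finite A" "card A < k"
  shows "{xs. length xs = k \<and> distinct xs \<and> set xs \<subseteq> A} = {}"
proof -
  have "length xs \<le> card A" if "distinct xs" "set xs \<subseteq> A" for xs :: "'a list"
    using that card_mono[OF assms(1) that(2)] by (simp add: distinct_card)
  then show ?thesis using assms(2) by fastforce
qed

text \<open>For finite \<open>D\<close> without 0 these are the coefficients of the exponential of
  the sum of \<open>z\<^sup>d / d\<close> over \<open>d \<in> D\<close>.\<close>

definition cycle_coeff :: "nat set \<Rightarrow> nat \<Rightarrow> rat" where
  "cycle_coeff D n = of_nat (card (cycle_perms D {..<n})) / fact n"

text \<open>The induction hypothesis is an assumption so that the step applies both to
  \<open>U\<close> and to the initial segment of the same size; comparing the two in
  \<open>card_cycle_perms\<close> shows that only the cardinality matters.\<close>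

lemma cycle_perms_step:
  fixes U :: "nat set"
  assumes "finite U" "p \<in> U" "finite D" "0 \<notin> D"
    and IH: "\<And>V :: nat set. finite V \<Longrightarrow> card V < card U \<Longrightarrow>
      of_nat (card (cycle_perms D V)) = fact (card V) * cycle_coeff D (card V)"
  shows "of_nat (card (cycle_perms D U)) =
    fact (card U - 1) * (\<Sum>d | d \<in> D \<and> d \<le> card U. cycle_coeff D (card U - d))"
proof -
  let ?I = "\<lambda>d. {xs. length xs = d - 1 \<and> distinct xs \<and> set xs \<subseteq> U - {p}}"
  let ?m = "card U - 1"
  have m: "card (U - {p}) = ?m" "card U > 0" using assms(1,2) by (auto simp: card_gt_0_iff)
  have inner: "(\<Sum>xs\<in>?I d. of_nat (card (cycle_perms D (U - {p} - set xs))) :: rat)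
    = (if d \<le> card U then fact ?m * cycle_coeff D (card U - d) else 0)" if "d \<in> D" for d
  proof (cases "d \<le> card U")
    case True
    have d: "d > 0" using that assms(4) by (cases d) auto
    have "(\<Sum>xs\<in>?I d. of_nat (card (cycle_perms D (U - {p} - set xs))) :: rat)
      = (\<Sum>xs\<in>?I d. fact (card U - d) * cycle_coeff D (card U - d))"
    proof (rule sum.cong)
      fix xs assume "xs \<in> ?I d"
      then have "card (U - {p} - set xs) = ?m - (d - 1)"
        using assms(1) m by (simp add: card_Diff_subset distinct_card)
      then have c: "card (U - {p} - set xs) = card U - d" using d by simp
      show "of_nat (card (cycle_perms D (U - {p} - set xs))) =
        (fact (card U - d) * cycle_coeff D (card U - d) :: rat)"
        using IH[of "U - {p} - set xs"] assms(1) True d m(2) by (simp add: c)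
    qed simp
    \<comment> \<open>The number of lists is a quotient of factorials; its denominator cancels the
      factorial contributed by the remaining points.\<close>
    also have "\<dots> = of_nat (card (?I d) * fact (card (U - {p}) - (d - 1))) * cycle_coeff D (card U - d)"
      using d True unfolding m(1) by simp
    also have "card (?I d) * fact (card (U - {p}) - (d - 1)) = fact ?m"
      using assms(1) True unfolding m(1)[symmetric]
      by (intro card_distinct_lists) (simp_all add: m(1))
    finally show ?thesis using True by simp
  next
    case False
    then have "?I d = {}" using assms(1) m by (intro no_long_distinct_lists) simp_all
    show ?thesis unfolding \<open>?I d = {}\<close> using False by simp
  qed
  have "of_nat (card (cycle_perms D U)) =
    (\<Sum>d\<in>D. if d \<le> card U then fact ?m * cycle_coeff D (card U - d) else 0)"
    unfolding card_cycle_perms_rec[OF assms(1-4)] of_nat_sum by (intro sum.cong refl inner)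
  also have "\<dots> = (\<Sum>d | d \<in> D \<and> d \<le> card U. fact ?m * cycle_coeff D (card U - d))"
    by (rule sum.inter_filter[OF assms(3), symmetric])
  finally show ?thesis by (simp add: sum_distrib_left)
qed

lemma card_cycle_perms:
  fixes U :: "nat set"
  assumes "finite D" "0 \<notin> D" "finite U"
  shows "of_nat (card (cycle_perms D U)) = fact (card U) * cycle_coeff D (card U)"
  using assms(3)
proof (induction "card U" arbitrary: U rule: less_induct)
  case less
  show ?case
  proof (cases "U = {}")
    case True
    then show ?thesis by (simp add: cycle_coeff_def)
  next
    case False
    then obtain p where p: "p \<in> U" by blast
    have pos: "card U > 0" using less.prems False by (simp add: card_gt_0_iff)
    have "of_nat (card (cycle_perms D U)) = (of_nat (card (cycle_perms D {..<card U})) :: rat)"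
      using cycle_perms_step[OF less.prems p assms(1,2) less.hyps]
        cycle_perms_step[of "{..<card U}" "card U - 1" D] assms(1,2) less.hyps pos by simp
    then show ?thesis by (simp add: cycle_coeff_def)
  qed
qed

lemma cycle_coeff_0: "cycle_coeff D 0 = 1"
proof -
  have "cycle_perms D {..<0::nat} = {id}" by (auto simp: cycle_perms_def)
  then show ?thesis by (simp add: cycle_coeff_def)
qed

text \<open>The coefficient form of \<open>C' = P C\<close>, where \<open>P\<close> is the
  derivative of the exponent, the sum of \<open>z\<^sup>d\<^sup>-\<^sup>1\<close> over
  \<open>d \<in> D\<close>.\<close>

lemma cycle_coeff_Suc:
  assumes "finite D" "0 \<notin> D"
  shows "of_nat (Suc n) * cycle_coeff D (Suc n) = (\<Sum>d | d \<in> D \<and> d \<le> Suc n. cycle_coeff D (Suc n - d))"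
proof -
  have "fact (Suc n) * cycle_coeff D (Suc n)
    = fact n * (\<Sum>d | d \<in> D \<and> d \<le> Suc n. cycle_coeff D (Suc n - d))"
    using cycle_perms_step[of "{..<Suc n}" n D, OF _ _ assms card_cycle_perms[OF assms]]
      card_cycle_perms[OF assms, of "{..<Suc n}"] by simp
  also have "fact (Suc n) * cycle_coeff D (Suc n) = fact n * (of_nat (Suc n) * cycle_coeff D (Suc n))"
    by simp
  finally show ?thesis by (simp del: of_nat_Suc)
qed

section \<open>Square roots of a free permutation of order 3\<close>

text \<open>The equation is imposed on \<open>U\<close> only, because \<open>U\<close> shrinks in
  the recursion while \<open>c\<close> stays the same function.\<close>

definition sqrt_perms :: "('b \<Rightarrow> 'b) \<Rightarrow> 'b set \<Rightarrow> ('b \<Rightarrow> 'b) set" where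
  "sqrt_perms c U = {x. x permutes U \<and> (\<forall>i\<in>U. x (x i) = c i)}"

definition free_order3 :: "('b \<Rightarrow> 'b) \<Rightarrow> 'b set \<Rightarrow> bool" where
  "free_order3 c U \<longleftrightarrow> (\<forall>i\<in>U. c i \<in> U \<and> c i \<noteq> i \<and> c (c (c i)) = i)"

lemma card_sqrt_perms_cycle:
  assumes "set cs \<subseteq> U"
    and "\<And>i. i \<in> set cs \<Longrightarrow> cycle_of_list cs (cycle_of_list cs i) = c i"
  shows "card {x \<in> sqrt_perms c U. \<forall>i\<in>set cs. x i = cycle_of_list cs i} = card (sqrt_perms c (U - set cs))"
proof -
  have "card {f. f permutes U \<and> (\<forall>i\<in>U. f (f i) = c i) \<and> (\<forall>i\<in>set cs. f i = cycle_of_list cs i)}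
    = card {f. f permutes (U - set cs) \<and> (\<forall>i\<in>U - set cs. f (f i) = c i)}"
  proof (rule card_extend_cycle)
    fix f g :: "'a \<Rightarrow> 'a" and V i
    assume *: "\<And>j. j \<in> V \<Longrightarrow> f j = g j \<and> f j \<in> V" "i \<in> V"
    show "(f (f i) = c i) = (g (g i) = c i)" using *(1)[OF *(2)] *(1)[of "f i"] by auto
  qed (use assms in simp_all)
  then show ?thesis by (simp add: sqrt_perms_def conj_assoc)
qed

text \<open>The argument is the number of \<open>c\<close>-cycles. Among \<open>m + 2\<close> of
  them, the cycle of a chosen point is either preserved or swapped with another one; in the second
  case the image of the point ranges over \<open>3 * Suc m\<close> points, and two cycles are used
  up.\<close>

fun sqrt_count :: "nat \<Rightarrow> nat" where
  "sqrt_count 0 = 1"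
| "sqrt_count (Suc 0) = 1"
| "sqrt_count (Suc (Suc m)) = sqrt_count (Suc m) + 3 * Suc m * sqrt_count m"

text \<open>Both sides are \<open>x (x (x i))\<close>.\<close>

lemma sqrt_perms_commute:
  assumes "x \<in> sqrt_perms c U" "i \<in> U"
  shows "x (c i) = c (x i)"
proof -
  have x: "x permutes U" "\<And>j. j \<in> U \<Longrightarrow> x (x j) = c j" using assms(1) by (auto simp: sqrt_perms_def)
  have "x i \<in> U" using permutes_in_image[OF x(1)] assms(2) by simp
  then show ?thesis using x(2)[of i] x(2)[of "x i"] assms(2) by simp
qed

lemma free_order3_Diff:
  assumes "free_order3 c U" "c ` T \<subseteq> T" "T \<subseteq> U"
  shows "free_order3 c (U - T)"
  unfolding free_order3_def
proof
  fix i assume i: "i \<in> U - T"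
  then have c: "c i \<in> U" "c i \<noteq> i" "c (c (c i)) = i" using assms(1) by (auto simp: free_order3_def)
  have "c i \<notin> T" using c(3) assms(2) i by (metis DiffD2 image_subset_iff)
  then show "c i \<in> U - T \<and> c i \<noteq> i \<and> c (c (c i)) = i" using c by simp
qed

text \<open>
  A square root \<open>x\<close> of a free permutation \<open>c\<close> of order 3 either preserves the \<open>c\<close>-cycle of \<open>p\<close>, where it
  must be \<open>c\<^sup>2\<close>, or swaps it with the \<open>c\<close>-cycle of \<open>q = x p\<close>, where it is a 6-cycle determined by \<open>q\<close>.
\<close>

lemma sqrt_fiber_same:
  assumes "free_order3 c U" "p \<in> U"
  shows "{x \<in> sqrt_perms c U. x p = c (c p)}
    = {x \<in> sqrt_perms c U. \<forall>i\<in>set [p, c (c p), c p]. x i = cycle_of_list [p, c (c p), c p] i}"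
    (is "?L = ?R")
    "i \<in> set [p, c (c p), c p] \<Longrightarrow>
      cycle_of_list [p, c (c p), c p] (cycle_of_list [p, c (c p), c p] i) = c i"
proof -
  have c: "c p \<in> U" "c (c p) \<in> U" "c p \<noteq> p" "c (c (c p)) = p" "c (c p) \<noteq> c p" "c (c p) \<noteq> p"
    using assms unfolding free_order3_def by metis+
  have t: "cycle_of_list [p, c (c p), c p] p = c (c p)"
    "cycle_of_list [p, c (c p), c p] (c (c p)) = c p"
    "cycle_of_list [p, c (c p), c p] (c p) = p"
    using c c(3,5,6)[symmetric] by (simp_all add: transpose_def)
  show "i \<in> set [p, c (c p), c p] \<Longrightarrow>
      cycle_of_list [p, c (c p), c p] (cycle_of_list [p, c (c p), c p] i) = c i"
    using t c(4) by auto
  show "?L = ?R"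
  proof (intro equalityI subsetI)
    fix x assume x: "x \<in> ?L"
    then have *: "x \<in> sqrt_perms c U" "x p = c (c p)" by simp_all
    have "x (c p) = p" "x (c (c p)) = c p"
      using sqrt_perms_commute[OF *(1) assms(2)] sqrt_perms_commute[OF *(1) c(1)] *(2) c(4) by simp_all
    then show "x \<in> ?R" using * t by simp
  next
    fix x assume "x \<in> ?R"
    then show "x \<in> ?L" using t(1) by simp
  qed
qed

lemma sqrt_fiber_other:
  assumes "free_order3 c U" "p \<in> U" "q \<in> U" "q \<notin> {p, c p, c (c p)}"
  defines "cs \<equiv> [p, q, c p, c q, c (c p), c (c q)]"
  shows "{x \<in> sqrt_perms c U. x p = q} = {x \<in> sqrt_perms c U. \<forall>i\<in>set cs. x i = cycle_of_list cs i}"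
    (is "?L = ?R")
    "i \<in> set cs \<Longrightarrow> cycle_of_list cs (cycle_of_list cs i) = c i"
    "{p, c p, c (c p)} \<inter> {q, c q, c (c q)} = {}"
proof -
  have cp: "c p \<in> U" "c (c p) \<in> U" "c p \<noteq> p" "c (c (c p)) = p" "c (c p) \<noteq> c p" "c (c p) \<noteq> p"
    using assms unfolding free_order3_def by metis+
  have cq: "c q \<in> U" "c (c q) \<in> U" "c q \<noteq> q" "c (c (c q)) = q" "c (c q) \<noteq> c q" "c (c q) \<noteq> q"
    using assms unfolding free_order3_def by metis+
  have pq: "q \<noteq> p" "q \<noteq> c p" "q \<noteq> c (c p)" using assms(4) by auto
  \<comment> \<open>If \<open>c q\<close> or \<open>c (c q)\<close> lay on the cycle of
    \<open>p\<close>, applying \<open>c\<close> further would return to \<open>q\<close> and place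
    it there too.\<close>
  have pq': "c q \<noteq> p" "c q \<noteq> c p" "c q \<noteq> c (c p)" "c (c q) \<noteq> p" "c (c q) \<noteq> c p" "c (c q) \<noteq> c (c p)"
    using pq cp(4) cq(4) by metis+
  show "{p, c p, c (c p)} \<inter> {q, c q, c (c q)} = {}"
    using pq pq' by auto
  note ne = cp(3,5,6) cq(3,5,6) pq pq'
  have t: "cycle_of_list cs p = q" "cycle_of_list cs q = c p" "cycle_of_list cs (c p) = c q"
    "cycle_of_list cs (c q) = c (c p)" "cycle_of_list cs (c (c p)) = c (c q)"
    "cycle_of_list cs (c (c q)) = p"
    unfolding cs_def using ne ne[symmetric] by (simp_all add: transpose_def)
  show "i \<in> set cs \<Longrightarrow> cycle_of_list cs (cycle_of_list cs i) = c i"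
    using t cp(4) cq(4) by (auto simp: cs_def)
  show "?L = ?R"
  proof (intro equalityI subsetI)
    fix x assume x: "x \<in> ?L"
    then have *: "x \<in> sqrt_perms c U" "x p = q" by simp_all
    have sq: "x (x i) = c i" if "i \<in> U" for i using *(1) that by (auto simp: sqrt_perms_def)
    have 1: "x q = c p" using sq[OF assms(2)] *(2) by simp
    have 2: "x (c p) = c q" using sq[OF assms(3)] 1 by simp
    have 3: "x (c q) = c (c p)" using sq[OF cp(1)] 2 by simp
    have 4: "x (c (c p)) = c (c q)" using sq[OF cq(1)] 3 by simp
    have 5: "x (c (c q)) = p" using sq[OF cp(2)] 4 cp(4) by simp
    show "x \<in> ?R" using * t 1 2 3 4 5 by (simp add: cs_def)
  next
    fix x assume "x \<in> ?R"
    then show "x \<in> ?L" using t(1) by (simp add: cs_def)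
  qed
qed

lemma card_sqrt_perms_step:
  assumes "finite U" "free_order3 c U" "p \<in> U"
  shows "card (sqrt_perms c U) = card (sqrt_perms c (U - {p, c p, c (c p)})) +
    (\<Sum>q\<in>U - {p, c p, c (c p)}. card (sqrt_perms c (U - {p, c p, c (c p)} - {q, c q, c (c q)})))"
proof -
  let ?O = "{p, c p, c (c p)}"
  have c: "c p \<in> U" "c (c p) \<in> U" "c p \<noteq> p" "c (c (c p)) = p" "c (c p) \<noteq> c p" "c (c p) \<noteq> p"
    using assms unfolding free_order3_def by metis+
  have fin: "finite (sqrt_perms c U)"
    unfolding sqrt_perms_def by (rule finite_subset[OF _ finite_permutations[OF assms(1)]]) auto
  have img: "(\<lambda>x. x p) ` sqrt_perms c U \<subseteq> insert (c (c p)) (U - ?O)"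
  proof
    fix q assume "q \<in> (\<lambda>x. x p) ` sqrt_perms c U"
    then obtain x where x: "x \<in> sqrt_perms c U" "q = x p" by (elim imageE)
    have perm: "x permutes U" and sq: "x (x p) = c p" using x(1) assms(3) by (auto simp: sqrt_perms_def)
    have "q \<in> U" using permutes_in_image[OF perm] assms(3) by (simp add: x(2))
    \<comment> \<open>Two images are impossible: \<open>x p = p\<close> would give
      \<open>c p = p\<close>, and \<open>x p = c p\<close> would give \<open>c p = c (c p)\<close>
      since \<open>x\<close> commutes with \<open>c\<close>.\<close>
    moreover have "x p \<noteq> p" using sq c(3) by metis
    moreover have "x p \<noteq> c p"
    proof
      assume "x p = c p"
      then have "x (c p) = c (c p)" using sqrt_perms_commute[OF x(1) assms(3)] by simp
      then show False using sq \<open>x p = c p\<close> c(5) by simp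
    qed
    ultimately show "q \<in> insert (c (c p)) (U - ?O)" by (auto simp: x(2))
  qed
  have "card (sqrt_perms c U)
    = (\<Sum>q\<in>insert (c (c p)) (U - ?O). \<Sum>x\<in>{x \<in> sqrt_perms c U. x p = q}. 1)"
    using sum.group[OF fin _ img, of "\<lambda>_. 1::nat"] assms(1) by simp
  also have "\<dots> = card {x \<in> sqrt_perms c U. x p = c (c p)}
      + (\<Sum>q\<in>U - ?O. card {x \<in> sqrt_perms c U. x p = q})"
    using assms(1) by simp
  also have "card {x \<in> sqrt_perms c U. x p = c (c p)} = card (sqrt_perms c (U - ?O))"
  proof -
    have "set [p, c (c p), c p] = ?O" by auto
    then show ?thesis
      using card_sqrt_perms_cycle[of "[p, c (c p), c p]" U c] sqrt_fiber_same[OF assms(2,3)] c(1,2) assms(3)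
      by simp
  qed
  also have "(\<Sum>q\<in>U - ?O. card {x \<in> sqrt_perms c U. x p = q})
    = (\<Sum>q\<in>U - ?O. card (sqrt_perms c (U - ?O - {q, c q, c (c q)})))"
  proof (rule sum.cong)
    fix q assume q: "q \<in> U - ?O"
    then have qU: "q \<in> U" "q \<notin> ?O" by simp_all
    let ?cs = "[p, q, c p, c q, c (c p), c (c q)]"
    have "c q \<in> U" "c (c q) \<in> U" using assms(2) qU(1) unfolding free_order3_def by metis+
    then have "set ?cs \<subseteq> U" using c(1,2) assms(3) qU(1) by simp
    moreover have "U - set ?cs = U - ?O - {q, c q, c (c q)}" by auto
    ultimately show "card {x \<in> sqrt_perms c U. x p = q} = card (sqrt_perms c (U - ?O - {q, c q, c (c q)}))"
      using card_sqrt_perms_cycle[of ?cs U c] sqrt_fiber_other[OF assms(2,3) qU]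
      by (metis (no_types, lifting))
  qed simp
  finally show ?thesis .
qed

lemma card_sqrt_perms:
  assumes "finite U" "free_order3 c U" "card U = 3 * m"
  shows "card (sqrt_perms c U) = sqrt_count m"
  using assms
proof (induction m arbitrary: U rule: sqrt_count.induct)
  case 1
  then have "sqrt_perms c U = {id}" by (auto simp: sqrt_perms_def)
  then show ?case by simp
next
  case (2 U)
  then obtain p where p: "p \<in> U" by fastforce
  have c: "c p \<in> U" "c (c p) \<in> U" "c p \<noteq> p" "c (c p) \<noteq> c p" "c (c p) \<noteq> p"
    using 2 p unfolding free_order3_def by metis+
  have O: "card {p, c p, c (c p)} = 3" "{p, c p, c (c p)} \<subseteq> U" using c p by auto
  have E: "U - {p, c p, c (c p)} = {}"
    using card_subset_eq[OF 2(1) O(2)] 2(3) O(1) by simp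
  have "sqrt_perms c {} = {id}" by (auto simp: sqrt_perms_def)
  then show ?case unfolding card_sqrt_perms_step[OF 2(1,2) p] E by simp
next
  case (3 m U)
  then obtain p where p: "p \<in> U" by fastforce
  have c3: "c q \<in> U" "c (c q) \<in> U" "c q \<noteq> q" "c (c q) \<noteq> c q" "c (c q) \<noteq> q" "c (c (c q)) = q"
    if "q \<in> U" for q
    using 3(4) that unfolding free_order3_def by metis+
  let ?O = "\<lambda>q. {q, c q, c (c q)}"
  have O: "card (?O q) = 3" "?O q \<subseteq> U" "c ` ?O q \<subseteq> ?O q" if "q \<in> U" for q
    using c3[OF that] that by auto
  have card1: "card (U - ?O p) = 3 * Suc m"
    using 3(3,5) O[OF p] by (simp add: card_Diff_subset)
  have free1: "free_order3 c (U - ?O p)" using 3(4) O(3,2)[OF p] by (rule free_order3_Diff)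
  have "card (sqrt_perms c (U - ?O p - ?O q)) = sqrt_count m" if q: "q \<in> U - ?O p" for q
  proof -
    have c: "c q \<in> U - ?O p" "c (c q) \<in> U - ?O p" using free1 q unfolding free_order3_def by metis+
    then have sub: "?O q \<subseteq> U - ?O p" using q by (simp only: insert_subset empty_subsetI simp_thms)
    have "card (U - ?O p - ?O q) = 3 * m"
      using card_Diff_subset[OF _ sub] card1 O(1)[of q] q by simp
    moreover have "free_order3 c (U - ?O p - ?O q)"
      by (rule free_order3_Diff[OF free1 _ sub]) (use O(3)[of q] q in blast)
    ultimately show ?thesis using 3(2) 3(3) by simp
  qed
  then have "(\<Sum>q\<in>U - ?O p. card (sqrt_perms c (U - ?O p - ?O q))) = 3 * Suc m * sqrt_count m"
    using card1 by simp
  moreover have "card (sqrt_perms c (U - ?O p)) = sqrt_count (Suc m)"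
    using 3(1)[OF _ free1 card1] 3(3) by simp
  ultimately show ?case using card_sqrt_perms_step[OF 3(3,4) p] by simp
qed

section \<open>Actions of the lifted and of the plain modular group\<close>

instance gen :: finite
proof
  have "(UNIV :: gen set) = {X, Y}" using gen.exhaust by auto
  then show "finite (UNIV :: gen set)" by (metis finite.emptyI finite_insert)
qed

lemma act_gen_pow: "act \<sigma> (gen_pow a n) = \<sigma> a ^^ n"
  by (induction n) (simp_all add: act_Cons funpow_Suc_right del: funpow.simps(2))

definition Gamma33_rels :: "(gen gword \<times> gen gword) set" where
  "Gamma33_rels = {(gen_pow X 6, []), (gen_pow Y 9, []), (gen_pow X 2, gen_pow Y 3)}"

definition PSL_rels :: "(gen gword \<times> gen gword) set" where
  "PSL_rels = {(gen_pow X 2, []), (gen_pow Y 3, [])}"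

lemma Gamma33_actions_iff:
  "\<sigma> \<in> actions Gamma33_rels S \<longleftrightarrow> \<sigma> X permutes S \<and> \<sigma> Y permutes S \<and>
    \<sigma> X ^^ 6 = id \<and> \<sigma> Y ^^ 9 = id \<and> \<sigma> X ^^ 2 = \<sigma> Y ^^ 3"
proof -
  have "(\<forall>a. \<sigma> a permutes S) \<longleftrightarrow> \<sigma> X permutes S \<and> \<sigma> Y permutes S" by (metis gen.exhaust)
  then show ?thesis by (simp add: actions_def Gamma33_rels_def act_gen_pow)
qed

lemma PSL_actions_iff:
  "\<sigma> \<in> actions PSL_rels S \<longleftrightarrow> \<sigma> X permutes S \<and> \<sigma> Y permutes S \<and> \<sigma> X ^^ 2 = id \<and> \<sigma> Y ^^ 3 = id"
proof -
  have "(\<forall>a. \<sigma> a permutes S) \<longleftrightarrow> \<sigma> X permutes S \<and> \<sigma> Y permutes S" by (metis gen.exhaust)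
  then show ?thesis by (simp add: actions_def PSL_rels_def act_gen_pow)
qed

lemma funpow_eq_id_iff:
  assumes "f permutes S" "finite S"
  shows "f ^^ n = id \<longleftrightarrow> (\<forall>i\<in>S. least_power f i dvd n)"
proof -
  have "(f ^^ n) i = i" if "i \<notin> S" for i
    by (rule permutes_not_in[OF permutes_funpow[OF assms(1)] that])
  then have "f ^^ n = id \<longleftrightarrow> (\<forall>i\<in>S. (f ^^ n) i = i)" by (auto simp: fun_eq_iff)
  then show ?thesis using least_power_dvd[OF permutes_imp_permutation[OF assms]] by simp
qed

lemma dvd_2_iff: "d dvd 2 \<longleftrightarrow> d \<in> {1, 2 :: nat}"
  and dvd_3_iff: "d dvd 3 \<longleftrightarrow> d \<in> {1, 3 :: nat}"
proof -
  have "prime (2 :: nat)" "prime (3 :: nat)" by simp_all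
  then show "d dvd 2 \<longleftrightarrow> d \<in> {1, 2 :: nat}" "d dvd 3 \<longleftrightarrow> d \<in> {1, 3 :: nat}"
    by (auto simp: prime_nat_iff)
qed

lemma dvd_9_not_dvd_3_iff: "d dvd 9 \<and> \<not> d dvd 3 \<longleftrightarrow> d = (9 :: nat)"
proof
  assume d: "d dvd 9 \<and> \<not> d dvd 3"
  then have "d \<le> 9" by (auto dest: dvd_imp_le)
  then have "d \<in> {0, 1, 2, 3, 4, 5, 6, 7, 8, 9}" by auto
  then show "d = 9" using d by auto
qed auto

text \<open>The relations do not link the two generators, so an action is a pair of independent
  permutations whose cycle lengths divide 2 and 3, respectively.\<close>

lemma card_PSL_actions:
  assumes "finite S"
  shows "card (actions PSL_rels S) = card (cycle_perms {1, 2} S) * card (cycle_perms {1, 3} S)"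
proof -
  have 2: "f \<in> cycle_perms {1, 2} S \<longleftrightarrow> f permutes S \<and> f ^^ 2 = id"
    and 3: "f \<in> cycle_perms {1, 3} S \<longleftrightarrow> f permutes S \<and> f ^^ 3 = id" for f
    using funpow_eq_id_iff[OF _ assms, of f]
    unfolding cycle_perms_def mem_Collect_eq dvd_2_iff[symmetric] dvd_3_iff[symmetric]
    by metis+
  have "bij_betw (\<lambda>\<sigma>. (\<sigma> X, \<sigma> Y)) (actions PSL_rels S) (cycle_perms {1, 2} S \<times> cycle_perms {1, 3} S)"
    by (rule bij_betw_byWitness[where f' = "\<lambda>(x, y). case_gen x y"])
      (auto simp: PSL_actions_iff 2 3 simp del: One_nat_def split: gen.splits intro!: ext)
  from bij_betw_same_card[OF this] show ?thesis unfolding card_cartesian_product .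
qed

section \<open>Actions in which \<open>c\<close> has no fixed point\<close>

lemma cycle_coeff_9_eq_0: "\<not> 9 dvd n \<Longrightarrow> cycle_coeff {9} n = 0"
proof (induction n rule: less_induct)
  case (less n)
  show ?case
  proof (cases n)
    case (Suc m)
    have *: "of_nat (Suc m) * cycle_coeff {9} (Suc m)
      = (\<Sum>d | d \<in> {9} \<and> d \<le> Suc m. cycle_coeff {9} (Suc m - d))"
      by (rule cycle_coeff_Suc) simp_all
    also have "\<dots> = 0"
    proof (rule sum.neutral, rule ballI)
      fix d assume d: "d \<in> {d. d \<in> {9} \<and> d \<le> Suc m}"
      have "\<not> 9 dvd Suc m" "9 \<le> Suc m" using d less.prems Suc by auto
      then have "\<not> 9 dvd Suc m - 9" by presburger
      then have "\<not> 9 dvd Suc m - d" using d by simp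
      then show "cycle_coeff {9} (Suc m - d) = 0" using d Suc by (intro less.IH) auto
    qed
    finally show ?thesis using Suc by (simp del: of_nat_Suc)
  qed (use less.prems in simp)
qed

definition free_actions :: "'b set \<Rightarrow> (gen \<Rightarrow> 'b \<Rightarrow> 'b) set" where
  "free_actions U = {\<sigma> \<in> actions Gamma33_rels U. \<forall>i\<in>U. (\<sigma> X ^^ 2) i \<noteq> i}"

text \<open>The only divisor of 9 that does not divide 3 is 9 itself.\<close>

lemma cycle_perms_9_iff:
  assumes "finite U"
  shows "y \<in> cycle_perms {9} U \<longleftrightarrow> y permutes U \<and> y ^^ 9 = id \<and> (\<forall>i\<in>U. (y ^^ 3) i \<noteq> i)"
proof (cases "y permutes U")
  case True
  have "(\<forall>i\<in>U. least_power y i = 9) \<longleftrightarrow>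
    (\<forall>i\<in>U. least_power y i dvd 9) \<and> (\<forall>i\<in>U. \<not> least_power y i dvd 3)"
    using dvd_9_not_dvd_3_iff by metis
  then show ?thesis
    using True funpow_eq_id_iff[OF True assms, of 9]
      least_power_dvd[OF permutes_imp_permutation[OF True assms], of _ 3]
    by (simp add: cycle_perms_def)
qed (simp add: cycle_perms_def)

lemma sqrt_perms_iff:
  assumes "y permutes U"
  shows "x \<in> sqrt_perms (y ^^ 3) U \<longleftrightarrow> x permutes U \<and> x ^^ 2 = y ^^ 3"
proof (cases "x permutes U")
  case True
  have "(x ^^ 2) i = (y ^^ 3) i" if "i \<notin> U" for i
    using permutes_not_in[OF permutes_funpow[OF True] that] permutes_not_in[OF permutes_funpow[OF assms] that]
    by simp
  then have "x ^^ 2 = y ^^ 3 \<longleftrightarrow> (\<forall>i\<in>U. (x ^^ 2) i = (y ^^ 3) i)" by (auto simp: fun_eq_iff)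
  then show ?thesis using True by (simp add: sqrt_perms_def numeral_2_eq_2)
qed (simp add: sqrt_perms_def)

lemma free_order3_cube:
  assumes "finite U" "y \<in> cycle_perms {9} U"
  shows "free_order3 (y ^^ 3) U"
  unfolding free_order3_def
proof
  have y: "y permutes U" "y ^^ 9 = id" "\<And>i. i \<in> U \<Longrightarrow> (y ^^ 3) i \<noteq> i"
    using assms by (simp_all add: cycle_perms_9_iff)
  fix i assume i: "i \<in> U"
  have "(y ^^ 3) ((y ^^ 3) ((y ^^ 3) i)) = (y ^^ (3 + (3 + 3))) i"
    unfolding funpow_add comp_apply ..
  also have "\<dots> = i" using y(2) by simp
  finally show "(y ^^ 3) i \<in> U \<and> (y ^^ 3) i \<noteq> i \<and> (y ^^ 3) ((y ^^ 3) ((y ^^ 3) i)) = i"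
    using y(3)[OF i] permutes_in_image[OF permutes_funpow[OF y(1)]] i by blast
qed

text \<open>Choose \<open>y\<close> first: it consists of 9-cycles, so \<open>y\<^sup>3\<close> is
  free of order 3, and \<open>x\<close> may be any square root of it, with
  \<open>x\<^sup>6 = y\<^sup>9 = 1\<close>. The number of square roots is the same for all
  \<open>y\<close>, which makes the count a product.\<close>

lemma card_free_actions:
  fixes U :: "nat set"
  assumes "finite U"
  shows "card (free_actions U) = card (cycle_perms {9} U) * sqrt_count (card U div 3)"
proof -
  let ?S = "Sigma (cycle_perms {9} U) (\<lambda>y. sqrt_perms (y ^^ 3) U)"
  have "bij_betw (\<lambda>\<sigma>. (\<sigma> Y, \<sigma> X)) (free_actions U) ?S"
  proof (rule bij_betw_byWitness[where f' = "\<lambda>(y, x). case_gen x y"])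
    show "\<forall>\<sigma>\<in>free_actions U. (case (\<sigma> Y, \<sigma> X) of (y, x) \<Rightarrow> case_gen x y) = \<sigma>"
      by (auto simp: fun_eq_iff split: gen.splits)
    show "\<forall>z\<in>?S. ((case z of (y, x) \<Rightarrow> case_gen x y) Y, (case z of (y, x) \<Rightarrow> case_gen x y) X) = z"
      by auto
    show "(\<lambda>\<sigma>. (\<sigma> Y, \<sigma> X)) ` free_actions U \<subseteq> ?S"
    proof
      fix z assume "z \<in> (\<lambda>\<sigma>. (\<sigma> Y, \<sigma> X)) ` free_actions U"
      then obtain \<sigma> where \<sigma>: "\<sigma> \<in> free_actions U" "z = (\<sigma> Y, \<sigma> X)" by (elim imageE)
      have *: "\<sigma> X permutes U" "\<sigma> Y permutes U" "\<sigma> Y ^^ 9 = id" "\<sigma> X ^^ 2 = \<sigma> Y ^^ 3"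
        "\<forall>i\<in>U. (\<sigma> X ^^ 2) i \<noteq> i"
        using \<sigma>(1) unfolding free_actions_def mem_Collect_eq Gamma33_actions_iff by blast+
      have "\<sigma> Y \<in> cycle_perms {9} U"
        unfolding cycle_perms_9_iff[OF assms] using *(2,3,5) unfolding *(4) by blast
      moreover have "\<sigma> X \<in> sqrt_perms (\<sigma> Y ^^ 3) U"
        unfolding sqrt_perms_iff[OF *(2)] using *(1,4) by blast
      ultimately show "z \<in> ?S" by (simp add: \<sigma>(2))
    qed
    show "(\<lambda>(y, x). case_gen x y) ` ?S \<subseteq> free_actions U"
    proof
      fix \<sigma> :: "gen \<Rightarrow> nat \<Rightarrow> nat" assume "\<sigma> \<in> (\<lambda>(y, x). case_gen x y) ` ?S"
      then obtain z where z: "z \<in> ?S" "\<sigma> = (case z of (y, x) \<Rightarrow> case_gen x y)" by (rule imageE)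
      obtain y x where yx: "z = (y, x)" by (rule prod.exhaust)
      have y: "y permutes U" "y ^^ 9 = id" "\<forall>i\<in>U. (y ^^ 3) i \<noteq> i"
        using z(1) by (simp_all add: yx cycle_perms_9_iff[OF assms])
      have x: "x permutes U" "x ^^ 2 = y ^^ 3"
        using z(1) sqrt_perms_iff[OF y(1)] by (simp_all add: yx)
      have "x ^^ 6 = (x ^^ 2) ^^ 3" by (simp add: funpow_mult)
      also have "\<dots> = y ^^ 9" unfolding x(2) by (simp add: funpow_mult)
      finally have "x ^^ 6 = id" using y(2) by simp
      then show "\<sigma> \<in> free_actions U"
        using x y by (simp add: free_actions_def Gamma33_actions_iff z(2) yx)
    qed
  qed
  then have "card (free_actions U) = card ?S" by (rule bij_betw_same_card)
  also have "\<dots> = (\<Sum>y\<in>cycle_perms {9} U. card (sqrt_perms (y ^^ 3) U))"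
  proof (rule card_SigmaI)
    show "\<forall>y\<in>cycle_perms {9} U. finite (sqrt_perms (y ^^ 3) U)"
      unfolding sqrt_perms_def by (auto intro: finite_subset[OF _ finite_permutations[OF assms]])
  qed (rule finite_cycle_perms[OF assms])
  also have "\<dots> = (\<Sum>y\<in>cycle_perms {9} U. sqrt_count (card U div 3))"
  proof (rule sum.cong)
    fix y assume y: "y \<in> cycle_perms {9} U"
    \<comment> \<open>The mere existence of \<open>y\<close> forces 9 to divide the number of
      points, so \<open>card U div 3\<close> is the exact number of cycles of
      \<open>y\<^sup>3\<close>. In all other cases the sum over \<open>y\<close> is empty.\<close>
    have "card U mod 9 = 0"
    proof (rule ccontr)
      assume "card U mod 9 \<noteq> 0"
      then have "cycle_coeff {9} (card U) = 0" by (intro cycle_coeff_9_eq_0) presburger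
      then have "of_nat (card (cycle_perms {9} U)) = (0 :: rat)"
        using card_cycle_perms[of "{9}" U] assms by simp
      then show False using y finite_cycle_perms[OF assms, of "{9}"] by auto
    qed
    then have "card U = 3 * (card U div 3)" by presburger
    from card_sqrt_perms[OF assms free_order3_cube[OF assms y] this]
    show "card (sqrt_perms (y ^^ 3) U) = sqrt_count (card U div 3)" .
  qed simp
  finally show ?thesis by simp
qed

section \<open>Splitting an action at the fixed points of \<open>c\<close>\<close>

text \<open>The fixed points of a central element form an invariant set; \<open>c\<close> commutes
  with each generator because it is a power of each. Finiteness turns the inclusion into an
  equality.\<close>

lemma Gamma33_fixed_image:
  assumes "\<sigma> \<in> actions Gamma33_rels S" "finite S"
  shows "\<sigma> a ` {i \<in> S. (\<sigma> X ^^ 2) i = i} = {i \<in> S. (\<sigma> X ^^ 2) i = i}" (is "\<sigma> a ` ?T = ?T")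
proof (rule endo_inj_surj)
  show "finite ?T" using assms(2) by simp
  have perm: "\<sigma> a permutes S" using assms(1) by (rule actions_permutes)
  then show "inj_on (\<sigma> a) ?T" by (rule permutes_inj_on)
  have "(\<sigma> X ^^ 2) (\<sigma> a i) = \<sigma> a ((\<sigma> X ^^ 2) i)" for i
  proof (cases a)
    case X
    then show ?thesis by (simp add: numeral_2_eq_2)
  next
    case Y
    have "\<sigma> X ^^ 2 = \<sigma> Y ^^ 3" using assms(1) by (simp add: Gamma33_actions_iff)
    then show ?thesis by (simp add: Y numeral_3_eq_3)
  qed
  then show "\<sigma> a ` ?T \<subseteq> ?T"
    using permutes_in_image[OF perm] by auto
qed

text \<open>Where \<open>c\<close> acts trivially the relations amount to
  \<open>x\<^sup>2 = y\<^sup>3 = 1\<close>; on the complement \<open>c\<close> moves every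
  point.\<close>

lemma card_Gamma33_actions_fixed:
  fixes S :: "nat set"
  assumes "T \<subseteq> S" "finite S"
  shows "card {\<sigma> \<in> actions Gamma33_rels S. {i \<in> S. (\<sigma> X ^^ 2) i = i} = T}
    = card (actions PSL_rels T) * card (free_actions (S - T))"
proof -
  let ?P = "\<lambda>\<tau>. \<forall>i\<in>T. (\<tau> X ^^ 2) i = i" and ?Q = "\<lambda>\<rho>. \<forall>i\<in>S - T. (\<rho> X ^^ 2) i \<noteq> i"
  have "{\<sigma> \<in> actions Gamma33_rels S. {i \<in> S. (\<sigma> X ^^ 2) i = i} = T}
    = {\<sigma> \<in> actions Gamma33_rels S. (\<forall>a. \<sigma> a ` T = T) \<and> ?P (restr T \<sigma>) \<and> ?Q (restr (S - T) \<sigma>)}"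
  proof (rule Collect_cong, rule conj_cong[OF refl])
    fix \<sigma> assume \<sigma>: "\<sigma> \<in> actions Gamma33_rels S"
    have r: "(restr V \<sigma> X ^^ 2) i = (\<sigma> X ^^ 2) i" if "\<And>a. \<sigma> a ` V = V" "i \<in> V" for V i
      using act_restr[OF \<sigma> that(1), of "gen_pow X 2" i] that(2) unfolding act_gen_pow by simp
    have r': "(restr (S - T) \<sigma> X ^^ 2) i = (\<sigma> X ^^ 2) i" if "\<And>a. \<sigma> a ` T = T" "i \<in> S - T" for i
      by (rule r[OF image_Diff_permutes[OF actions_permutes[OF \<sigma>] that(1)] that(2)])
    show "{i \<in> S. (\<sigma> X ^^ 2) i = i} = T \<longleftrightarrow>
      (\<forall>a. \<sigma> a ` T = T) \<and> ?P (restr T \<sigma>) \<and> ?Q (restr (S - T) \<sigma>)" (is "?L \<longleftrightarrow> ?R")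
    proof
      assume L: ?L
      have inv: "\<sigma> a ` T = T" for a using Gamma33_fixed_image[OF \<sigma> assms(2), of a] unfolding L .
      have "?P (restr T \<sigma>)" using r[OF inv] L by auto
      moreover have "?Q (restr (S - T) \<sigma>)" using r'[OF inv] L by auto
      ultimately show ?R using inv by blast
    next
      assume R: ?R
      then have inv: "\<sigma> a ` T = T" for a by blast
      have "(\<sigma> X ^^ 2) i = i" if "i \<in> T" for i using R r[OF inv that] that by simp
      moreover have "(\<sigma> X ^^ 2) i \<noteq> i" if "i \<in> S - T" for i using bspec[OF conjunct2[OF conjunct2[OF R]] that] r'[OF inv that] by simp
      ultimately show ?L using assms(1) by blast
    qed
  qed
  then have "card {\<sigma> \<in> actions Gamma33_rels S. {i \<in> S. (\<sigma> X ^^ 2) i = i} = T}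
    = card {\<tau> \<in> actions Gamma33_rels T. ?P \<tau>} * card {\<rho> \<in> actions Gamma33_rels (S - T). ?Q \<rho>}"
    using card_actions_split[OF assms(1), of Gamma33_rels ?P ?Q] by (rule trans[OF arg_cong[where f = card]])
  moreover have "{\<tau> \<in> actions Gamma33_rels T. ?P \<tau>} = actions PSL_rels T"
  proof (rule Set.set_eqI)
    fix \<tau> :: "gen \<Rightarrow> nat \<Rightarrow> nat"
    have 1: "\<tau> X ^^ 2 = id" if "\<tau> X permutes T" "?P \<tau>"
    proof
      fix i show "(\<tau> X ^^ 2) i = id i"
        using permutes_not_in[OF permutes_funpow[OF that(1)], of i 2] that(2) by (cases "i \<in> T") auto
    qed
    have 2: "\<tau> X ^^ 6 = id" if "\<tau> X ^^ 2 = id"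
    proof -
      have "\<tau> X ^^ 6 = (\<tau> X ^^ 2) ^^ 3" by (simp add: funpow_mult)
      then show ?thesis unfolding that by simp
    qed
    have 3: "\<tau> Y ^^ 9 = id" if "\<tau> Y ^^ 3 = id"
    proof -
      have "\<tau> Y ^^ 9 = (\<tau> Y ^^ 3) ^^ 3" by (simp add: funpow_mult)
      then show ?thesis unfolding that by simp
    qed
    show "\<tau> \<in> {\<tau> \<in> actions Gamma33_rels T. ?P \<tau>} \<longleftrightarrow> \<tau> \<in> actions PSL_rels T"
      unfolding mem_Collect_eq Gamma33_actions_iff PSL_actions_iff using 1 2 3 by (metis id_apply)
  qed
  ultimately show ?thesis by (simp add: free_actions_def)
qed

text \<open>This is \<open>H = H\<^sub>1 H\<^sub>2\<close> on coefficients: \<open>k\<close> is the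
  number of fixed points of \<open>c\<close>.\<close>

theorem num_actions_Gamma33:
  "num_actions Gamma33_rels n = (\<Sum>k\<le>n. (n choose k) *
    (card (actions PSL_rels {..<k}) * card (free_actions {..<n - k})))"
proof -
  let ?F = "\<lambda>\<sigma>. {i \<in> {..<n}. (\<sigma> X ^^ 2) i = i}"
  have img: "?F ` actions Gamma33_rels {..<n} \<subseteq> Pow {..<n}" by auto
  have "card (actions Gamma33_rels {..<n})
    = (\<Sum>T\<in>Pow {..<n}. \<Sum>\<sigma>\<in>{\<sigma> \<in> actions Gamma33_rels {..<n}. ?F \<sigma> = T}. 1)"
    using sum.group[OF _ _ img, of "\<lambda>_. 1::nat"] finite_actions[of "{..<n}" Gamma33_rels] by simp
  also have "\<dots> = (\<Sum>T\<in>Pow {..<n}. card (actions PSL_rels {..<card T}) *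
      card (free_actions {..<n - card T}))"
  proof (rule sum.cong)
    fix T assume "T \<in> Pow {..<n}"
    then have T: "T \<subseteq> {..<n}" and fin: "finite T" using finite_subset by auto
    then have card: "card ({..<n} - T) = n - card T" by (simp add: card_Diff_subset)
    have "of_nat (card (free_actions ({..<n} - T))) = (of_nat (card (free_actions {..<n - card T})) :: rat)"
      using card_cycle_perms[of "{9}" "{..<n} - T"] card_cycle_perms[of "{9}" "{..<n - card T}"]
      by (simp add: card_free_actions card)
    then show "(\<Sum>\<sigma>\<in>{\<sigma> \<in> actions Gamma33_rels {..<n}. ?F \<sigma> = T}. 1) =
        card (actions PSL_rels {..<card T}) * card (free_actions {..<n - card T})"
      using card_Gamma33_actions_fixed[OF T] card_actions[OF fin, of PSL_rels]
      by (simp add: num_actions_def)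
  qed simp
  also have "\<dots> = (\<Sum>k\<le>n. (n choose k) *
    (card (actions PSL_rels {..<k}) * card (free_actions {..<n - k})))"
    using sum_subsets_by_card[of "{..<n}" "\<lambda>k. card (actions PSL_rels {..<k}) * card (free_actions {..<n - k})"]
    by simp
  finally show ?thesis by (simp add: num_actions_def)
qed

section \<open>Generating functions\<close>

definition action_egf :: "('a gword \<times> 'a gword) set \<Rightarrow> rat fps" where
  "action_egf R = Abs_fps (\<lambda>n. of_nat (num_actions R n) / fact n)"

definition subgroup_series :: "('a gword \<times> 'a gword) set \<Rightarrow> int fps" where
  "subgroup_series R = Abs_fps (\<lambda>n. int (num_subgroups (presented_group R) (n + 1)))"

text \<open>Equations are derived over the rationals, where \<open>H\<^sub>1\<close> and
  \<open>H\<^sub>2\<close> live and can be cancelled, and are then pulled back along this injective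
  homomorphism.\<close>

definition rat_fps :: "int fps \<Rightarrow> rat fps" where
  "rat_fps f = Abs_fps (\<lambda>n. of_int (f $ n))"

lemma rat_fps_nth [simp]: "rat_fps f $ n = of_int (f $ n)"
  by (simp add: rat_fps_def)

lemma rat_fps_hom:
  "rat_fps (f + g) = rat_fps f + rat_fps g"
  "rat_fps (f - g) = rat_fps f - rat_fps g"
  "rat_fps (f * g) = rat_fps f * rat_fps g"
  "rat_fps (- f) = - rat_fps f"
  "rat_fps 1 = 1" "rat_fps 0 = 0" "rat_fps fps_X = fps_X" "rat_fps (numeral k) = numeral k"
  "rat_fps (fps_deriv f) = fps_deriv (rat_fps f)"
  by (simp_all add: fps_eq_iff fps_mult_nth fps_X_def numeral_fps_const)

lemma rat_fps_power: "rat_fps (f ^ n) = rat_fps f ^ n"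
  by (induction n) (simp_all add: rat_fps_hom)

lemma rat_fps_eq_iff: "rat_fps f = rat_fps g \<longleftrightarrow> f = g"
  by (simp add: fps_eq_iff)

lemma deriv_action_egf:
  fixes R :: "('a::finite gword \<times> 'a gword) set"
  shows "fps_deriv (action_egf R) = rat_fps (subgroup_series R) * action_egf R"
proof (rule fps_ext)
  fix n
  have "fps_deriv (action_egf R) $ n = of_nat (num_actions R (Suc n)) / fact n"
    unfolding action_egf_def fps_deriv_nth fps_nth_Abs_fps Suc_eq_plus1[symmetric] fact_Suc
    by (simp del: of_nat_Suc)
  also have "\<dots> = (\<Sum>k\<le>n. of_nat ((n choose k) *
      (fact k * num_subgroups (presented_group R) (Suc k) * num_actions R (n - k))) / fact n)"
    unfolding num_actions_Suc of_nat_sum by (rule sum_divide_distrib)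
  also have "\<dots> = (\<Sum>k\<le>n. rat_fps (subgroup_series R) $ k * action_egf R $ (n - k))"
  proof (rule sum.cong)
    fix k assume "k \<in> {..n}"
    then have "of_nat (n choose k) = (fact n / (fact k * fact (n - k)) :: rat)"
      by (intro binomial_fact) simp
    then show "of_nat ((n choose k) * (fact k * num_subgroups (presented_group R) (Suc k) * num_actions R (n - k))) / fact n
      = rat_fps (subgroup_series R) $ k * action_egf R $ (n - k)"
      by (simp add: subgroup_series_def action_egf_def field_simps)
  qed simp
  also have "\<dots> = (rat_fps (subgroup_series R) * action_egf R) $ n"
    by (simp add: fps_mult_nth atLeast0AtMost)
  finally show "fps_deriv (action_egf R) $ n = (rat_fps (subgroup_series R) * action_egf R) $ n" .
qed

text \<open>\<open>n div 3\<close> is meant as the number of \<open>c\<close>-cycles. It is exact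
  where it counts: the first factor vanishes unless 9 divides \<open>n\<close>.\<close>

definition free_egf :: "rat fps" where
  "free_egf = Abs_fps (\<lambda>n. cycle_coeff {9} n * of_nat (sqrt_count (n div 3)))"

lemma card_free_actions_egf:
  "of_nat (card (free_actions {..<n})) / fact n = free_egf $ n"
  using card_cycle_perms[of "{9}" "{..<n}"] by (simp add: card_free_actions free_egf_def)

lemma action_egf_Gamma33: "action_egf Gamma33_rels = action_egf PSL_rels * free_egf"
proof (rule fps_ext)
  fix n
  have "action_egf Gamma33_rels $ n = (\<Sum>k\<le>n. of_nat ((n choose k) *
    (card (actions PSL_rels {..<k}) * card (free_actions {..<n - k}))) / fact n)"
    unfolding action_egf_def num_actions_Gamma33 fps_nth_Abs_fps of_nat_sum by (rule sum_divide_distrib)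
  also have "\<dots> = (\<Sum>k\<le>n. action_egf PSL_rels $ k * free_egf $ (n - k))"
  proof (rule sum.cong)
    fix k assume "k \<in> {..n}"
    then have "of_nat (n choose k) = (fact n / (fact k * fact (n - k)) :: rat)"
      by (intro binomial_fact) simp
    then show "of_nat ((n choose k) * (card (actions PSL_rels {..<k}) * card (free_actions {..<n - k}))) / fact n
      = action_egf PSL_rels $ k * free_egf $ (n - k)"
      unfolding card_free_actions_egf[symmetric] by (simp add: action_egf_def num_actions_def field_simps)
  qed simp
  also have "\<dots> = (action_egf PSL_rels * free_egf) $ n"
    by (simp add: fps_mult_nth atLeast0AtMost)
  finally show "action_egf Gamma33_rels $ n = (action_egf PSL_rels * free_egf) $ n" .
qed

lemma free_egf_0: "free_egf $ 0 = 1"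
  by (simp add: free_egf_def cycle_coeff_0)

text \<open>A coefficient of \<open>H\<^sub>1\<close> is \<open>n!\<close> times two cycle
  coefficients. Giving \<open>n!\<close> to this factor leaves both factors with recurrences whose
  coefficients have degree at most one in \<open>n\<close>.\<close>

definition involution_count :: "nat \<Rightarrow> rat" where
  "involution_count n = fact n * cycle_coeff {1, 2} n"

lemma involution_count_rec:
  "involution_count 0 = 1" "involution_count 1 = 1"
  "involution_count (n + 2) = involution_count (n + 1) + (of_nat n + 1) * involution_count n"
proof -
  have rec: "of_nat (Suc n) * cycle_coeff {1, 2} (Suc n)
    = (\<Sum>d | d \<in> {1, 2} \<and> d \<le> Suc n. cycle_coeff {1, 2} (Suc n - d))" for n
    by (rule cycle_coeff_Suc) simp_all
  show "involution_count 0 = 1" by (simp add: involution_count_def cycle_coeff_0)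
  have "{d. d \<in> {1, 2} \<and> d \<le> Suc 0} = {1::nat}" by auto
  then show "involution_count 1 = 1" using rec[of 0] by (simp add: involution_count_def cycle_coeff_0)
  have "{d. d \<in> {1, 2} \<and> d \<le> Suc (Suc n)} = {1, 2::nat}" by auto
  then have "(of_nat n + 2) * cycle_coeff {1, 2} (n + 2) = cycle_coeff {1, 2} (n + 1) + cycle_coeff {1, 2} n"
    using rec[of "Suc n"] by (simp add: add.commute)
  then have "fact (n + 1) * ((of_nat n + 2) * cycle_coeff {1, 2} (n + 2))
    = fact (n + 1) * (cycle_coeff {1, 2} (n + 1) + cycle_coeff {1, 2} n)" by simp
  moreover have "(fact (n + 2) :: rat) = (of_nat n + 2) * fact (n + 1)" "(fact (n + 1) :: rat) = (of_nat n + 1) * fact n"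
    by (simp_all add: algebra_simps)
  ultimately show "involution_count (n + 2) = involution_count (n + 1) + (of_nat n + 1) * involution_count n"
    unfolding involution_count_def by (simp only:) (simp only: algebra_simps)
qed

lemma cycle_coeff_3_rec:
  "cycle_coeff {1, 3} 0 = 1" "cycle_coeff {1, 3} 1 = 1" "cycle_coeff {1, 3} 2 = 1 / 2"
  "(of_nat n + 3) * cycle_coeff {1, 3} (n + 3) = cycle_coeff {1, 3} (n + 2) + cycle_coeff {1, 3} n"
proof -
  have rec: "of_nat (Suc n) * cycle_coeff {1, 3} (Suc n)
    = (\<Sum>d | d \<in> {1, 3} \<and> d \<le> Suc n. cycle_coeff {1, 3} (Suc n - d))" for n
    by (rule cycle_coeff_Suc) simp_all
  show "cycle_coeff {1, 3} 0 = 1" by (rule cycle_coeff_0)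
  have "{d. d \<in> {1, 3} \<and> d \<le> Suc 0} = {1::nat}" by auto
  then show 1: "cycle_coeff {1, 3} 1 = 1" using rec[of 0] by (simp add: cycle_coeff_0)
  have "{d. d \<in> {1, 3} \<and> d \<le> Suc 1} = {1::nat}" by auto
  then show "cycle_coeff {1, 3} 2 = 1 / 2" using rec[of 1] 1 by (simp add: numeral_2_eq_2)
  have "{d. d \<in> {1, 3} \<and> d \<le> Suc (n + 2)} = {1, 3::nat}" by auto
  then show "(of_nat n + 3) * cycle_coeff {1, 3} (n + 3) = cycle_coeff {1, 3} (n + 2) + cycle_coeff {1, 3} n"
    using rec[of "n + 2"] by (simp add: numeral_3_eq_3 algebra_simps)
qed

lemma cycle_coeff_9_rec: "(of_nat n + 9) * cycle_coeff {9} (n + 9) = cycle_coeff {9} n"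
proof -
  have "of_nat (Suc (n + 8)) * cycle_coeff {9} (Suc (n + 8))
    = (\<Sum>d | d \<in> {9} \<and> d \<le> Suc (n + 8). cycle_coeff {9} (Suc (n + 8) - d))"
    by (rule cycle_coeff_Suc) simp_all
  moreover have "{d. d \<in> {9} \<and> d \<le> Suc (n + 8)} = {9::nat}" by auto
  moreover have "Suc (n + 8) = n + 9" by simp
  ultimately show ?thesis by (simp del: of_nat_Suc add_Suc_right)
qed

lemma action_egf_PSL_nth: "action_egf PSL_rels $ n = involution_count n * cycle_coeff {1, 3} n"
proof -
  have "of_nat (num_actions PSL_rels n) = (fact n * cycle_coeff {1, 2} n) * (fact n * cycle_coeff {1, 3} n)"
    using card_cycle_perms[of "{1, 2}" "{..<n}"] card_cycle_perms[of "{1, 3}" "{..<n}"]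
    by (simp add: num_actions_def card_PSL_actions)
  then show ?thesis by (simp add: action_egf_def involution_count_def)
qed

text \<open>The companion of \<open>free_egf\<close> with the square root count shifted by one. As
  \<open>sqrt_count\<close> has a recurrence of order two, advancing by three
  \<open>c\<close>-cycles closes up only on the pair of both series.\<close>

definition free_egf' :: "rat fps" where
  "free_egf' = Abs_fps (\<lambda>n. cycle_coeff {9} n * of_nat (sqrt_count (Suc (n div 3))))"

text \<open>One more 9-cycle of \<open>y\<close> means three more \<open>c\<close>-cycles. Iterating
  the recurrence for \<open>s = sqrt_count\<close> gives
  \<open>s(m+3) = (3m+7) s(m+1) + (3m+3) s(m)\<close>; with \<open>n = 3m\<close> this explains the
  constants 7 and 3, and a factor \<open>n\<close> becomes \<open>fps_X\<close> times the
  derivative.\<close>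

lemma free_egf_ode:
  "fps_X * fps_deriv free_egf = fps_X ^ 9 *
    (fps_X * fps_deriv free_egf' + 7 * free_egf' + fps_X * fps_deriv free_egf + 3 * free_egf)" (is ?A)
  "free_egf' = free_egf + fps_X ^ 9 * (free_egf' + fps_X * fps_deriv free_egf + 3 * free_egf)" (is ?B)
proof -
  have theta: "(fps_X * fps_deriv f) $ n = of_nat n * f $ n" for f :: "rat fps" and n
    by (cases n) simp_all
  have small: "cycle_coeff {9} n = 0" if "0 < n" "n < 9" for n
    using that by (intro cycle_coeff_9_eq_0) (auto dest: dvd_imp_le)
  have step: "cycle_coeff {9} (n + 9) * of_nat (sqrt_count (n div 3 + 3)) * (of_nat n + 9)
      = (of_nat n + 7) * cycle_coeff {9} n * of_nat (sqrt_count (Suc (n div 3)))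
        + (of_nat n + 3) * cycle_coeff {9} n * of_nat (sqrt_count (n div 3))"
    "cycle_coeff {9} (n + 9) * of_nat (sqrt_count (Suc (n div 3 + 3)))
      = cycle_coeff {9} (n + 9) * of_nat (sqrt_count (n div 3 + 3)) +
        cycle_coeff {9} n * of_nat (sqrt_count (Suc (n div 3)))
        + (of_nat n + 3) * cycle_coeff {9} n * of_nat (sqrt_count (n div 3))" for n
  proof -
    define m where "m = n div 3"
    have s: "of_nat (sqrt_count (m + 2)) = (of_nat (sqrt_count (Suc m)) + 3 * (of_nat m + 1) * of_nat (sqrt_count m) :: rat)"
      "of_nat (sqrt_count (m + 3)) = (of_nat (sqrt_count (m + 2)) + 3 * (of_nat m + 2) * of_nat (sqrt_count (Suc m)) :: rat)"
      "of_nat (sqrt_count (Suc (m + 3))) = (of_nat (sqrt_count (m + 3)) + 3 * (of_nat m + 3) * of_nat (sqrt_count (m + 2)) :: rat)"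
      by (simp_all add: numeral_2_eq_2 numeral_3_eq_3 algebra_simps)
    have y: "cycle_coeff {9} n = (of_nat n + 9) * cycle_coeff {9} (n + 9)"
      by (rule cycle_coeff_9_rec[symmetric])
    \<comment> \<open>If 9 divides \<open>n\<close>, then \<open>n = 3 m\<close> exactly; otherwise
      both cycle coefficients vanish and nothing remains to be shown.\<close>
    consider "cycle_coeff {9} n = 0" "cycle_coeff {9} (n + 9) = 0" | "of_nat n = (3 * of_nat m :: rat)"
    proof (cases "9 dvd n")
      case True
      then have "n = 3 * m" by (auto simp: m_def)
      then show ?thesis using that(2) by simp
    next
      case False
      then have "\<not> 9 dvd n + 9" by presburger
      then show ?thesis using False that(1) by (simp add: cycle_coeff_9_eq_0)
    qed
    then show "cycle_coeff {9} (n + 9) * of_nat (sqrt_count (n div 3 + 3)) * (of_nat n + 9)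
      = (of_nat n + 7) * cycle_coeff {9} n * of_nat (sqrt_count (Suc (n div 3)))
        + (of_nat n + 3) * cycle_coeff {9} n * of_nat (sqrt_count (n div 3))"
      "cycle_coeff {9} (n + 9) * of_nat (sqrt_count (Suc (n div 3 + 3)))
      = cycle_coeff {9} (n + 9) * of_nat (sqrt_count (n div 3 + 3)) +
        cycle_coeff {9} n * of_nat (sqrt_count (Suc (n div 3)))
        + (of_nat n + 3) * cycle_coeff {9} n * of_nat (sqrt_count (n div 3))"
      unfolding m_def[symmetric] s y by (cases; simp add: algebra_simps)+
  qed
  show ?A
  proof (rule fps_ext)
    fix n
    show "(fps_X * fps_deriv free_egf) $ n = (fps_X ^ 9 *
      (fps_X * fps_deriv free_egf' + 7 * free_egf' + fps_X * fps_deriv free_egf + 3 * free_egf)) $ n"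
    proof (cases "n < 9")
      case True
      then show ?thesis using small[of n]
        by (cases "n = 0") (simp_all add: fps_X_power_mult_nth theta free_egf_def)
    next
      case False
      then obtain k where n: "n = k + 9" by (metis add.commute le_Suc_ex not_less)
      have "(k + 9) div 3 = k div 3 + 3" by simp
      then show ?thesis using step(1)[of k]
        by (simp add: n fps_X_power_mult_nth theta free_egf_def free_egf'_def numeral_fps_const algebra_simps)
    qed
  qed
  show ?B
  proof (rule fps_ext)
    fix n
    show "free_egf' $ n
      = (free_egf + fps_X ^ 9 * (free_egf' + fps_X * fps_deriv free_egf + 3 * free_egf)) $ n"
    proof (cases "n < 9")
      case True
      then show ?thesis using small[of n]
        by (cases "n = 0") (simp_all add: fps_X_power_mult_nth free_egf_def free_egf'_def)
    next
      case False
      then obtain k where n: "n = k + 9" by (metis add.commute le_Suc_ex not_less)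
      have "(k + 9) div 3 = k div 3 + 3" by simp
      then show ?thesis using step(2)[of k]
        by (simp add: n fps_X_power_mult_nth theta free_egf_def free_egf'_def numeral_fps_const algebra_simps)
    qed
  qed
qed

text \<open>Keeps indices such as \<open>m + 1\<close> and \<open>m + 2\<close> in numeral form.\<close>

declare One_nat_def [simp del] add_2_eq_Suc [simp del] add_2_eq_Suc' [simp del]

section \<open>Differential and Riccati equations\<close>

text \<open>With recurrences of orders 2 and 3, all shifts of \<open>u\<close> lie in a space of
  dimension at most 6 over the rational functions in \<open>m\<close>, so they are linearly
  dependent. A relation reaching up to \<open>m + 9\<close> leaves room for coefficients of degree
  at most two, and the resulting differential equation has order two.\<close>

lemma PSL_recurrence:
  fixes a b :: "nat \<Rightarrow> rat"
  assumes a: "\<And>n. a (n + 2) = a (n + 1) + (of_nat n + 1) * a n"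
    and b: "\<And>n. (of_nat n + 3) * b (n + 3) = b (n + 2) + b n"
  defines "u \<equiv> \<lambda>n. a n * b n"
  shows "(of_nat m + 9) * u (m + 9) - 4 * ((of_nat m + 6) * u (m + 6)) - 2 * ((of_nat m + 5) * u (m + 5))
      - 4 * ((of_nat m + 3) * u (m + 3)) + 2 * ((of_nat m + 2) * u (m + 2)) + 4 * (of_nat m * u m)
    = u (m + 8) + u (m + 7) + 4 * u (m + 6) + 4 * u (m + 5) - u (m + 4) + 4 * u (m + 3)
      - 2 * u (m + 2) - 2 * u m
      + (of_nat m + 2) * (of_nat m + 3) * u (m + 3) - (of_nat m - 1) * of_nat m * u m"
proof -
  define M :: rat where "M = of_nat m"
  define p q where "p = a m" and "q = a (m + 1)"
  define r s t where "r = b (m + 9)" and "s = b (m + 8)" and "t = b (m + 7)"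
  have a': "a (m + (k + 2)) = a (m + (k + 1)) + (M + of_nat k + 1) * a (m + k)" for k
    using a[of "m + k"] by (simp add: M_def add.assoc)
  \<comment> \<open>The recurrence for \<open>b\<close> is solved downwards, which avoids division
    by polynomials in \<open>m\<close>. Hence everything is expressed by the two lowest values of
    \<open>a\<close> and the three highest of \<open>b\<close>.\<close>
  have b': "b (m + k) = (M + of_nat k + 3) * b (m + (k + 3)) - b (m + (k + 2))" for k
    using b[of "m + k"] by (simp add: M_def add.assoc)
  have A: "a (m + 2) = q + (M + 1) * p"
    "a (m + 3) = a (m + 2) + (M + 2) * q"
    "a (m + 4) = a (m + 3) + (M + 3) * a (m + 2)"
    "a (m + 5) = a (m + 4) + (M + 4) * a (m + 3)"
    "a (m + 6) = a (m + 5) + (M + 5) * a (m + 4)"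
    "a (m + 7) = a (m + 6) + (M + 6) * a (m + 5)"
    "a (m + 8) = a (m + 7) + (M + 7) * a (m + 6)"
    "a (m + 9) = a (m + 8) + (M + 8) * a (m + 7)"
    using a'[of 0] a'[of 1] a'[of 2] a'[of 3] a'[of 4] a'[of 5] a'[of 6] a'[of 7]
    by (simp_all add: p_def q_def algebra_simps)
  have B6: "b (m + 6) = (M + 9) * r - s" using b'[of 6] by (simp add: r_def s_def)
  have B5: "b (m + 5) = (M + 8) * s - t" using b'[of 5] by (simp add: s_def t_def)
  have B4: "b (m + 4) = (M + 7) * t - b (m + 6)" using b'[of 4] by (simp add: t_def)
  have B3: "b (m + 3) = (M + 6) * b (m + 6) - b (m + 5)" using b'[of 3] by simp
  have B2: "b (m + 2) = (M + 5) * b (m + 5) - b (m + 4)" using b'[of 2] by simp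
  have B0: "b m = (M + 3) * b (m + 3) - b (m + 2)" using b'[of 0] by simp
  have fold: "a m = p" "a (m + 1) = q" "b (m + 9) = r" "b (m + 8) = s" "b (m + 7) = t" "of_nat m = M"
    by (simp_all add: M_def p_def q_def r_def s_def t_def)
  show ?thesis
    unfolding u_def fold A B0 B2 B3 B4 B5 B6 by algebra
qed


lemma PSL_ode:
  defines "f \<equiv> action_egf PSL_rels"
  shows "fps_deriv f - 4 * (fps_X ^ 3 * fps_deriv f) - 2 * (fps_X ^ 4 * fps_deriv f)
      - 4 * (fps_X ^ 6 * fps_deriv f) + 2 * (fps_X ^ 7 * fps_deriv f) + 4 * (fps_X ^ 9 * fps_deriv f)
    = f + fps_X ^ 1 * f + 4 * (fps_X ^ 2 * f) + 4 * (fps_X ^ 3 * f) - fps_X ^ 4 * f + 4 * (fps_X ^ 5 * f)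
      - 2 * (fps_X ^ 6 * f) - 2 * (fps_X ^ 8 * f)
      + fps_X ^ 7 * fps_deriv (fps_deriv f) - fps_X ^ 10 * fps_deriv (fps_deriv f)" (is "?L = ?R")
proof (rule fps_ext)
  fix n
  let ?a = involution_count and ?b = "cycle_coeff {1, 3}"
  have f: "f $ k = ?a k * ?b k" for k by (simp add: f_def action_egf_PSL_nth)
  have X: "(fps_X ^ k * g) $ n = (if n < k then 0 else g $ (n - k))" for k and g :: "rat fps"
    by (rule fps_X_power_mult_nth)
  have num: "(numeral k * g) $ n = numeral k * g $ n" for k and g :: "rat fps"
    by (simp add: numeral_fps_const)
  have D2: "fps_deriv (fps_deriv f) $ k = (of_nat k + 1) * (of_nat k + 2) * f $ (k + 2)" for k
    unfolding fps_deriv_nth add.assoc one_add_one by (simp add: algebra_simps)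
  have D: "fps_deriv f $ k = (of_nat k + 1) * f $ (k + 1)" for k
    by simp
  note lin = fps_add_nth fps_sub_nth num X D2 D
  \<comment> \<open>The recurrence with \<open>m = n - 8\<close> covers \<open>n \<ge> 8\<close>;
    the coefficients below are computed.\<close>
  show "?L $ n = ?R $ n"
  proof (cases "n < 8")
    case True
    have a: "?a 0 = 1" "?a 1 = 1" "?a 2 = 2" "?a 3 = 4" "?a 4 = 10" "?a 5 = 26" "?a 6 = 76" "?a 7 = 232" "?a 8 = 764"
      using involution_count_rec(1,2) involution_count_rec(3)[of 0] involution_count_rec(3)[of 1]
        involution_count_rec(3)[of 2] involution_count_rec(3)[of 3] involution_count_rec(3)[of 4]
        involution_count_rec(3)[of 5] involution_count_rec(3)[of 6] by simp_all
    have b: "?b 0 = 1" "?b 1 = 1" "?b 2 = 1 / 2" "?b 3 = 1 / 2" "?b 4 = 3 / 8" "?b 5 = 7 / 40" "?b 6 = 9 / 80"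
      "?b 7 = 39 / 560" "?b 8 = 137 / 4480"
      using cycle_coeff_3_rec(1-3) cycle_coeff_3_rec(4)[of 0] cycle_coeff_3_rec(4)[of 1]
        cycle_coeff_3_rec(4)[of 2] cycle_coeff_3_rec(4)[of 3] cycle_coeff_3_rec(4)[of 4]
        cycle_coeff_3_rec(4)[of 5] by simp_all
    from True consider "n = 0" | "n = 1" | "n = 2" | "n = 3" | "n = 4" | "n = 5" | "n = 6" | "n = 7" by linarith
    then show ?thesis
      unfolding lin f by cases (simp_all add: a b flip: One_nat_def)
  next
    case False
    then obtain m where n: "n = m + 8" by (metis add.commute le_Suc_ex not_less)
    have *: "(of_nat m + 9) * f $ (m + 9) - 4 * ((of_nat m + 6) * f $ (m + 6)) - 2 * ((of_nat m + 5) * f $ (m + 5))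
      - 4 * ((of_nat m + 3) * f $ (m + 3)) + 2 * ((of_nat m + 2) * f $ (m + 2)) + 4 * (of_nat m * f $ m)
    = f $ (m + 8) + f $ (m + 7) + 4 * f $ (m + 6) + 4 * f $ (m + 5) - f $ (m + 4) + 4 * f $ (m + 3)
      - 2 * f $ (m + 2) - 2 * f $ m
      + (of_nat m + 2) * (of_nat m + 3) * f $ (m + 3) - (of_nat m - 1) * of_nat m * f $ m"
      unfolding f by (rule PSL_recurrence[OF involution_count_rec(3) cycle_coeff_3_rec(4)])
    have Suc_1_add: "Suc (k + 1) = k + 2" for k by simp
    \<comment> \<open>For \<open>m < 2\<close> the terms with \<open>X\<^sup>9 f'\<close> or
      \<open>X\<^sup>1\<^sup>0 f''\<close> may not reach the coefficient \<open>m + 8\<close>; the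
      factors \<open>m\<close> and \<open>(m - 1) m\<close> of the recurrence vanish
      accordingly.\<close>
    consider "m = 0" | "m = 1" | k where "m = k + 2"
      by (metis One_nat_def add_2_eq_Suc' not0_implies_Suc)
    then show ?thesis
      using * unfolding lin unfolding n
      by cases (simp_all add: algebra_simps Suc_1_add One_nat_def[symmetric])
  qed
qed

text \<open>Division by \<open>H\<^sub>1\<close>: if \<open>H\<^sub>1' = G H\<^sub>1\<close>, then
  \<open>H\<^sub>1'' = (G' + G\<^sup>2) H\<^sub>1\<close>, so the linear equation of order two
  becomes a Riccati equation for \<open>G\<close>, with integral coefficients and an integral
  unknown.\<close>

lemma PSL_riccati:
  defines "F \<equiv> subgroup_series PSL_rels"
  shows "F = 1 + fps_X + 4 * fps_X ^ 2 + 4 * fps_X ^ 3 - fps_X ^ 4 + 4 * fps_X ^ 5 - 2 * fps_X ^ 6 - 2 * fps_X ^ 8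
    + (4 * fps_X ^ 3 + 2 * fps_X ^ 4 + 4 * fps_X ^ 6 - 2 * fps_X ^ 7 - 4 * fps_X ^ 9) * F
    + (fps_X ^ 7 - fps_X ^ 10) * (fps_deriv F + F ^ 2)" (is "F = ?R")
proof -
  define f where "f = action_egf PSL_rels"
  define G where "G = rat_fps F"
  have f0: "f \<noteq> 0"
  proof
    assume "f = 0"
    then have "f $ 0 = 0" by simp
    then show False by (simp add: f_def action_egf_PSL_nth involution_count_rec cycle_coeff_3_rec)
  qed
  have D: "fps_deriv f = G * f" unfolding f_def G_def F_def by (rule deriv_action_egf)
  have D2: "fps_deriv (fps_deriv f) = (fps_deriv G + G ^ 2) * f"
    unfolding D by (simp add: D algebra_simps power2_eq_square)
  have "G * f = (1 + fps_X + 4 * fps_X ^ 2 + 4 * fps_X ^ 3 - fps_X ^ 4 + 4 * fps_X ^ 5 - 2 * fps_X ^ 6 - 2 * fps_X ^ 8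
    + (4 * fps_X ^ 3 + 2 * fps_X ^ 4 + 4 * fps_X ^ 6 - 2 * fps_X ^ 7 - 4 * fps_X ^ 9) * G
    + (fps_X ^ 7 - fps_X ^ 10) * (fps_deriv G + G ^ 2)) * f"
    using PSL_ode unfolding f_def[symmetric] D2 unfolding D by algebra
  then have "G = 1 + fps_X + 4 * fps_X ^ 2 + 4 * fps_X ^ 3 - fps_X ^ 4 + 4 * fps_X ^ 5 - 2 * fps_X ^ 6 - 2 * fps_X ^ 8
    + (4 * fps_X ^ 3 + 2 * fps_X ^ 4 + 4 * fps_X ^ 6 - 2 * fps_X ^ 7 - 4 * fps_X ^ 9) * G
    + (fps_X ^ 7 - fps_X ^ 10) * (fps_deriv G + G ^ 2)"
    by (rule mult_right_cancel[OF f0, THEN iffD1])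
  then have "rat_fps F = rat_fps ?R"
    unfolding rat_fps_hom rat_fps_power G_def .
  then show ?thesis unfolding rat_fps_eq_iff .
qed

text \<open>\<open>L\<close> is \<open>fps_X\<close> times the logarithmic derivative of
  \<open>H\<^sub>2\<close>. The second equation for \<open>free_egf\<close> and
  \<open>free_egf'\<close> yields their quotient \<open>N / (1 - w)\<close>; inserting it into the
  first and clearing denominators leaves an equation in \<open>L\<close> alone.\<close>

lemma free_riccati:
  defines "L \<equiv> fps_X * (subgroup_series Gamma33_rels - subgroup_series PSL_rels)"
  defines "w \<equiv> fps_X ^ 9"
  defines "N \<equiv> 1 + w * (L + 3)"
  shows "L * (1 - w) ^ 2 = w * ((1 - w) * (fps_X * fps_deriv N) + 9 * w * N + (1 - w) * (L + 7) * N
    + (1 - w) ^ 2 * (L + 3))" (is "?l = ?r")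
proof -
  define f where "f = free_egf"
  define g where "g = free_egf'"
  define h where "h = action_egf PSL_rels"
  define G where "G = rat_fps (subgroup_series Gamma33_rels)"
  define P where "P = rat_fps (subgroup_series PSL_rels)"
  have h0: "h \<noteq> 0"
  proof
    assume "h = 0"
    then have "h $ 0 = 0" by simp
    then show False by (simp add: h_def action_egf_PSL_nth involution_count_rec cycle_coeff_3_rec)
  qed
  have f0: "f $ 0 \<noteq> 0" by (simp add: f_def free_egf_0)
  then have f1: "f \<noteq> 0" by auto
  define l W where "l = fps_X * (G - P)" and "W = (fps_X ^ 9 :: rat fps)"
  have "fps_deriv (h * f) = G * (h * f)" "fps_deriv h = P * h"
    unfolding h_def f_def G_def P_def action_egf_Gamma33[symmetric] by (rule deriv_action_egf)+
  then have "h * fps_deriv f = h * ((G - P) * f)"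
    by (simp add: algebra_simps)
  then have "fps_deriv f = (G - P) * f" using h0 by simp
  then have Xf: "fps_X * fps_deriv f = l * f" by (simp add: l_def mult.assoc)
  define Q where "Q = g * inverse f"
  have g: "g = Q * f" using inverse_mult_eq_1[OF f0] by (simp add: Q_def mult.assoc)
  have Xg: "fps_X * fps_deriv g = (fps_X * fps_deriv Q + Q * l) * f"
    unfolding g using Xf by (simp add: algebra_simps)
  have "l * f = W * ((fps_X * fps_deriv Q + Q * l) * f + 7 * (Q * f) + l * f + 3 * f)"
    using free_egf_ode(1) unfolding f_def[symmetric] g_def[symmetric] W_def[symmetric] Xf Xg unfolding g .
  then have "l * f = (W * (fps_X * fps_deriv Q + Q * l + 7 * Q + l + 3)) * f"
    by (simp add: algebra_simps)
  then have 1: "l = W * (fps_X * fps_deriv Q + Q * l + 7 * Q + l + 3)" by (rule mult_right_cancel[OF f1, THEN iffD1])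
  have "Q * f = f + W * (Q * f + l * f + 3 * f)"
    using free_egf_ode(2) unfolding f_def[symmetric] g_def[symmetric] W_def[symmetric] Xf unfolding g .
  then have "Q * f = (1 + W * (Q + l + 3)) * f" by (simp add: algebra_simps)
  then have "Q = 1 + W * (Q + l + 3)" by (rule mult_right_cancel[OF f1, THEN iffD1])
  define n where "n = 1 + W * (l + 3)"
  have 2: "Q * (1 - W) = n" using \<open>Q = 1 + W * (Q + l + 3)\<close> by (simp add: n_def algebra_simps)
  have "fps_X * fps_deriv W = 9 * W"
    by (simp add: W_def fps_deriv_power power_eq_if numeral_fps_const algebra_simps)
  moreover have "fps_X * fps_deriv n = (fps_X * fps_deriv Q) * (1 - W) - Q * (fps_X * fps_deriv W)"
    unfolding 2[symmetric] by (simp add: algebra_simps)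
  ultimately have 3: "fps_X * fps_deriv n = (fps_X * fps_deriv Q) * (1 - W) - Q * (9 * W)" by simp
  have "l * (1 - W) ^ 2 = W * ((1 - W) * (fps_X * fps_deriv n) + 9 * W * n + (1 - W) * (l + 7) * n
    + (1 - W) ^ 2 * (l + 3))"
    unfolding 3 unfolding 2[symmetric] using 1 by algebra
  then have "rat_fps ?l = rat_fps ?r"
    unfolding L_def w_def N_def n_def l_def W_def G_def P_def rat_fps_hom rat_fps_power .
  then show ?thesis unfolding rat_fps_eq_iff .
qed

section \<open>Congruences for power series\<close>

text \<open>Congruence of all coefficients becomes divisibility in the ring of series, so that
  congruences can be treated by ring identities.\<close>

lemma numeral_dvd_fps_iff: "(numeral k :: int fps) dvd f \<longleftrightarrow> (\<forall>n. numeral k dvd f $ n)"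
proof
  assume "numeral k dvd f"
  then show "\<forall>n. numeral k dvd f $ n" by (auto simp: numeral_fps_const elim!: dvdE)
next
  assume *: "\<forall>n. numeral k dvd f $ n"
  have "f = numeral k * Abs_fps (\<lambda>n. f $ n div numeral k)"
    using * by (intro fps_ext) (simp add: numeral_fps_const)
  then show "numeral k dvd f" by (rule dvdI)
qed

text \<open>
  The coefficient of index \<open>n\<close> of the bracket times \<open>X\<close> involves only \<open>D $ i\<close> with \<open>i < n\<close>; this gives
  uniqueness modulo \<open>k\<close> of the solutions of the differential equations.
\<close>

lemma dvd_fps_contraction:
  fixes D :: "int fps"
  assumes "numeral k dvd D - fps_X * (A * D + fps_X * (B * fps_deriv D))"
  shows "numeral k dvd D"
  unfolding numeral_dvd_fps_iff
proof
  fix n show "numeral k dvd D $ n"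
  proof (induction n rule: less_induct)
    case (less n)
    have eq: "numeral k dvd D $ n - (fps_X * (A * D + fps_X * (B * fps_deriv D))) $ n" for n
      using assms unfolding numeral_dvd_fps_iff by simp
    have "numeral k dvd (fps_X * (A * D + fps_X * (B * fps_deriv D))) $ n"
    proof (cases n)
      case (Suc m)
      have "numeral k dvd (A * D) $ m"
        unfolding fps_mult_nth by (intro dvd_sum dvd_mult less.IH) (simp add: Suc)
      moreover have "numeral k dvd (fps_X * (B * fps_deriv D)) $ m"
      proof (cases m)
        case (Suc l)
        have "numeral k dvd (B * fps_deriv D) $ l"
          unfolding fps_mult_nth fps_deriv_nth
          by (intro dvd_sum dvd_mult less.IH) (simp add: Suc \<open>n = Suc m\<close>)
        then show ?thesis by (simp add: Suc)
      qed simp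
      ultimately show ?thesis by (simp add: Suc)
    qed simp
    from dvd_add[OF eq[of n] this] show ?case by (simp only: diff_add_cancel)
  qed
qed

text \<open>Frobenius modulo 2: mixed products occur in pairs, and \<open>a\<^sup>2\<close> and
  \<open>a\<close> have the same parity.\<close>

lemma square_cong_compose_X2: "(2 :: int fps) dvd f ^ 2 - (f oo fps_X ^ 2)"
  unfolding numeral_dvd_fps_iff
proof
  fix n
  let ?g = "\<lambda>i. f $ i * f $ (n - i)"
  let ?A = "{i. i \<le> n \<and> i < n - i}" and ?B = "{i. i \<le> n \<and> n - i < i}" and ?C = "{i. i \<le> n \<and> i = n - i}"
  have "{0..n} = ?A \<union> ?B \<union> ?C" by auto
  then have "(f ^ 2) $ n = sum ?g (?A \<union> ?B \<union> ?C)"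
    by (simp add: power2_eq_square fps_mult_nth)
  also have "\<dots> = sum ?g ?A + sum ?g ?B + sum ?g ?C"
    by (subst sum.union_disjoint; (subst sum.union_disjoint)?) auto
  also have "sum ?g ?B = sum ?g ?A"
    by (rule sum.reindex_bij_witness[where i = "\<lambda>i. n - i" and j = "\<lambda>i. n - i"]) auto
  also have "sum ?g ?C = (if even n then f $ (n div 2) * f $ (n div 2) else 0)"
  proof (cases "even n")
    case True
    then have E: "?C = {n div 2}" by auto
    show ?thesis unfolding E using True by auto
  next
    case False
    then have E: "?C = {}" by auto presburger
    show ?thesis unfolding E using False by simp
  qed
  finally have "(f ^ 2 - (f oo fps_X ^ 2)) $ n =
    2 * sum ?g ?A + (if even n then f $ (n div 2) * f $ (n div 2) - f $ (n div 2) else 0)"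
    by (simp add: fps_nth_compose_X_power)
  moreover have "even (a * a - a)" for a :: int by simp
  ultimately show "2 dvd (f ^ 2 - (f oo fps_X ^ 2)) $ n" by simp
qed

section \<open>Relations for \<Phi> and its derivative modulo 8\<close>

lemma Phi_fps_eq: "Phi_fps = fps_X + (Phi_fps oo fps_X ^ 2)"
proof (rule fps_ext)
  fix n :: nat
  have "(\<exists>k. n = 2 ^ k) \<longleftrightarrow> n = 1 \<or> (even n \<and> (\<exists>k. n div 2 = 2 ^ k))"
  proof
    assume "\<exists>k. n = 2 ^ k"
    then obtain k where "n = 2 ^ k" by blast
    then show "n = 1 \<or> (even n \<and> (\<exists>k. n div 2 = 2 ^ k))" by (cases k) auto
  next
    assume "n = 1 \<or> (even n \<and> (\<exists>k. n div 2 = 2 ^ k))"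
    then show "\<exists>k. n = 2 ^ k"
    proof
      assume "n = 1"
      then have "n = 2 ^ 0" by simp
      then show ?thesis by blast
    next
      assume "even n \<and> (\<exists>k. n div 2 = 2 ^ k)"
      then obtain k where "n = 2 * 2 ^ k" by auto
      then have "n = 2 ^ Suc k" by simp
      then show ?thesis by blast
    qed
  qed
  then show "Phi_fps $ n = (fps_X + (Phi_fps oo fps_X ^ 2)) $ n"
    by (auto simp: Phi_fps_nth fps_nth_compose_X_power)
qed

text \<open>With \<open>\<Psi> = \<Phi>(z\<^sup>2) = \<Phi> - z\<close>, Frobenius gives
  \<open>\<Phi>\<^sup>2 - \<Psi> = 2 e\<close>. Substituting \<open>z\<^sup>2\<close> for
  \<open>z\<close> and eliminating yields \<open>e = z \<Psi> + e(z\<^sup>2)\<close>, so Frobenius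
  for \<open>e\<close> makes \<open>e\<^sup>2 - e + z \<Psi>\<close> even. Four times this, written
  in \<open>2 e = \<Phi>\<^sup>2 - \<Phi> + z\<close>, is the quartic relation modulo 8.\<close>

lemma Phi_fps_relations:
  "(8 :: int fps) dvd (Phi_fps ^ 2 - Phi_fps + fps_X) ^ 2 - 2 * (Phi_fps ^ 2 - Phi_fps + fps_X)
    + 4 * fps_X * (Phi_fps - fps_X)"
  "(2 :: int fps) dvd Phi_fps ^ 2 + Phi_fps + fps_X"
proof -
  define \<Psi> where "\<Psi> = Phi_fps oo fps_X ^ 2"
  have Phi: "Phi_fps = fps_X + \<Psi>" unfolding \<Psi>_def by (rule Phi_fps_eq)
  obtain e where e: "Phi_fps ^ 2 - \<Psi> = 2 * e"
    using square_cong_compose_X2[of Phi_fps] unfolding \<Psi>_def by (elim dvdE)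
  have X0: "((fps_X :: int fps) ^ 2) $ 0 = 0" by simp
  have "(Phi_fps ^ 2 - \<Psi>) oo fps_X ^ 2 = (2 * e) oo fps_X ^ 2" unfolding e ..
  moreover have "(Phi_fps ^ 2) oo fps_X ^ 2 = \<Psi> ^ 2"
    by (simp only: power2_eq_square[of Phi_fps] power2_eq_square[of \<Psi>]
        fps_compose_mult_distrib[OF X0] \<Psi>_def[symmetric])
  moreover have "(2 * e) oo fps_X ^ 2 = 2 * (e oo fps_X ^ 2)"
    unfolding mult_2 fps_compose_add_distrib ..
  ultimately have "\<Psi> ^ 2 - (\<Psi> oo fps_X ^ 2) = 2 * (e oo fps_X ^ 2)"
    by (simp only: fps_compose_sub_distrib)
  moreover have "\<Psi> = fps_X ^ 2 + (\<Psi> oo fps_X ^ 2)"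
  proof -
    have "\<Psi> = (fps_X + \<Psi>) oo fps_X ^ 2"
      using arg_cong[where f = "\<lambda>u. u oo fps_X ^ 2", OF Phi] by (simp only: \<Psi>_def[symmetric])
    then show ?thesis by (simp add: fps_compose_add_distrib fps_X_fps_compose_startby0)
  qed
  ultimately have "2 * e = 2 * (fps_X * \<Psi> + (e oo fps_X ^ 2))"
    using e unfolding Phi by algebra
  then have ee: "e = fps_X * \<Psi> + (e oo fps_X ^ 2)"
    by (rule mult_left_cancel[THEN iffD1, rotated]) (simp add: numeral_fps_const)
  obtain d where d: "e ^ 2 - (e oo fps_X ^ 2) = 2 * d"
    using square_cong_compose_X2[of e] by (elim dvdE)
  have "(Phi_fps ^ 2 - Phi_fps + fps_X) ^ 2 - 2 * (Phi_fps ^ 2 - Phi_fps + fps_X)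
    + 4 * fps_X * (Phi_fps - fps_X) = 8 * d"
  proof -
    have s: "Phi_fps ^ 2 - Phi_fps + fps_X = 2 * e" "Phi_fps - fps_X = \<Psi>" using e Phi by (simp_all add: algebra_simps)
    show ?thesis unfolding s using ee d by algebra
  qed
  then show "(8 :: int fps) dvd (Phi_fps ^ 2 - Phi_fps + fps_X) ^ 2 - 2 * (Phi_fps ^ 2 - Phi_fps + fps_X)
    + 4 * fps_X * (Phi_fps - fps_X)" by (rule dvdI)
  have "Phi_fps ^ 2 + Phi_fps + fps_X = 2 * (Phi_fps + e)" using e Phi by algebra
  then show "(2 :: int fps) dvd Phi_fps ^ 2 + Phi_fps + fps_X" by (rule dvdI)
qed

text \<open>Differentiating the term with exponent \<open>2\<^sup>k\<close> produces the factor
  \<open>2\<^sup>k\<close>, so only \<open>k < 3\<close> survives modulo 8.\<close>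

lemma deriv_Phi_fps: "(8 :: int fps) dvd fps_deriv Phi_fps - (1 + 2 * fps_X + 4 * fps_X ^ 3)"
  unfolding numeral_dvd_fps_iff
proof
  fix n
  have X: "(2 * fps_X + 4 * fps_X ^ 3 :: int fps) $ n = (if n = 1 then 2 else if n = 3 then 4 else 0)"
    by (simp add: numeral_fps_const fps_X_power_nth)
  have Y: "(1 + 2 * fps_X + 4 * fps_X ^ 3 :: int fps) $ n = 1 $ n + (2 * fps_X + 4 * fps_X ^ 3 :: int fps) $ n"
    by (simp only: add.assoc fps_add_nth)
  have D: "(fps_deriv Phi_fps - (1 + 2 * fps_X + 4 * fps_X ^ 3)) $ n
    = (int n + 1) * of_bool (\<exists>k. n + 1 = 2 ^ k)
      - (if n = 0 then 1 else if n = 1 then 2 else if n = 3 then 4 else 0)"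
    unfolding fps_sub_nth Y X by (simp add: Phi_fps_nth)
  have "8 dvd (int n + 1) * of_bool (\<exists>k. n + 1 = 2 ^ k)
      - (if n = 0 then 1 else if n = 1 then 2 else if n = 3 then 4 else 0 :: int)"
  proof (cases "\<exists>k. n + 1 = 2 ^ k")
    case True
    then obtain k where k: "n + 1 = 2 ^ k" by blast
    consider "k = 0" | "k = 1" | "k = 2" | "k \<ge> 3" by linarith
    then show ?thesis
    proof cases
      case 4
      define j where "j = k - 3"
      then have kj: "k = j + 3" using 4 by simp
      have "int n + 1 = 2 ^ k" using k by (metis of_nat_1 of_nat_add of_nat_numeral of_nat_power)
      then have "int n + 1 = 8 * 2 ^ j" by (simp add: kj power_add)
      moreover have "(1 :: int) \<le> 2 ^ j" by simp
      then have "n \<noteq> 0" "n \<noteq> 1" "n \<noteq> 3" using \<open>int n + 1 = 8 * 2 ^ j\<close> by linarith+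
      ultimately show ?thesis using True by simp
    qed (use k True in \<open>simp_all\<close>)
  next
    case False
    then have "n + 1 \<noteq> 2 ^ k" for k by blast
    from this[of 0] this[of 1] this[of 2] have "n \<noteq> 0" "n \<noteq> 1" "n \<noteq> 3" by auto
    then show ?thesis using False by simp
  qed
  then show "8 dvd (fps_deriv Phi_fps - (1 + 2 * fps_X + 4 * fps_X ^ 3)) $ n" unfolding D .
qed

section \<open>The solutions modulo 8\<close>

text \<open>
  The asserted value of \<open>z\<^sup>7 S\<^sub>1\<close> is \<open>modular_value z \<Phi>\<close>, that of \<open>z S\<^sub>2\<close> is \<open>free_value (z\<^sup>9)\<close>. The cofactors
  in the two identities below come from division by the quartic relation for \<open>\<Phi>\<close> modulo 8, followed by
  division by \<open>4 (\<Phi>\<^sup>2 + \<Phi> + z)\<close>.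
\<close>

definition modular_coeff0 :: "'a :: idom \<Rightarrow> 'a" where
  "modular_coeff0 x =
    6 * x + 3 * x ^ 2 + 7 * x ^ 4 + 7 * x ^ 5 + 6 * x ^ 7 + 4 * x ^ 8 + 4 * x ^ 9 + 4 * x ^ 10 + 6 *
    x ^ 11 + 4 * x ^ 12 - 2 * x ^ 15 + 4 * x ^ 16 + 4 * x ^ 17 + 4 * x ^ 18 + 4 * x ^ 19 + 4 * x ^
    21 - 4 * x ^ 24 + 4 * x ^ 27"

definition modular_coeff1 :: "'a :: idom \<Rightarrow> 'a" where
  "modular_coeff1 x =
    2 + 6 * x + 6 * x ^ 3 + 6 * x ^ 4 + 4 * x ^ 6 + 4 * x ^ 9 + 4 * x ^ 10"

definition modular_coeff2 :: "'a :: idom \<Rightarrow> 'a" where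
  "modular_coeff2 x =
    5 + 6 * x + 6 * x ^ 2 + 5 * x ^ 3 + 2 * x ^ 4 + 6 * x ^ 5 + 4 * x ^ 6 + 4 * x ^ 7 + 6 * x ^ 9 +
    4 * x ^ 10 + 4 * x ^ 11 + 4 * x ^ 15"

definition modular_coeff3 :: "'a :: idom \<Rightarrow> 'a" where
  "modular_coeff3 x =
    2 + 4 * x + 4 * x ^ 2 + 2 * x ^ 3 + 4 * x ^ 4 + 4 * x ^ 5 + 4 * x ^ 9"

text \<open>The derivatives of the four coefficient polynomials are written out, so that the
  identity to be checked is purely algebraic.\<close>

definition modular_coeff0' :: "'a :: idom \<Rightarrow> 'a" where
  "modular_coeff0' x =
    6 + 6 * x + 28 * x ^ 3 + 35 * x ^ 4 + 42 * x ^ 6 + 32 * x ^ 7 + 36 * x ^ 8 + 40 * x ^ 9 + 66 * x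
    ^ 10 + 48 * x ^ 11 - 30 * x ^ 14 + 64 * x ^ 15 + 68 * x ^ 16 + 72 * x ^ 17 + 76 * x ^ 18 + 84 *
    x ^ 20 - 96 * x ^ 23 + 108 * x ^ 26"

definition modular_coeff1' :: "'a :: idom \<Rightarrow> 'a" where
  "modular_coeff1' x =
    6 + 18 * x ^ 2 + 24 * x ^ 3 + 24 * x ^ 5 + 36 * x ^ 8 + 40 * x ^ 9"

definition modular_coeff2' :: "'a :: idom \<Rightarrow> 'a" where
  "modular_coeff2' x =
    6 + 12 * x + 15 * x ^ 2 + 8 * x ^ 3 + 30 * x ^ 4 + 24 * x ^ 5 + 28 * x ^ 6 + 54 * x ^ 8 + 40 * x
    ^ 9 + 44 * x ^ 10 + 60 * x ^ 14"

definition modular_coeff3' :: "'a :: idom \<Rightarrow> 'a" where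
  "modular_coeff3' x =
    4 + 8 * x + 6 * x ^ 2 + 16 * x ^ 3 + 20 * x ^ 4 + 36 * x ^ 8"

definition modular_value :: "'a :: idom \<Rightarrow> 'a \<Rightarrow> 'a" where
  "modular_value x f = modular_coeff0 x + modular_coeff1 x * f + modular_coeff2 x * f ^ 2 + modular_coeff3 x * f ^ 3"

definition modular_value_dx :: "'a :: idom \<Rightarrow> 'a \<Rightarrow> 'a" where
  "modular_value_dx x f =
    modular_coeff0' x + modular_coeff1' x * f + modular_coeff2' x * f ^ 2 + modular_coeff3' x * f ^ 3"

definition modular_value_df :: "'a :: idom \<Rightarrow> 'a \<Rightarrow> 'a" where
  "modular_value_df x f = modular_coeff1 x + 2 * modular_coeff2 x * f + 3 * modular_coeff3 x * f ^ 2"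

definition free_value :: "'a :: idom \<Rightarrow> 'a" where
  "free_value w = 2 * w + 4 * w ^ 2 + 6 * w ^ 3 + 4 * w ^ 4 + 4 * w ^ 5 + 4 * w ^ 6 + 4 * w ^ 7"

text \<open>\<open>X\<close> times the derivative of \<open>free_value (X\<^sup>9)\<close>; the
  factor 9 comes from the inner power.\<close>

definition free_value_theta :: "'a :: idom \<Rightarrow> 'a" where
  "free_value_theta w =
    9 * (2 * w + 8 * w ^ 2 + 18 * w ^ 3 + 16 * w ^ 4 + 20 * w ^ 5 + 24 * w ^ 6 + 28 * w ^ 7)"

lemma free_mod8_identity:
  fixes w :: "'a :: idom"
  defines "l \<equiv> free_value w"
  defines "n \<equiv> 1 + w * (l + 3)"
  shows "w * ((1 - w) * (9 * w * (l + 3) + w * free_value_theta w) + 9 * w * n + (1 - w) * (l + 7) * n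
      + (1 - w) ^ 2 * (l + 3)) - l * (1 - w) ^ 2
    = 8 * (w + 6 * w ^ 2 + 5 * w ^ 3 + 15 * w ^ 4 + 21 * w ^ 5 + 3 * w ^ 6 + 12 * w ^ 7 + 12 * w ^ 8 + 9
      * w ^ 9 - 34 * w ^ 10 - 2 * w ^ 12 - 4 * w ^ 13 - 2 * w ^ 14 - 2 * w ^ 15 - 2 * w ^ 16 - 2 * w
      ^ 17)"
  unfolding n_def l_def free_value_def free_value_theta_def by algebra

lemma modular_mod8_identity:
  fixes x f :: "'a :: idom"
  defines "P \<equiv> modular_value x f"
  shows "x ^ 7 * (1 + x + 4 * x ^ 2 + 4 * x ^ 3 - x ^ 4 + 4 * x ^ 5 - 2 * x ^ 6 - 2 * x ^ 8)
    + (4 * x ^ 3 + 2 * x ^ 4 + 4 * x ^ 6 - 2 * x ^ 7 - 4 * x ^ 9) * P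
    + (1 - x ^ 3) * (x ^ 7 * (modular_value_dx x f + modular_value_df x f * (1 + 2 * x + 4 * x ^ 3))
      - 7 * x ^ 6 * P + P ^ 2) - P
    = ((- 3 + 4 * x - 3 * x ^ 3 + 3 * x ^ 6 - x ^ 9 + 4 * x ^ 13 + 4 * x ^ 15 + 4 * x ^ 18 + 4 * x ^
      21) + (4 + 4 * x ^ 3 + 4 * x ^ 6 + 4 * x ^ 9) * f + (4 + 4 * x ^ 3 + 4 * x ^ 6 + 4 * x ^ 9) *
      f ^ 2)
      * ((f ^ 2 - f + x) ^ 2 - 2 * (f ^ 2 - f + x) + 4 * x * (f - x))
    + 4 * ((1 + x ^ 3 + x ^ 6 + x ^ 8 + x ^ 9 + x ^ 14) + (x ^ 7 + x ^ 13) * f) * (f ^ 2 + f + x)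
    + 8 * ((- 2 * x + 4 * x ^ 2 + 6 * x ^ 3 + 2 * x ^ 4 + 7 * x ^ 5 + 12 * x ^ 6 + 6 * x ^ 7 + 10 * x ^ 8
      + 9 * x ^ 9 + 16 * x ^ 10 + 11 * x ^ 11 + 8 * x ^ 12 + 16 * x ^ 13 + 5 * x ^ 14 - x ^ 15 - 2 *
      x ^ 16 + x ^ 17 - 4 * x ^ 19 + 2 * x ^ 20 - 3 * x ^ 21 + 13 * x ^ 22 + 9 * x ^ 23 + 2 * x ^ 24
      - 11 * x ^ 25 - 16 * x ^ 26 - 2 * x ^ 27 - 5 * x ^ 29 - 19 * x ^ 30 - 14 * x ^ 31 - 5 * x ^ 32
      + 10 * x ^ 33 - 2 * x ^ 34 - 3 * x ^ 35 - 10 * x ^ 36 + 6 * x ^ 37 + 6 * x ^ 38 + 6 * x ^ 39 -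
      12 * x ^ 40 - 16 * x ^ 41 - 14 * x ^ 42 + 8 * x ^ 44 + 4 * x ^ 45 + 4 * x ^ 46 - 4 * x ^ 47 +
      6 * x ^ 48 - 4 * x ^ 49 - 10 * x ^ 51 + 6 * x ^ 54 - 2 * x ^ 57) + (3 * x + 11 * x ^ 2 + 5 * x
      ^ 3 + 14 * x ^ 4 + 20 * x ^ 5 + 11 * x ^ 6 + 11 * x ^ 7 + 12 * x ^ 8 + 10 * x ^ 9 + 21 * x ^
      10 + 10 * x ^ 11 + 15 * x ^ 12 + x ^ 13 - 12 * x ^ 14 - x ^ 15 - 18 * x ^ 16 - 7 * x ^ 17 - 17
      * x ^ 18 + 2 * x ^ 19 + 5 * x ^ 21 - x ^ 22 - 20 * x ^ 23 - 20 * x ^ 24 - 17 * x ^ 25 - 4 * x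
      ^ 26 + 2 * x ^ 27 - 2 * x ^ 28 - 4 * x ^ 29 - 2 * x ^ 30 + 2 * x ^ 31 - 4 * x ^ 32 - 6 * x ^
      33 - 14 * x ^ 34 + 4 * x ^ 36 + 8 * x ^ 37 - 4 * x ^ 39 - 4 * x ^ 40) * f + (- 2 + 11 * x + 17
      * x ^ 2 + 16 * x ^ 3 + 27 * x ^ 4 + 23 * x ^ 5 + 22 * x ^ 6 + 18 * x ^ 7 + 10 * x ^ 8 + 13 * x
      ^ 9 + 22 * x ^ 10 + 28 * x ^ 11 + 24 * x ^ 12 - 2 * x ^ 13 - 7 * x ^ 14 - 23 * x ^ 15 - 18 * x
      ^ 16 - 16 * x ^ 17 - 4 * x ^ 18 + 4 * x ^ 19 - 4 * x ^ 20 + 2 * x ^ 21 - 21 * x ^ 22 - 12 * x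
      ^ 23 - 29 * x ^ 24 - 25 * x ^ 25 - 12 * x ^ 26 + 7 * x ^ 27 + 10 * x ^ 28 - 10 * x ^ 29 - 13 *
      x ^ 30 - 16 * x ^ 31 + 6 * x ^ 32 - 7 * x ^ 33 - 2 * x ^ 34 - 18 * x ^ 35 + 8 * x ^ 36 + 8 * x
      ^ 38 - 14 * x ^ 39 - 4 * x ^ 40 - 4 * x ^ 41 + 8 * x ^ 42 - 4 * x ^ 45) * f ^ 2 + (1 + 12 * x
      + 19 * x ^ 2 + 25 * x ^ 3 + 21 * x ^ 4 + 25 * x ^ 5 + 29 * x ^ 6 + 5 * x ^ 7 + 2 * x ^ 8 - 2 *
      x ^ 9 + 20 * x ^ 10 + 12 * x ^ 11 + x ^ 12 - 8 * x ^ 13 - 13 * x ^ 14 - 15 * x ^ 15 - 20 * x ^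
      16 - 22 * x ^ 17 - 12 * x ^ 18 - 4 * x ^ 19 + 6 * x ^ 20 + 4 * x ^ 21 - 16 * x ^ 22 - 14 * x ^
      23 - 22 * x ^ 24 - 6 * x ^ 25 - 8 * x ^ 26 - 2 * x ^ 27 - 4 * x ^ 28 - 4 * x ^ 29 + 2 * x ^ 30
      + 4 * x ^ 32 - 10 * x ^ 33 - 4 * x ^ 34 - 4 * x ^ 35 + 8 * x ^ 36 - 4 * x ^ 39) * f ^ 3 + (6 +
      11 * x + 20 * x ^ 2 + 23 * x ^ 3 + 15 * x ^ 4 + 18 * x ^ 5 + 13 * x ^ 6 + 6 * x ^ 7 - 2 * x ^
      8 - 2 * x ^ 9 + 5 * x ^ 10 + 4 * x ^ 11 + 6 * x ^ 12 - 12 * x ^ 13 - 14 * x ^ 14 - 13 * x ^ 15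
      - 8 * x ^ 16 - 12 * x ^ 17 - 10 * x ^ 18 - 10 * x ^ 19 - 10 * x ^ 21 - 6 * x ^ 22 - 14 * x ^
      23 - 2 * x ^ 24 - 2 * x ^ 25 + 4 * x ^ 26 - 6 * x ^ 27 - 4 * x ^ 28 - 4 * x ^ 29 + 2 * x ^ 30
      - 2 * x ^ 33) * f ^ 4 + (3 + 8 * x + 14 * x ^ 2 + 15 * x ^ 3 + 12 * x ^ 4 + 10 * x ^ 5 + 8 * x
      ^ 6 + 4 * x ^ 7 - 6 * x ^ 8 - 2 * x ^ 9 + 2 * x ^ 10 + 8 * x ^ 11 - 2 * x ^ 12 - 12 * x ^ 13 -
      8 * x ^ 14 - 6 * x ^ 15 - 2 * x ^ 16 - 14 * x ^ 17 - 6 * x ^ 18 - 4 * x ^ 19 + 4 * x ^ 20 - 8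
      * x ^ 21 - 8 * x ^ 22 - 8 * x ^ 23 + 4 * x ^ 24 - 4 * x ^ 27) * f ^ 5 + (2 * x + 4 * x ^ 2 + 4
      * x ^ 3 + 4 * x ^ 4 + 4 * x ^ 5 + 3 * x ^ 6 - 4 * x ^ 8 - 3 * x ^ 9 - 4 * x ^ 12 - 2 * x ^ 13
      - 2 * x ^ 15 - 4 * x ^ 16 - 4 * x ^ 17 + 2 * x ^ 18 - 2 * x ^ 21) * f ^ 6)"
  unfolding P_def modular_value_def modular_value_dx_def modular_value_df_def
    modular_coeff0_def modular_coeff1_def modular_coeff2_def modular_coeff3_def
    modular_coeff0'_def modular_coeff1'_def modular_coeff2'_def modular_coeff3'_def
  by algebra

text \<open>Fits the form of the cofactor identity: \<open>q\<close> is the relation modulo 8,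
  \<open>t\<close> the one modulo 2, which enters with a factor 4.\<close>

lemma eight_dvd_combination:
  fixes a :: "'a :: comm_ring_1"
  assumes "8 dvd q" "2 dvd t"
  shows "8 dvd a * q + 4 * s * t + 8 * u"
proof -
  obtain c d where "q = 8 * c" "t = 2 * d" using assms by (elim dvdE)
  then have "a * q + 4 * s * t + 8 * u = 8 * (a * c + s * d + u)" by (simp add: algebra_simps)
  then show ?thesis by simp
qed

lemma deriv_numeral_mult: "fps_deriv (numeral k * f) = numeral k * fps_deriv (f :: int fps)"
  by (simp add: numeral_fps_const)

lemma deriv_numeral: "fps_deriv (numeral k :: int fps) = 0"
  by (simp add: numeral_fps_const)

lemma deriv_X_power: "fps_deriv (fps_X ^ n :: int fps) = of_nat n * fps_X ^ (n - 1)"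
  by (simp add: fps_deriv_power fps_of_nat)

lemma deriv_modular_value:
  "fps_deriv (modular_value fps_X f) = modular_value_dx fps_X f + modular_value_df fps_X f * fps_deriv (f :: int fps)"
proof -
  have "fps_deriv (modular_coeff0 fps_X) = (modular_coeff0' fps_X :: int fps)"
    "fps_deriv (modular_coeff1 fps_X) = (modular_coeff1' fps_X :: int fps)"
    "fps_deriv (modular_coeff2 fps_X) = (modular_coeff2' fps_X :: int fps)"
    "fps_deriv (modular_coeff3 fps_X) = (modular_coeff3' fps_X :: int fps)"
    unfolding modular_coeff0_def modular_coeff1_def modular_coeff2_def modular_coeff3_def
      modular_coeff0'_def modular_coeff1'_def modular_coeff2'_def modular_coeff3'_def
    by (simp_all only: fps_deriv_add fps_deriv_sub deriv_numeral_mult deriv_X_power deriv_numeral fps_deriv_fps_X)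
      simp_all
  moreover have "fps_deriv (f ^ 2) = 2 * f * fps_deriv f" "fps_deriv (f ^ 3) = 3 * f ^ 2 * fps_deriv f"
    by (simp_all add: power2_eq_square power3_eq_cube algebra_simps)
  ultimately show ?thesis
    unfolding modular_value_def modular_value_dx_def modular_value_df_def
    by (simp add: algebra_simps)
qed

section \<open>Uniqueness of the solutions modulo 8\<close>

text \<open>The exact equation is compared with one that holds up to \<open>v\<close>. In
  \<open>h\<^sup>2 - p\<^sup>2 = (h + p) (h - p)\<close> the zero constant terms of \<open>h\<close>
  and \<open>p\<close> supply the factor \<open>x\<close> that \<open>dvd_fps_contraction\<close>
  demands.\<close>

lemma riccati_difference:
  fixes x :: "'a :: idom"
  assumes "h = x ^ 7 * c + x * a * h + (1 - x ^ 3) * (x ^ 7 * h' - 7 * x ^ 6 * h + h ^ 2)"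
    and "x ^ 7 * c + x * a * p + (1 - x ^ 3) * (x ^ 7 * p' - 7 * x ^ 6 * p + p ^ 2) - p = v"
    and "h = x * k" "p = x * m"
  shows "(h - p) - x * ((a + (1 - x ^ 3) * (k + m - 7 * x ^ 5)) * (h - p)
    + x * ((1 - x ^ 3) * x ^ 5 * (h' - p'))) = v"
proof -
  have "(1 - x ^ 3) * (h ^ 2 - p ^ 2) = (1 - x ^ 3) * x * (k + m) * (h - p)"
    unfolding assms(3,4) by algebra
  then show ?thesis using assms(1,2) by algebra
qed

lemma modular_series_mod8:
  "(8 :: int fps) dvd fps_X ^ 7 * subgroup_series PSL_rels - modular_value fps_X Phi_fps"
proof -
  define F where "F = subgroup_series PSL_rels"
  \<comment> \<open>The factor \<open>X\<^sup>7\<close> clears the poles of the asserted solution.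
    In the equation it turns \<open>X\<^sup>1\<^sup>4 F'\<close> into
    \<open>X\<^sup>7 h' - 7 X\<^sup>6 h\<close>.\<close>
  define h where "h = fps_X ^ 7 * F"
  define P where "P = modular_value fps_X Phi_fps"
  let ?x = "fps_X :: int fps"
  let ?c = "1 + ?x + 4 * ?x ^ 2 + 4 * ?x ^ 3 - ?x ^ 4 + 4 * ?x ^ 5 - 2 * ?x ^ 6 - 2 * ?x ^ 8"
  let ?a = "4 * ?x ^ 2 + 2 * ?x ^ 3 + 4 * ?x ^ 5 - 2 * ?x ^ 6 - 4 * ?x ^ 8"
  have "fps_deriv h = 7 * ?x ^ 6 * F + ?x ^ 7 * fps_deriv F"
    unfolding h_def by (simp add: deriv_X_power)
  then have "h = ?x ^ 7 * ?c + ?x * ?a * h + (1 - ?x ^ 3) * (?x ^ 7 * fps_deriv h - 7 * ?x ^ 6 * h + h ^ 2)"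
    using PSL_riccati unfolding F_def[symmetric] h_def by algebra
  moreover
  have "8 dvd ?x ^ 7 * ?c + ?x * ?a * P + (1 - ?x ^ 3) * (?x ^ 7 * fps_deriv P - 7 * ?x ^ 6 * P + P ^ 2) - P"
  proof -
    have e: "8 dvd ?x ^ 7 * ?c + (4 * ?x ^ 3 + 2 * ?x ^ 4 + 4 * ?x ^ 6 - 2 * ?x ^ 7 - 4 * ?x ^ 9) * P
      + (1 - ?x ^ 3) * (?x ^ 7 * (modular_value_dx ?x Phi_fps + modular_value_df ?x Phi_fps * (1 + 2 * ?x + 4 * ?x ^ 3))
      - 7 * ?x ^ 6 * P + P ^ 2) - P" (is "8 dvd ?e")
      unfolding P_def modular_mod8_identity by (rule eight_dvd_combination[OF Phi_fps_relations])
    \<comment> \<open>The algebraic identity uses the derivative of \<open>Phi_fps\<close> reduced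
      modulo 8; the error is absorbed into a multiple of 8.\<close>
    obtain g where "fps_deriv Phi_fps - (1 + 2 * ?x + 4 * ?x ^ 3) = 8 * g"
      using deriv_Phi_fps by (elim dvdE)
    then have eq: "?x ^ 7 * ?c + ?x * ?a * P + (1 - ?x ^ 3) * (?x ^ 7 * fps_deriv P - 7 * ?x ^ 6 * P + P ^ 2) - P
      = ?e + 8 * ((1 - ?x ^ 3) * ?x ^ 7 * modular_value_df ?x Phi_fps * g)"
      unfolding P_def deriv_modular_value by algebra
    show ?thesis unfolding eq using e dvd_triv_left by (rule dvd_add)
  qed
  then obtain v where "?x ^ 7 * ?c + ?x * ?a * P
      + (1 - ?x ^ 3) * (?x ^ 7 * fps_deriv P - 7 * ?x ^ 6 * P + P ^ 2) - P = 8 * v"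
    by (elim dvdE)
  moreover have "h = ?x * (?x ^ 6 * F)" by (simp add: h_def power_eq_if mult.assoc)
  moreover have "P = ?x * fps_shift 1 P"
  proof -
    have "P $ 0 = 0"
      by (simp add: P_def modular_value_def modular_coeff0_def Phi_fps_nth power2_eq_square power3_eq_cube)
    then show ?thesis by (intro fps_ext) (simp add: fps_X_mult_nth)
  qed
  ultimately have "(h - P) - ?x * ((?a + (1 - ?x ^ 3) * (?x ^ 6 * F + fps_shift 1 P - 7 * ?x ^ 5)) * (h - P)
      + ?x * ((1 - ?x ^ 3) * ?x ^ 5 * (fps_deriv h - fps_deriv P))) = 8 * v"
    by (rule riccati_difference)
  then have "8 dvd (h - P) - ?x * ((?a + (1 - ?x ^ 3) * (?x ^ 6 * F + fps_shift 1 P - 7 * ?x ^ 5)) * (h - P)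
      + ?x * ((1 - ?x ^ 3) * ?x ^ 5 * fps_deriv (h - P)))"
    by (simp only: fps_deriv_sub dvd_triv_left)
  from dvd_fps_contraction[OF this] show ?thesis unfolding h_def P_def F_def .
qed

text \<open>The right-hand side carries the factor \<open>w = x\<^sup>9\<close>, which provides all
  powers of \<open>x\<close> needed for the contraction. The summand \<open>2 - w\<close> stems from
  \<open>1 - (1 - w)\<^sup>2 = w (2 - w)\<close>.\<close>

lemma free_difference:
  fixes x :: "'a :: idom"
  defines "w \<equiv> x ^ 9"
  assumes "l * (1 - w) ^ 2 = w * ((1 - w) * (9 * w * (l + 3) + w * (x * l')) + 9 * w * (1 + w * (l + 3))
      + (1 - w) * (l + 7) * (1 + w * (l + 3)) + (1 - w) ^ 2 * (l + 3))"
    and "w * ((1 - w) * (9 * w * (m + 3) + w * (x * m')) + 9 * w * (1 + w * (m + 3))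
      + (1 - w) * (m + 7) * (1 + w * (m + 3)) + (1 - w) ^ 2 * (m + 3)) - m * (1 - w) ^ 2 = v"
  shows "(l - m) - x * (x ^ 8 * (2 - w + 9 * w * (1 - w) + 9 * w ^ 2 + (1 - w) * (1 + w * (l + 3) + (m + 7) * w)
    + (1 - w) ^ 2) * (l - m) + x * (x ^ 8 * (1 - w) * w * (l' - m'))) = v"
proof -
  have w: "x * x ^ 8 = w" by (simp add: w_def power_eq_if)
  have "x * (x ^ 8 * (2 - w + 9 * w * (1 - w) + 9 * w ^ 2 + (1 - w) * (1 + w * (l + 3) + (m + 7) * w)
      + (1 - w) ^ 2) * (l - m) + x * (x ^ 8 * (1 - w) * w * (l' - m')))
    = w * (2 - w + 9 * w * (1 - w) + 9 * w ^ 2 + (1 - w) * (1 + w * (l + 3) + (m + 7) * w)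
      + (1 - w) ^ 2) * (l - m) + w * (1 - w) * w * (x * l' - x * m')"
    unfolding w[symmetric] by algebra
  then show ?thesis using assms(2,3) by algebra
qed

lemma free_series_mod8:
  "(8 :: int fps) dvd fps_X * (subgroup_series Gamma33_rels - subgroup_series PSL_rels) - free_value (fps_X ^ 9)"
proof -
  define L where "L = fps_X * (subgroup_series Gamma33_rels - subgroup_series PSL_rels)"
  define w where "w = (fps_X ^ 9 :: int fps)"
  define M where "M = free_value w"
  have "fps_X * fps_deriv w = 9 * w"
    unfolding w_def deriv_X_power by (simp add: power_eq_if)
  \<comment> \<open>The operator \<open>X d/dX\<close> only rescales powers of \<open>w\<close>,
    which makes the claim polynomial in \<open>w\<close>.\<close>
  then have wk: "fps_X * fps_deriv (w ^ k) = of_nat (9 * k) * w ^ k" for k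
  proof (induction k)
    case (Suc k)
    have "fps_X * fps_deriv (w ^ Suc k) = (fps_X * fps_deriv w) * w ^ k + w * (fps_X * fps_deriv (w ^ k))"
      by (simp add: algebra_simps)
    also have "\<dots> = of_nat (9 * Suc k) * w ^ Suc k"
      unfolding Suc.IH[OF Suc.prems] Suc.prems by (simp add: algebra_simps)
    finally show ?case .
  qed simp
  have M': "fps_X * fps_deriv M = free_value_theta w"
    unfolding M_def free_value_def free_value_theta_def
    by (simp add: deriv_numeral_mult distrib_left mult.left_commute[of fps_X] wk \<open>fps_X * fps_deriv w = 9 * w\<close>
        del: fps_deriv_power)
  have "fps_X * fps_deriv (1 + w * (L + 3)) = (fps_X * fps_deriv w) * (L + 3) + w * (fps_X * fps_deriv L)"
    by (simp add: deriv_numeral algebra_simps)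
  then have "fps_X * fps_deriv (1 + w * (L + 3)) = 9 * w * (L + 3) + w * (fps_X * fps_deriv L)"
    unfolding \<open>fps_X * fps_deriv w = 9 * w\<close> .
  then have "L * (1 - w) ^ 2 = w * ((1 - w) * (9 * w * (L + 3) + w * (fps_X * fps_deriv L)) + 9 * w * (1 + w * (L + 3))
      + (1 - w) * (L + 7) * (1 + w * (L + 3)) + (1 - w) ^ 2 * (L + 3))"
    using free_riccati unfolding L_def[symmetric] w_def[symmetric] by simp
  then have "8 dvd (L - M) - fps_X * (fps_X ^ 8 * (2 - w + 9 * w * (1 - w) + 9 * w ^ 2
      + (1 - w) * (1 + w * (L + 3) + (M + 7) * w) + (1 - w) ^ 2) * (L - M)
      + fps_X * (fps_X ^ 8 * (1 - w) * w * (fps_deriv (L - M))))"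
    using free_difference[of L fps_X "fps_deriv L" M "fps_deriv M", folded w_def, OF _
        free_mod8_identity[of w, folded M_def M']]
    by (simp only: fps_deriv_sub dvd_triv_left)
  from dvd_fps_contraction[OF this] show ?thesis unfolding L_def M_def w_def .
qed

section \<open>Return to Laurent series\<close>

lemma Gamma33_eq_presented_group: "Gamma33 = presented_group Gamma33_rels"
  by (simp add: Gamma33_def Gamma33_rels_def)

text \<open>The congruences for \<open>X\<^sup>7 S\<^sub>1\<close> and \<open>X S\<^sub>2\<close>
  are brought to the common factor \<open>X\<^sup>8\<close> and added.\<close>

lemma Gamma33_series_mod8:
  "(8 :: int fps) dvd fps_X ^ 8 * subgroup_series Gamma33_rels
    - (fps_X * modular_value fps_X Phi_fps + fps_X ^ 7 * free_value (fps_X ^ 9))"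
proof -
  obtain u v where uv: "fps_X ^ 7 * subgroup_series PSL_rels - modular_value fps_X Phi_fps = 8 * u"
    "fps_X * (subgroup_series Gamma33_rels - subgroup_series PSL_rels) - free_value (fps_X ^ 9) = 8 * v"
    using modular_series_mod8 free_series_mod8 by (elim dvdE)
  have "fps_X ^ 8 * subgroup_series Gamma33_rels
    - (fps_X * modular_value fps_X Phi_fps + fps_X ^ 7 * free_value (fps_X ^ 9))
    = 8 * (fps_X * u + fps_X ^ 7 * v)"
    using uv by algebra
  then show ?thesis by (rule dvdI)
qed

text \<open>Multiplication by \<open>zpow (int m)\<close> merely shifts indices, so a congruence
  between power series can be divided by it even if \<open>h\<close> has a pole.\<close>

lemma fls_cong_if_dvd_shift:
  assumes "numeral k dvd fps_X ^ m * f - g" and "zpow (int m) * h = fps_to_fls g"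
  shows "fls_cong (numeral k) (fps_to_fls f) h"
  unfolding fls_cong_def
proof
  fix i
  obtain q where "fps_X ^ m * f - g = numeral k * q" using assms(1) by (elim dvdE)
  then have "fps_X ^ m * f = g + numeral k * q" by (simp add: algebra_simps)
  then have "fps_to_fls (fps_X ^ m * f) = fps_to_fls (g + numeral k * q)" by simp
  moreover have "fps_to_fls (fps_X ^ m :: int fps) = zpow (int m)"
    by (simp add: fps_to_fls_power fls_X_power_conv_shift_1)
  ultimately have "zpow (int m) * fps_to_fls f = zpow (int m) * h + numeral k * fps_to_fls q"
    by (simp only: fls_times_fps_to_fls fps_to_fls_plus fps_to_fls_numeral assms(2))
  then have "fls_nth (zpow (int m) * fps_to_fls f) (i + int m)
    = fls_nth (zpow (int m) * h) (i + int m) + fls_nth (numeral k * fps_to_fls q) (i + int m)"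
    by simp
  moreover have "fls_nth (numeral k * fps_to_fls q) j = numeral k * fls_nth (fps_to_fls q) j" for j
    unfolding fls_const_numeral[symmetric] by (rule fls_mult_const_nth)
  ultimately have "fls_nth (fps_to_fls f) i = fls_nth h i + numeral k * fls_nth (fps_to_fls q) (i + int m)"
    unfolding fls_X_intpow_times_conv_shift by simp
  then show "[fls_nth (fps_to_fls f) i = fls_nth h i] (mod numeral k)"
    by (simp add: cong_def)
qed

theorem theorem30:
  shows "fls_cong 8
    (fps_to_fls (Abs_fps (\<lambda>n. int (num_subgroups Gamma33 (n + 1)))))
    (4 * zpow 62 + 4 * zpow 53 + 4 * zpow 44 + 4 * zpow 35 + 6 * zpow 26 + 4 * zpow 20
      + 4 * zpow 14 + 4 * zpow 12 + 4 * zpow 11 + 4 * zpow 10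
      + 4 * zpow 9 + 4 * zpow 5 + 6 * zpow 4 + 4 * zpow 3 + 4 * zpow 2 + 4 * zpow 1 + 6
      + 7 * zpow (-2) + 7 * zpow (-3) + 3 * zpow (-5) + 6 * zpow (-6)
     + (4 * zpow 3 + 4 * zpow 2 + 4 * zpow (-1) + 6 * zpow (-3) + 6 * zpow (-4)
        + 6 * zpow (-6) + 2 * zpow (-7)) * Phi
     + (4 * zpow 8 + 4 * zpow 4 + 4 * zpow 3 + 6 * zpow 2 + 4 + 4 * zpow (-1)
        + 6 * zpow (-2) + 2 * zpow (-3) + 5 * zpow (-4) + 6 * zpow (-5)
        + 6 * zpow (-6) + 5 * zpow (-7)) * Phi ^ 2
     + (4 * zpow 2 + 4 * zpow (-2) + 4 * zpow (-3) + 2 * zpow (-4) + 4 * zpow (-5)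
        + 4 * zpow (-6) + 2 * zpow (-7)) * Phi ^ 3)" (is "fls_cong 8 _ ?R")
proof -
  \<comment> \<open>This equality is exact, not just modulo 8. It explains the representatives -2
    and -4 at \<open>x\<^sup>1\<^sup>5\<close> and \<open>x\<^sup>2\<^sup>4\<close> in
    \<open>modular_coeff0\<close>: they cancel \<open>2 w\<close> and \<open>4 w\<^sup>2\<close> of
    \<open>free_value\<close>.\<close>
  have "zpow (int 8) * ?R = fps_to_fls (fps_X * modular_value fps_X Phi_fps + fps_X ^ 7 * free_value (fps_X ^ 9))"
  proof -
    \<comment> \<open>A local name for the powers of \<open>z\<close>, to which only the rules for
      adding exponents apply.\<close>
    define zp :: "int \<Rightarrow> int fls" where "zp = (\<lambda>k. zpow k)"
    have zp: "zpow k = zp k" for k by (simp add: zp_def)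
    have mult: "zp i * zp j = zp (i + j)" for i j
      unfolding zp_def by (rule fls_X_intpow_times_fls_X_intpow)
    have mult': "zp i * (zp j * c) = zp (i + j) * c" for i j c
      unfolding mult[symmetric] by (simp only: mult.assoc)
    have X: "fps_to_fls (fps_X :: int fps) = zp 1" and Xn: "fps_to_fls (fps_X ^ n :: int fps) = zp (int n)" for n
      by (simp_all add: zp_def fps_to_fls_power fls_X_power_conv_shift_1 flip: fls_X_conv_shift_1)
    show ?thesis
      unfolding zp modular_value_def free_value_def
        modular_coeff0_def modular_coeff1_def modular_coeff2_def modular_coeff3_def
        power_mult[symmetric] fps_to_fls_plus fps_to_fls_minus fls_times_fps_to_fls fps_to_fls_numeral
        fps_to_fls_power[of Phi_fps] Phi_def[symmetric] X Xn
      by (simp add: distrib_left distrib_right mult.assoc mult.left_commute[of "zp _" "numeral _"] mult mult'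
          right_diff_distrib left_diff_distrib)
  qed
  moreover have "Abs_fps (\<lambda>n. int (num_subgroups Gamma33 (n + 1))) = subgroup_series Gamma33_rels"
    by (simp add: subgroup_series_def Gamma33_eq_presented_group)
  ultimately show ?thesis
    using fls_cong_if_dvd_shift[OF Gamma33_series_mod8] by (simp only:)
qed

end
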